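(* Let $\mathfrak{M}$ be a weight matrix. (Roumieu case) If $\mathfrak{M}$ is R-regular and has R-moderate growth, then the ring ${}_1\mathcal{E}^{\{\mathfrak{M}\}}$ has property $(\mathscr{D})$. (Beurling case) If $\mathfrak{M}$ is B-regular and has B-moderate growth, then the ring ${}_1\mathcal{E}^{(\mathfrak{M})}$ has property $(\mathscr{D})$.
   Context: A weight sequence is a sequence $M=(M_k)_{k\ge0}$ of positive reals with $M_k=\mu_1\cdots\mu_k$, $M_0=1$, where $(\mu_k)$ is positive and increasing with $\mu_0=1$, and $M_k^{1/k}\to\infty$; lowercase $m_k:=M_k/k!$ (similarly $n_k=N_k/k!$). For a positive sequence $m$ with $m_0=1$, $m_k^{1/k}\to\infty$, $m_{k+1}/m_k\to\infty$, set $h_m(t):=\inf_k m_kt^k$ ($t>0$), $\overline\Gamma_m(t):=\min\{k:h_m(t)=m_kt^k\}$, $\underline\Gamma_m(t):=\min\{k:m_{k+1}/m_k\ge1/t\}$. A weight matrix $\mathfrak{M}$ is a family of weight sequences totally ordered by the pointwise order. With $m_k^{1/k}\to\infty$ for all $M\in\mathfrak{M}$, $\mathfrak{M}$ is R-regular if (a) $\forall M\in\mathfrak{M}\ \exists N\in\mathfrak{M}\ \exists C\ge1\ \forall j: M_{j+1}\le C^{j+1}N_j$ and (b) $\forall M\ \exists N\ \exists C\ge1\ \forall t>0: \overline\Gamma_n(Ct)\le\underline\Gamma_m(t)$; it is B-regular if (a') $\forall M\ \exists N\ \exists C\ge1\ \forall j: N_{j+1}\le C^jM_j$ and (b') $\forall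 M\ \exists N\ \exists C\ge1\ \forall t>0:\overline\Gamma_m(Ct)\le\underline\Gamma_n(t)$. For positive sequences let $\mathrm{mg}(M,N):=\sup_{j,k\ge0,j+k\ge1}(M_{j+k}/(N_jN_k))^{1/(j+k)}\in(0,\infty]$. $\mathfrak{M}$ has R-moderate growth if $\forall M\in\mathfrak{M}\ \exists N\in\mathfrak{M}:\mathrm{mg}(M,N)<\infty$, and B-moderate growth if $\forall M\ \exists N:\mathrm{mg}(N,M)<\infty$. For open $U\subseteq\mathbb{R}^d$ and $\sigma>0$, $\mathcal{B}^M_\sigma(U)$ is the set of $f\in C^\infty(U)$ with $\sup_{x\in U,\alpha}|\partial^\alpha f(x)|/(\sigma^{|\alpha|}M_{|\alpha|})<\infty$; $\mathcal{B}^{\{\mathfrak{M}\}}(U):=\bigcup_{M\in\mathfrak{M}}\bigcup_{\sigma>0}\mathcal{B}^M_\sigma(U)$, $\mathcal{B}^{(\mathfrak{M})}(U):=\bigcap_{M\in\mathfrak{M}}\bigcap_{\sigma>0}\mathcal{B}^M_\sigma(U)$, and $\mathcal{E}^{\{\mathfrak{M}\}}(U)$ (resp. $\mathcal{E}^{(\mathfrak{M})}(U)$) is the set of $f:U\to\mathbb{C}$ with $f|_V\in\mathcal{B}^{\{\mathfrak{M}\}}(V)$ (resp. $\mathcal{B}^{(\mathfrak{M})}(V)$) for every relatively compact open $V\subseteq U$. ${}_d\mathcal{E}^{\{\mathfrak{M}\}}$, ${}_d\mathcal{E}^{(\mathfrak{M})}$ are the rings of germs at $0\in\mathbb{R}^d$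 of such complex valued functions. A subring $\mathcal{S}$ of the ring of germs at $0\in\mathbb{R}^d$ of complex valued $C^\infty$ functions has property $(\mathscr{D})$ if for every complex valued function germ $f$ at $0$: if $f^j,f^{j+1}\in\mathcal{S}$ for some integer $j\ge1$, then $f\in\mathcal{S}$. *)

theory Defs
  imports "HOL-Analysis.Analysis"
begin

definition weight_sequence :: "(nat \<Rightarrow> real) \<Rightarrow> bool" where
  "weight_sequence M \<longleftrightarrow>
     (\<exists>mu :: nat \<Rightarrow> real. mu 0 = 1 \<and> (\<forall>k. mu k > 0) \<and> mono mu \<and>
        (\<forall>k. M k = (\<Prod>i\<in>{1..k}. mu i))) \<and>
     filterlim (\<lambda>k. M k powr (1 / real k)) at_top sequentially"

definition weight_matrix :: "(nat \<Rightarrow> real) set \<Rightarrow> bool" where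
  "weight_matrix MM \<longleftrightarrow> MM \<noteq> {} \<and> (\<forall>M\<in>MM. weight_sequence M) \<and>
     (\<forall>M\<in>MM. \<forall>N\<in>MM. (\<forall>k. M k \<le> N k) \<or> (\<forall>k. N k \<le> M k))"

definition lower :: "(nat \<Rightarrow> real) \<Rightarrow> nat \<Rightarrow> real" where
  "lower M k = M k / fact k"

definition h_fun :: "(nat \<Rightarrow> real) \<Rightarrow> real \<Rightarrow> real" where
  "h_fun m t = Inf (range (\<lambda>k. m k * t ^ k))"

definition Gamma_over :: "(nat \<Rightarrow> real) \<Rightarrow> real \<Rightarrow> nat" where
  "Gamma_over m t = (LEAST k. h_fun m t = m k * t ^ k)"

definition Gamma_under :: "(nat \<Rightarrow> real) \<Rightarrow> real \<Rightarrow> nat" where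
  "Gamma_under m t = (LEAST k. m (Suc k) / m k \<ge> 1 / t)"

definition R_regular :: "(nat \<Rightarrow> real) set \<Rightarrow> bool" where
  "R_regular MM \<longleftrightarrow>
     (\<forall>M\<in>MM. filterlim (\<lambda>k. lower M k powr (1 / real k)) at_top sequentially) \<and>
     (\<forall>M\<in>MM. \<exists>N\<in>MM. \<exists>C\<ge>1. \<forall>j. M (Suc j) \<le> C ^ (Suc j) * N j) \<and>
     (\<forall>M\<in>MM. \<exists>N\<in>MM. \<exists>C\<ge>1. \<forall>t>0.
        Gamma_over (lower N) (C * t) \<le> Gamma_under (lower M) t)"

definition B_regular :: "(nat \<Rightarrow> real) set \<Rightarrow> bool" where
  "B_regular MM \<longleftrightarrow>
     (\<forall>M\<in>MM. filterlim (\<lambda>k. lower M k powr (1 / real k)) at_top sequentially) \<and>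
     (\<forall>M\<in>MM. \<exists>N\<in>MM. \<exists>C\<ge>1. \<forall>j. N (Suc j) \<le> C ^ j * M j) \<and>
     (\<forall>M\<in>MM. \<exists>N\<in>MM. \<exists>C\<ge>1. \<forall>t>0.
        Gamma_over (lower M) (C * t) \<le> Gamma_under (lower N) t)"

definition mg_finite :: "(nat \<Rightarrow> real) \<Rightarrow> (nat \<Rightarrow> real) \<Rightarrow> bool" where
  "mg_finite M N \<longleftrightarrow> (\<exists>C. \<forall>j k. j + k \<ge> 1 \<longrightarrow>
      (M (j + k) / (N j * N k)) powr (1 / real (j + k)) \<le> C)"

definition R_moderate_growth :: "(nat \<Rightarrow> real) set \<Rightarrow> bool" where
  "R_moderate_growth MM \<longleftrightarrow> (\<forall>M\<in>MM. \<exists>N\<in>MM. mg_finite M N)"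

definition B_moderate_growth :: "(nat \<Rightarrow> real) set \<Rightarrow> bool" where
  "B_moderate_growth MM \<longleftrightarrow> (\<forall>M\<in>MM. \<exists>N\<in>MM. mg_finite N M)"

definition B_class :: "(nat \<Rightarrow> real) \<Rightarrow> real \<Rightarrow> real set \<Rightarrow> (real \<Rightarrow> complex) \<Rightarrow> bool" where
  "B_class M \<sigma> U f \<longleftrightarrow>
     (\<exists>D :: nat \<Rightarrow> real \<Rightarrow> complex.
        (\<forall>x\<in>U. D 0 x = f x) \<and>
        (\<forall>k. \<forall>x\<in>U. (D k has_vector_derivative D (Suc k) x) (at x)) \<and>
        (\<exists>C. \<forall>k. \<forall>x\<in>U. norm (D k x) / (\<sigma> ^ k * M k) \<le> C))"

definition B_roumieu :: "(nat \<Rightarrow> real) set \<Rightarrow> real set \<Rightarrow> (real \<Rightarrow> complex) \<Rightarrow> bool" where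
  "B_roumieu MM U f \<longleftrightarrow> (\<exists>M\<in>MM. \<exists>\<sigma>>0. B_class M \<sigma> U f)"

definition B_beurling :: "(nat \<Rightarrow> real) set \<Rightarrow> real set \<Rightarrow> (real \<Rightarrow> complex) \<Rightarrow> bool" where
  "B_beurling MM U f \<longleftrightarrow> (\<forall>M\<in>MM. \<forall>\<sigma>>0. B_class M \<sigma> U f)"

definition rel_compact_open :: "real set \<Rightarrow> real set \<Rightarrow> bool" where
  "rel_compact_open V U \<longleftrightarrow> open V \<and> compact (closure V) \<and> closure V \<subseteq> U"

definition E_roumieu :: "(nat \<Rightarrow> real) set \<Rightarrow> real set \<Rightarrow> (real \<Rightarrow> complex) \<Rightarrow> bool" where
  "E_roumieu MM U f \<longleftrightarrow> (\<forall>V. rel_compact_open V U \<longrightarrow> B_roumieu MM V f)"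

definition E_beurling :: "(nat \<Rightarrow> real) set \<Rightarrow> real set \<Rightarrow> (real \<Rightarrow> complex) \<Rightarrow> bool" where
  "E_beurling MM U f \<longleftrightarrow> (\<forall>V. rel_compact_open V U \<longrightarrow> B_beurling MM V f)"

text \<open>Germs at 0 in R: a germ (given by any representative f) lies in the ring
  iff some representative on some open neighbourhood U of 0 lies in E(U).\<close>
definition germ_roumieu :: "(nat \<Rightarrow> real) set \<Rightarrow> (real \<Rightarrow> complex) \<Rightarrow> bool" where
  "germ_roumieu MM f \<longleftrightarrow> (\<exists>U. open U \<and> 0 \<in> U \<and> E_roumieu MM U f)"

definition germ_beurling :: "(nat \<Rightarrow> real) set \<Rightarrow> (real \<Rightarrow> complex) \<Rightarrow> bool" where
  "germ_beurling MM f \<longleftrightarrow> (\<exists>U. open U \<and> 0 \<in> U \<and> E_beurling MM U f)"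

definition property_D :: "((real \<Rightarrow> complex) \<Rightarrow> bool) \<Rightarrow> bool" where
  "property_D S \<longleftrightarrow> (\<forall>f :: real \<Rightarrow> complex. \<forall>j :: nat. j \<ge> 1 \<and>
      S (\<lambda>x. f x ^ j) \<and> S (\<lambda>x. f x ^ Suc j) \<longrightarrow> S f)"

end

theory Submission
  imports Defs "HOL-Complex_Analysis.Complex_Analysis"
begin

text \<open>
  Near a point \<open>x0\<close> and at a scale \<open>\<epsilon>\<close>, replace \<open>f ^ j\<close> and \<open>f ^ Suc j\<close> by Taylor polynomials \<open>P\<close>, \<open>Q\<close> of
  the degree that regularity of the matrix makes optimal. They are bounded on a complex disc of radius
  comparable to \<open>\<epsilon>\<close>, and \<open>Q ^ j - P ^ Suc j\<close> is small there. So \<open>Q / P\<close> is bounded where \<open>\<bar>P\<bar>\<close> is not too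
  small, and small where \<open>\<bar>P\<bar>\<close> is moderately small; cutting it off at a level of \<open>\<bar>P\<bar>\<close> and keeping the
  outer Cauchy integral gives a bounded holomorphic function close to \<open>f\<close> on the real axis. Its error
  is a fixed power of the Taylor error, and moderate growth turns a power of the error into an
  admissible error for another sequence of the matrix. Comparing the approximations at dyadic scales
  gives the derivatives of \<open>f\<close> with the required bounds.
\<close>

section \<open>Cauchy integrals over grid squares\<close>

text \<open>Away from the zeros of \<open>f ^ j\<close> the function is the quotient of its two
  powers. The difficulty sits at the zeros: nothing is known of \<open>f\<close> there, not even
  continuity, and \<open>Q / P\<close> may have poles at places unrelated to \<open>f\<close>. What
  tames them is the approximate relation between \<open>Q ^ j\<close> and \<open>P ^ Suc j\<close>:
  it makes \<bar>Q / P\<bar>^j comparable to \<bar>P\<bar>, so the quotient behaves like a function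
  vanishing together with \<open>P\<close>, down to a level of \<bar>P\<bar> fixed by the error. A
  cut-off by level works without any information on the position of the zeros. Two losses determine
  the exponents. The quotient is small only like the j-th root of the level, and the level itself is
  a root of the Taylor error; this costs the exponent \<open>4 * j * Suc j\<close>. Comparing two
  approximants off the real axis costs a further fourth root. Together they give
  \<open>16 * j * Suc j\<close>, the power that moderate growth has to absorb.\<close>

definition corner :: "real \<Rightarrow> int \<Rightarrow> int \<Rightarrow> complex" where
  "corner a p q = Complex ((of_int p - 1/2) * a) ((of_int q - 1/2) * a)"

abbreviation grid_sq :: "real \<Rightarrow> int \<Rightarrow> int \<Rightarrow> complex set" where
  "grid_sq a p q \<equiv> cbox (corner a p q) (corner a (p+1) (q+1))"

text \<open>Edges run right or up, never round a square, so the two squares sharing an edge refer to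
  the same integral with opposite signs. Summation by parts relies on this.\<close>

definition hedge :: "real \<Rightarrow> int \<Rightarrow> int \<Rightarrow> real \<Rightarrow> complex" where
  "hedge a p q = linepath (corner a p q) (corner a (p+1) q)"

definition vedge :: "real \<Rightarrow> int \<Rightarrow> int \<Rightarrow> real \<Rightarrow> complex" where
  "vedge a p q = linepath (corner a p q) (corner a p (q+1))"

text \<open>With \<open>c\<close> the indicator of good squares and \<open>V\<close> the edge
  integrals along a row, an interior edge survives only where the indicator changes.\<close>

lemma sum_by_parts_int:
  fixes c V :: "int \<Rightarrow> 'a::comm_ring_1"
  assumes "a \<le> b"
  shows "(\<Sum>p\<in>{a..b}. c p * (V (p+1) - V p)) =
     c b * V (b+1) - c a * V a - (\<Sum>p\<in>{a..<b}. (c (p+1) - c p) * V (p+1))"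
  using assms
proof (induction b rule: int_ge_induct)
  case base
  show ?case by (simp add: algebra_simps)
next
  case (step b)
  have 1: "{a..b+1} = insert (b+1) {a..b}" and 2: "{a..<b+1} = insert b {a..<b}"
    using step by auto
  have A: "(\<Sum>p\<in>{a..b+1}. c p * (V (p+1) - V p)) = c (b+1) * (V (b+1+1) - V (b+1)) + (\<Sum>p\<in>{a..b}. c p * (V (p+1) - V p))"
    unfolding 1 by (subst sum.insert) auto
  have B: "(\<Sum>p\<in>{a..<b+1}. (c (p+1) - c p) * V (p+1)) = (c (b+1) - c b) * V (b+1) + (\<Sum>p\<in>{a..<b}. (c (p+1) - c p) * V (p+1))"
    unfolding 2 by (subst sum.insert) auto
  show ?case unfolding A B step.IH by (simp add: algebra_simps)
qed

text \<open>Each change of sign produces a root by the intermediate value theorem. The asymmetric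
  test (< 0 against \<ge> 0) excludes one endpoint of the cell, always the same one within each
  count, so the roots lie in disjoint half-open cells and are distinct. The real function is
  presented as the restriction of a complex polynomial so that the degree bounds its roots.\<close>

lemma card_sign_changes:
  fixes r :: "real \<Rightarrow> real" and R :: "complex poly"
  assumes a: "a > 0" and R: "\<And>x::real. poly R (of_real x) = of_real (r x)" and deg: "degree R \<le> d"
  shows "card {p\<in>{m..<n::int}. r (of_int p * a) < 0 \<and> r (of_int (p+1) * a) \<ge> 0} \<le> d" (is "card ?A \<le> d")
    and "card {p\<in>{m..<n::int}. r (of_int p * a) \<ge> 0 \<and> r (of_int (p+1) * a) < 0} \<le> d" (is "card ?B \<le> d")
proof -
  have r: "r = (\<lambda>x. Re (poly R (of_real x)))" by (simp add: R)
  have cont: "continuous_on S r" for S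
    unfolding r by (intro continuous_intros)
  have nz: "R \<noteq> 0" if "r x \<noteq> 0" for x
    using R[of x] that by auto
  show "card ?A \<le> d"
  proof (cases "?A = {}")
    case True
    show ?thesis unfolding True by simp
  next
    case False
    then have nz: "R \<noteq> 0" using nz by force
    have "\<exists>x. of_int p * a < x \<and> x \<le> of_int (p+1) * a \<and> r x = 0" if "p \<in> ?A" for p
    proof -
      have "\<exists>x\<ge>of_int p * a. x \<le> of_int (p+1) * a \<and> r x = 0"
        using that a by (intro IVT' cont) (auto simp: algebra_simps)
      then obtain x where "x \<ge> of_int p * a" "x \<le> of_int (p+1) * a" "r x = 0" by blast
      moreover have "x \<noteq> of_int p * a" using \<open>r x = 0\<close> that by auto
      ultimately show ?thesis by force
    qed
    then have "\<forall>p\<in>?A. \<exists>x. of_int p * a < x \<and> x \<le> of_int (p+1) * a \<and> r x = 0" by blast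
    from bchoice[OF this] obtain X where X: "\<And>p. p \<in> ?A \<Longrightarrow> of_int p * a < X p \<and> X p \<le> of_int (p+1) * a \<and> r (X p) = 0" by blast
    have inj: "inj_on (\<lambda>p. complex_of_real (X p)) ?A"
    proof (rule inj_onI)
      fix p q assume pq: "p \<in> ?A" "q \<in> ?A" "complex_of_real (X p) = of_real (X q)"
      then have "of_int p * a < of_int (q+1) * a" "of_int q * a < of_int (p+1) * a"
        using X[of p] X[of q] by force+
      then show "p = q" using a by (simp add: mult_less_cancel_right)
    qed
    have "card ?A \<le> card {x. poly R x = 0}"
      using X by (intro card_inj_on_le[OF inj]) (auto simp: R poly_roots_finite[OF nz])
    also have "\<dots> \<le> d" using card_poly_roots_bound[OF nz] deg by linarith
    finally show ?thesis .
  qed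
  show "card ?B \<le> d"
  proof (cases "?B = {}")
    case True
    show ?thesis unfolding True by simp
  next
    case False
    then have nz: "R \<noteq> 0" using nz by force
    have "\<exists>x. of_int p * a \<le> x \<and> x < of_int (p+1) * a \<and> r x = 0" if "p \<in> ?B" for p
    proof -
      have "\<exists>x\<ge>of_int p * a. x \<le> of_int (p+1) * a \<and> r x = 0"
        using that a by (intro IVT2' cont) (auto simp: algebra_simps)
      then obtain x where "x \<ge> of_int p * a" "x \<le> of_int (p+1) * a" "r x = 0" by blast
      moreover have "x \<noteq> of_int (p+1) * a" using \<open>r x = 0\<close> that by auto
      ultimately show ?thesis by force
    qed
    then have "\<forall>p\<in>?B. \<exists>x. of_int p * a \<le> x \<and> x < of_int (p+1) * a \<and> r x = 0" by blast
    from bchoice[OF this] obtain X where X: "\<And>p. p \<in> ?B \<Longrightarrow> of_int p * a \<le> X p \<and> X p < of_int (p+1) * a \<and> r (X p) = 0" by blast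
    have inj: "inj_on (\<lambda>p. complex_of_real (X p)) ?B"
    proof (rule inj_onI)
      fix p q assume pq: "p \<in> ?B" "q \<in> ?B" "complex_of_real (X p) = of_real (X q)"
      then have "of_int p * a < of_int (q+1) * a" "of_int q * a < of_int (p+1) * a"
        using X[of p] X[of q] by force+
      then show "p = q" using a by (simp add: mult_less_cancel_right)
    qed
    have "card ?B \<le> card {x. poly R x = 0}"
      using X by (intro card_inj_on_le[OF inj]) (auto simp: R poly_roots_finite[OF nz])
    also have "\<dots> \<le> d" using card_poly_roots_bound[OF nz] deg by linarith
    finally show ?thesis .
  qed
qed

lemma card_level_transitions:
  fixes P :: "complex poly" and b c :: complex
  assumes a: "a > 0" and deg: "degree P \<le> k" and s: "s > 0"
  shows "card {p\<in>{m..<n::int}. (s \<le> norm (poly P (b + of_real (of_int (p+1) * a) * c))) \<noteq> (s \<le> norm (poly P (b + of_real (of_int p * a) * c)))} \<le> 4 * k"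
    (is "card ?S \<le> _")
proof -
  define p1 where "p1 = P \<circ>\<^sub>p [:b, c:]"
  \<comment> \<open>Conjugating the coefficients conjugates the values on the real line, so there
    the product is \<bar>P\<bar>^2 and the whole is a polynomial of degree at most
    \<open>2 * k\<close>. Upward and downward crossings are counted separately, hence
    \<open>4 * k\<close>.\<close>
  define R where "R = p1 * map_poly cnj p1 - [:of_real (s^2):]"
  define r where "r = (\<lambda>x::real. (norm (poly P (b + of_real x * c)))^2 - s^2)"
  have p1: "poly p1 (of_real x) = poly P (b + of_real x * c)" for x
    by (simp add: p1_def poly_pcompose)
  have cnjp: "poly (map_poly cnj p1) (of_real x) = cnj (poly p1 (of_real x))" for x
    using poly_cnj[of p1 "of_real x"] by simp
  have R: "poly R (of_real x) = of_real (r x)" for x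
    unfolding R_def r_def by (simp add: cnjp p1 complex_norm_square[symmetric] del: of_real_power)
  have d1: "degree p1 \<le> k"
  proof -
    have "degree p1 \<le> degree P * degree [:b,c:]" unfolding p1_def by (rule degree_pcompose_le)
    also have "\<dots> \<le> degree P * 1" by (intro mult_left_mono) auto
    finally show ?thesis using deg by simp
  qed
  have dR: "degree R \<le> 2 * k"
    unfolding R_def
  proof (rule degree_diff_le)
    have "degree (p1 * map_poly cnj p1) \<le> degree p1 + degree (map_poly cnj p1)" by (rule degree_mult_le)
    also have "degree (map_poly cnj p1) \<le> degree p1" by (simp add: degree_map_poly)
    finally show "degree (p1 * map_poly cnj p1) \<le> 2 * k" using d1 by linarith
  qed simp
  have sq: "s \<le> norm (poly P (b + of_real x * c)) \<longleftrightarrow> r x \<ge> 0" for x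
    using s by (simp add: r_def power_mono_iff)
  have "?S \<subseteq> {p\<in>{m..<n}. r (of_int p * a) < 0 \<and> r (of_int (p+1) * a) \<ge> 0} \<union> {p\<in>{m..<n}. r (of_int p * a) \<ge> 0 \<and> r (of_int (p+1) * a) < 0}" (is "_ \<subseteq> ?A \<union> ?B")
    unfolding sq by auto
  moreover have "finite (?A \<union> ?B)" by (rule finite_subset[of _ "{m..<n}"]) auto
  ultimately have "card ?S \<le> card (?A \<union> ?B)" by (intro card_mono)
  also have "\<dots> \<le> card ?A + card ?B" by (rule card_Un_le)
  also have "\<dots> \<le> 2 * k + 2 * k"
    using card_sign_changes[OF a R dR] by (intro add_mono) blast+
  finally show ?thesis by simp
qed

text \<open>Corners sit at half-integer multiples of \<open>a\<close>, so a grid point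
  \<open>z\<close> is the centre of exactly one square and lies on no edge. The formula therefore
  never meets a pole on the contour, and the alternating edge sum is the boundary integral of the
  square.\<close>

lemma cauchy_square:
  assumes a: "a > 0" and u: "u holomorphic_on grid_sq a p q"
    and z: "z = Complex (of_int p0 * a) (of_int q0 * a)"
  defines "\<phi> \<equiv> \<lambda>w. u w / (w - z)"
  shows "contour_integral (hedge a p q) \<phi> + contour_integral (vedge a (p+1) q) \<phi>
       - contour_integral (hedge a p (q+1)) \<phi> - contour_integral (vedge a p q) \<phi>
     = (if p = p0 \<and> q = q0 then 2 * pi * \<i> * u z else 0)"
proof -
  let ?c = "corner a p q" and ?d = "corner a (p+1) (q+1)"
  have le: "Re ?c < Re ?d" "Im ?c < Im ?d"
    using a by (auto simp: corner_def)
  have zin: "z \<in> box ?c ?d" if "p = p0 \<and> q = q0"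
    using that a by (auto simp: z corner_def in_box_complex_iff algebra_simps)
  have zout: "z \<notin> cbox ?c ?d" if "\<not> (p = p0 \<and> q = q0)"
  proof
    assume "z \<in> cbox ?c ?d"
    then have "(of_int p - 1/2) * a \<le> of_int p0 * a" "of_int p0 * a \<le> (of_int (p+1) - 1/2) * a"
      "(of_int q - 1/2) * a \<le> of_int q0 * a" "of_int q0 * a \<le> (of_int (q+1) - 1/2) * a"
      by (auto simp: z corner_def in_cbox_complex_iff)
    then have "of_int p - 1/2 \<le> real_of_int p0" "real_of_int p0 \<le> of_int (p+1) - 1/2"
      "of_int q - 1/2 \<le> real_of_int q0" "real_of_int q0 \<le> of_int (q+1) - 1/2"
      using a by (simp_all add: mult_le_cancel_right)
    then show False using that by linarith
  qed
  have I: "(\<phi> has_contour_integral (if p = p0 \<and> q = q0 then 2 * pi * \<i> * u z else 0)) (rectpath ?c ?d)"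
  proof (cases "p = p0 \<and> q = q0")
    case True
    have "((\<lambda>w. u w / (w - z)) has_contour_integral (2*pi * \<i> * winding_number (rectpath ?c ?d) z * u z)) (rectpath ?c ?d)"
      using zin[OF True] le
      by (intro Cauchy_integral_formula_convex_simple[OF _ u])
         (auto simp: path_image_rectpath_cbox_minus_box)
    with True zin[OF True] show ?thesis by (simp add: \<phi>_def winding_number_rectpath)
  next
    case False
    have "\<phi> holomorphic_on cbox ?c ?d"
      unfolding \<phi>_def using zout[OF False] by (intro holomorphic_intros u) auto
    then have "(\<phi> has_contour_integral 0) (rectpath ?c ?d)"
      using le by (intro Cauchy_theorem_convex_simple[of _ "cbox ?c ?d"])
        (auto simp: path_image_rectpath_cbox_minus_box)
    with False show ?thesis by auto
  qed
  have e2: "Complex (Re ?d) (Im ?c) = corner a (p+1) q" "Complex (Re ?c) (Im ?d) = corner a p (q+1)"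
    by (simp_all add: corner_def)
  have J: "rectpath ?c ?d = hedge a p q +++ vedge a (p+1) q +++ linepath ?d (corner a p (q+1)) +++ linepath (corner a p (q+1)) ?c"
    by (simp add: rectpath_def Let_def e2 hedge_def vedge_def)
  have int: "\<phi> contour_integrable_on rectpath ?c ?d" using I by (rule has_contour_integral_integrable)
  have ints: "\<phi> contour_integrable_on hedge a p q" "\<phi> contour_integrable_on vedge a (p+1) q"
     "\<phi> contour_integrable_on linepath ?d (corner a p (q+1))" "\<phi> contour_integrable_on linepath (corner a p (q+1)) ?c"
    using int unfolding J hedge_def vedge_def by simp_all
  have r: "contour_integral (linepath ?d (corner a p (q+1))) \<phi> = - contour_integral (hedge a p (q+1)) \<phi>"
     "contour_integral (linepath (corner a p (q+1)) ?c) \<phi> = - contour_integral (vedge a p q) \<phi>"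
    using contour_integral_reversepath[of "linepath ?d (corner a p (q+1))" \<phi>] contour_integral_reversepath[of "linepath (corner a p (q+1)) ?c" \<phi>]
    by (simp_all add: hedge_def vedge_def)
  have "contour_integral (rectpath ?c ?d) \<phi> = contour_integral (hedge a p q) \<phi> + contour_integral (vedge a (p+1) q) \<phi> - contour_integral (hedge a p (q+1)) \<phi> - contour_integral (vedge a p q) \<phi>"
    unfolding J using ints
    by (simp add: hedge_def vedge_def r[unfolded hedge_def vedge_def])
  then show ?thesis using contour_integral_unique[OF I] by simp
qed

text \<open>Serves the outer edges: their Cauchy integrals are holomorphic off the edge although
  \<open>Q / P\<close> may have poles elsewhere, since only continuity on the segment
  enters.\<close>

lemma holomorphic_linepath_cauchy_transform:
  assumes u: "continuous_on (closed_segment c d) u" and S: "open S" "S \<inter> closed_segment c d = {}"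
  shows "(\<lambda>z. contour_integral (linepath c d) (\<lambda>w. u w / (w - z))) holomorphic_on S"
proof -
  have "((\<lambda>z. contour_integral (linepath c d) (\<lambda>w. u w / (w - z))) has_field_derivative
      (of_nat 1 * contour_integral (linepath c d) (\<lambda>w. u w / (w - z) ^ Suc 1))) (at z)" if "z \<in> S" for z
  proof (rule Cauchy_next_derivative(2)[where S = S and B = "norm (d - c)"])
    show "continuous_on (path_image (linepath c d)) u" using u by simp
    show "norm (vector_derivative (linepath c d) (at t)) \<le> norm (d - c)" for t by simp
    fix w assume "w \<in> S - path_image (linepath c d)"
    then have "(\<lambda>x. u x / (x - w)) contour_integrable_on linepath c d"
      by (intro contour_integrable_continuous_linepath continuous_intros u) auto
    then show "((\<lambda>x. u x / (x - w) ^ 1) has_contour_integral contour_integral (linepath c d) (\<lambda>x. u x / (x - w))) (linepath c d)"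
      by (simp add: has_contour_integral_integral)
  qed (use that S in auto)
  then show ?thesis
    using S by (auto simp: holomorphic_on_open)
qed

text \<open>The cap \<open>max 1\<close> reflects that the edges nearest to the pole are still half
  a mesh away. Index differences reach \<open>2 * n\<close>, hence the length of the harmonic sum,
  one for each side of \<open>p0\<close>.\<close>

lemma sum_inverse_distance:
  fixes n p0 :: int
  assumes "\<bar>p0\<bar> \<le> n"
  shows "(\<Sum>p\<in>{-n..n}. 1 / max 1 \<bar>real_of_int (p - p0)\<bar>) \<le> 1 + 2 * harm (nat (2 * n))"
proof -
  let ?f = "\<lambda>p. 1 / max 1 \<bar>real_of_int (p - p0)\<bar>"
  have up: "(\<Sum>p\<in>{p0<..p0 + int m}. ?f p) = harm m" for m
  proof (induction m)
    case (Suc m)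
    have "{p0<..p0 + int (Suc m)} = insert (p0 + int (Suc m)) {p0<..p0 + int m}" by auto
    then show ?case using Suc by (simp add: harm_Suc inverse_eq_divide max_def)
  qed (simp add: harm_def)
  have dn: "(\<Sum>p\<in>{p0 - int m..<p0}. ?f p) = harm m" for m
  proof (induction m)
    case (Suc m)
    have "{p0 - int (Suc m)..<p0} = insert (p0 - int (Suc m)) {p0 - int m..<p0}" by auto
    then show ?case using Suc by (simp add: harm_Suc inverse_eq_divide max_def)
  qed (simp add: harm_def)
  let ?m = "nat (2 * n)"
  have "{-n..n} \<subseteq> insert p0 ({p0<..p0 + int ?m} \<union> {p0 - int ?m..<p0})"
    using assms by auto
  then have "(\<Sum>p\<in>{-n..n}. ?f p) \<le> (\<Sum>p\<in>insert p0 ({p0<..p0 + int ?m} \<union> {p0 - int ?m..<p0}). ?f p)"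
    by (intro sum_mono2) auto
  also have "\<dots> = 1 + ((\<Sum>p\<in>{p0<..p0 + int ?m}. ?f p) + (\<Sum>p\<in>{p0 - int ?m..<p0}. ?f p))"
    by (subst sum.insert, simp, simp, subst sum.union_disjoint) auto
  also have "\<dots> = 1 + 2 * harm ?m" by (simp only: up dn)
  finally show ?thesis .
qed

lemma cmod_le_2I: "\<bar>x\<bar> \<le> 5/4 \<Longrightarrow> \<bar>y\<bar> \<le> 5/4 \<Longrightarrow> cmod (Complex x y) \<le> 2"
proof -
  assume "\<bar>x\<bar> \<le> 5/4" "\<bar>y\<bar> \<le> 5/4"
  then have "x\<^sup>2 \<le> (5/4)\<^sup>2" "y\<^sup>2 \<le> (5/4)\<^sup>2" by (simp_all only: abs_le_square_iff[symmetric])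
  then have "x\<^sup>2 + y\<^sup>2 \<le> 2\<^sup>2" by (simp add: power2_eq_square)
  then show ?thesis by (simp add: complex_norm real_le_lsqrt)
qed

lemma norm_sum_le_card_bound:
  fixes f :: "'a \<Rightarrow> complex"
  assumes "finite A" "\<And>x. x \<in> A \<Longrightarrow> norm (f x) \<le> (if R x then b else 0)" "card {x\<in>A. R x} \<le> k" "b \<ge> 0"
  shows "norm (sum f A) \<le> real k * b"
proof -
  have "norm (sum f A) \<le> (\<Sum>x\<in>A. if R x then b else 0)" by (rule sum_norm_le) (use assms in auto)
  also have "\<dots> = real (card {x\<in>A. R x}) * b"
    using assms(1) by (simp add: sum.If_cases Int_def)
  also have "\<dots> \<le> real k * b" using assms by (intro mult_right_mono) auto
  finally show ?thesis .
qed

lemma hedge_points: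
  assumes "w \<in> closed_segment (corner a p q) (corner a (p+1) q)" "a > 0"
  shows "Im w = (of_int q - 1/2) * a" "(of_int p - 1/2) * a \<le> Re w" "Re w \<le> (of_int p + 1/2) * a"
  using assms by (auto simp: corner_def closed_segment_same_Im closed_segment_eq_real_ivl mult_le_cancel_right algebra_simps split: if_splits)

lemma vedge_points:
  assumes "w \<in> closed_segment (corner a p q) (corner a p (q+1))" "a > 0"
  shows "Re w = (of_int p - 1/2) * a" "(of_int q - 1/2) * a \<le> Im w" "Im w \<le> (of_int q + 1/2) * a"
  using assms by (auto simp: corner_def closed_segment_same_Re closed_segment_eq_real_ivl mult_le_cancel_right algebra_simps split: if_splits)

text \<open>The true bound is (\<bar>m\<bar> - 1/2) a for \<open>m\<close> other than 0; the weaker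
  \<bar>m\<bar> a / 2 holds for all \<open>m\<close> and has the form needed for the harmonic
  sum.\<close>

lemma abs_grid_offset:
  fixes m :: int and a x :: real
  assumes a: "a > 0" and x: "(of_int m - 1/2) * a \<le> x" "x \<le> (of_int m + 1/2) * a"
  shows "a * \<bar>real_of_int m\<bar> / 2 \<le> \<bar>x\<bar>"
proof -
  consider "m = 0" | "real_of_int m \<ge> 1" | "real_of_int m \<le> -1" by linarith
  then show ?thesis
  proof cases
    case 2
    then have "0 \<le> a * (real_of_int m - 1)" using a by simp
    then show ?thesis using 2 x by (simp add: algebra_simps)
  next
    case 3
    then have "a * (real_of_int m + 1) \<le> 0" using a by (simp add: mult_nonneg_nonpos)
    then show ?thesis using 3 x by (simp add: algebra_simps)
  qed simp
qed

lemma corner_length: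
  assumes "a > 0"
  shows "norm (corner a (p+1) q - corner a p q) = a" "norm (corner a p (q+1) - corner a p q) = a"
  using assms by (simp_all add: corner_def cmod_def algebra_simps)

text \<open>
  A substitute for solving a d-bar problem. Call a grid square good if \<open>\<bar>P\<bar> \<ge> s\<close> at its centre and
  sum Cauchy's formula for \<open>Q / P\<close> over the good squares. The edges on the outer boundary yield a
  holomorphic \<open>F\<close>. Only edges between a good and a bad square remain: there \<open>Q / P\<close> is at most \<open>\<beta>\<close>,
  and each row or column has at most \<open>4 k\<close> of them since \<open>\<bar>P\<bar>\<^sup>2 - s\<^sup>2\<close> is a polynomial of degree
  \<open>2 k\<close> on a line. Summing the Cauchy kernel over them costs a harmonic sum.
\<close>

lemma grid_approximation:
  fixes P Q :: "complex poly" and n k :: nat and s B \<beta> :: real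
  defines "u \<equiv> \<lambda>w. poly Q w / poly P w"
  assumes n: "n \<ge> 2" and s: "s > 0" and B: "B \<ge> 0" and \<beta>: "\<beta> \<ge> 0"
    and deg: "degree P \<le> k"
    and lip: "\<And>w c. norm w \<le> 2 \<Longrightarrow> norm c \<le> 2 \<Longrightarrow> norm (w - c) \<le> 1 / real n \<Longrightarrow>
               norm (poly P w - poly P c) \<le> s / 2"
    and uB: "\<And>w. norm w \<le> 2 \<Longrightarrow> s / 2 \<le> norm (poly P w) \<Longrightarrow> norm (u w) \<le> B"
    and u\<beta>: "\<And>w. norm w \<le> 2 \<Longrightarrow> s / 2 \<le> norm (poly P w) \<Longrightarrow> norm (poly P w) \<le> 2 * s \<Longrightarrow> norm (u w) \<le> \<beta>"
  obtains F where "F holomorphic_on ball 0 (3/4)"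
    and "\<And>z. norm z < 3/4 \<Longrightarrow> norm (F z) \<le> 16 * B"
    and "\<And>p. \<bar>p\<bar> \<le> int n \<Longrightarrow>
      norm (F (of_real (of_int p / real n)) - (let z = of_real (of_int p / real n) in if s \<le> norm (poly P z) then u z else 0))
        \<le> 16 * real k * \<beta> * (1 + 2 * harm (2 * n))"
proof -
  define a where "a = 1 / real n"
  have a: "a > 0" and an: "real n * a = 1" and a2: "a \<le> 1/2" using n by (auto simp: a_def field_simps)
  define cen where "cen = (\<lambda>p q. Complex (of_int p * a) (of_int q * a))"
  define good where "good = (\<lambda>p q. s \<le> norm (poly P (cen p q)))"
  define \<xi> where "\<xi> = (\<lambda>p q. if good p q then 1 else (0::complex))"
  define V where "V = (\<lambda>z p q. contour_integral (vedge a p q) (\<lambda>w. u w / (w - z)))"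
  define H where "H = (\<lambda>z p q. contour_integral (hedge a p q) (\<lambda>w. u w / (w - z)))"
  let ?N = "int n" and ?I = "{-int n..int n}"
  \<comment> \<open>What summation by parts leaves at the ends: the edges of the big square, each
    weighted by the indicator of the small square inside. They keep distance at least 1/4 from the
    disc of radius 3/4, so \<open>G\<close> is holomorphic there whatever \<open>P\<close> does
    inside.\<close>
  define G where "G = (\<lambda>z. (\<Sum>q\<in>?I. \<xi> ?N q * V z (?N+1) q - \<xi> (-?N) q * V z (-?N) q)
                     + (\<Sum>p\<in>?I. \<xi> p (-?N) * H z p (-?N) - \<xi> p ?N * H z p (?N+1)))"
  have small: "\<bar>x\<bar> \<le> 5/4" if "(of_int p - 1/2) * a \<le> x" "x \<le> (of_int p + 1/2) * a" "p \<in> ?I" for x p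
  proof -
    have "(of_int p + 1/2) * a \<le> (real n + 1/2) * a" "(- real n - 1/2) * a \<le> (of_int p - 1/2) * a"
      using that(3) a by (intro mult_right_mono; force)+
    then have "x \<le> real n * a + a / 2" "- (real n * a) - a / 2 \<le> x" using that by (auto simp: algebra_simps)
    then show ?thesis using a2 unfolding an by linarith
  qed
  have near: "norm w \<le> 2 \<and> norm (cen p q) \<le> 2 \<and> norm (w - cen p q) \<le> a"
    if "(of_int p - 1/2) * a \<le> Re w" "Re w \<le> (of_int p + 1/2) * a" "(of_int q - 1/2) * a \<le> Im w" "Im w \<le> (of_int q + 1/2) * a"
      "p \<in> ?I" "q \<in> ?I" for w p q
  proof (intro conjI)
    have "norm (Complex (Re w) (Im w)) \<le> 2"
      by (rule cmod_le_2I) (use small that in blast)+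
    then show "norm w \<le> 2" by simp
    show "norm (cen p q) \<le> 2" unfolding cen_def
      by (rule cmod_le_2I[OF small[of p] small[of q]]) (use that a in \<open>auto simp: algebra_simps\<close>)
    have "norm (w - cen p q) \<le> \<bar>Re (w - cen p q)\<bar> + \<bar>Im (w - cen p q)\<bar>" by (rule cmod_le)
    also have "\<dots> \<le> a/2 + a/2" using that by (intro add_mono; simp only: abs_le_iff) (auto simp: cen_def algebra_simps)
    finally show "norm (w - cen p q) \<le> a" by simp
  qed
  have lip': "norm (poly P w - poly P (cen p q)) \<le> s / 2"
    if "(of_int p - 1/2) * a \<le> Re w" "Re w \<le> (of_int p + 1/2) * a" "(of_int q - 1/2) * a \<le> Im w" "Im w \<le> (of_int q + 1/2) * a"
      "p \<in> ?I" "q \<in> ?I" for w p q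
    using near[OF that] lip by (auto simp: a_def)
  \<comment> \<open>Since \<bar>P\<bar> moves by at most \<open>s / 2\<close> within a square,
    testing the centre decides for the whole square. An edge between a good and a bad square
    satisfies this bound and the next one, which is the range where \<open>u\<close> is at most
    \<open>\<beta>\<close>.\<close>
  have goodP: "s / 2 \<le> norm (poly P w)"
    if "(of_int p - 1/2) * a \<le> Re w" "Re w \<le> (of_int p + 1/2) * a" "(of_int q - 1/2) * a \<le> Im w" "Im w \<le> (of_int q + 1/2) * a"
      "p \<in> ?I" "q \<in> ?I" "good p q" for w p q
  proof -
    have "norm (poly P (cen p q)) \<le> norm (poly P w) + norm (poly P w - poly P (cen p q))"
      using norm_triangle_ineq4[of "poly P w" "poly P w - poly P (cen p q)"] by simp
    then show ?thesis using lip'[OF that(1-6)] that(7) by (simp add: good_def)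
  qed
  have badP: "norm (poly P w) \<le> 2 * s"
    if "(of_int p - 1/2) * a \<le> Re w" "Re w \<le> (of_int p + 1/2) * a" "(of_int q - 1/2) * a \<le> Im w" "Im w \<le> (of_int q + 1/2) * a"
      "p \<in> ?I" "q \<in> ?I" "\<not> good p q" for w p q
  proof -
    have "norm (poly P w) \<le> norm (poly P (cen p q)) + norm (poly P w - poly P (cen p q))"
      using norm_triangle_ineq[of "poly P (cen p q)" "poly P w - poly P (cen p q)"] by simp
    then show ?thesis using lip'[OF that(1-6)] that(7) s by (simp add: good_def)
  qed
  have P0: "poly P w \<noteq> 0" if "s / 2 \<le> norm (poly P w)" for w using that s by auto
  have ucont: "continuous_on S u" if "\<And>w. w \<in> S \<Longrightarrow> s / 2 \<le> norm (poly P w)" for S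
    unfolding u_def using that P0 by (intro continuous_intros) auto
  have bound: "norm (contour_integral (linepath c d) (\<lambda>w. u w / (w - z))) \<le> b / \<rho> * a"
    if "norm (d - c) = a" "\<rho> > 0" "\<And>w. w \<in> closed_segment c d \<Longrightarrow> s / 2 \<le> norm (poly P w) \<and> norm (u w) \<le> b \<and> \<rho> \<le> norm (w - z)" for c d z b \<rho>
  proof -
    have "norm (u c) \<le> b" using that(3)[of c] by simp
    then have b: "b \<ge> 0" by (rule order_trans[OF norm_ge_zero])
    have "norm (contour_integral (linepath c d) (\<lambda>w. u w / (w - z))) \<le> b / \<rho> * norm (d - c)"
    proof (rule contour_integral_bound_linepath)
      show "(\<lambda>w. u w / (w - z)) contour_integrable_on linepath c d"
        using that by (intro contour_integrable_continuous_linepath continuous_intros ucont) force+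
      show "0 \<le> b / \<rho>" using b that by simp
      fix w assume "w \<in> closed_segment c d"
      then show "norm (u w / (w - z)) \<le> b / \<rho>"
        using that(2) that(3)[of w] b by (auto simp: norm_divide intro!: frac_le)
    qed
    then show ?thesis using that by simp
  qed
  have hseg: "(of_int p - 1/2) * a \<le> Re w \<and> Re w \<le> (of_int p + 1/2) * a \<and> (of_int q - 1/2) * a \<le> Im w \<and> Im w \<le> (of_int q + 1/2) * a"
    if "w \<in> closed_segment (corner a p q) (corner a (p+1) q)" for w p q
    using hedge_points[OF that a] a by (auto simp: algebra_simps)
  have hseg': "(of_int p - 1/2) * a \<le> Re w \<and> Re w \<le> (of_int p + 1/2) * a \<and> (of_int q - 1/2) * a \<le> Im w \<and> Im w \<le> (of_int q + 1/2) * a"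
    if "w \<in> closed_segment (corner a p (q+1)) (corner a (p+1) (q+1))" for w p q
    using hedge_points[OF that a] a by (auto simp: algebra_simps)
  have vseg: "(of_int p - 1/2) * a \<le> Re w \<and> Re w \<le> (of_int p + 1/2) * a \<and> (of_int q - 1/2) * a \<le> Im w \<and> Im w \<le> (of_int q + 1/2) * a"
    if "w \<in> closed_segment (corner a p q) (corner a p (q+1))" for w p q
    using vedge_points[OF that a] a by (auto simp: algebra_simps)
  have vseg': "(of_int p - 1/2) * a \<le> Re w \<and> Re w \<le> (of_int p + 1/2) * a \<and> (of_int q - 1/2) * a \<le> Im w \<and> Im w \<le> (of_int q + 1/2) * a"
    if "w \<in> closed_segment (corner a (p+1) q) (corner a (p+1) (q+1))" for w p q
    using vedge_points[OF that a] a by (auto simp: algebra_simps)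
  have far: "1/4 \<le> norm (w - z)" if "norm z < 3/4" "1 \<le> \<bar>Re w\<bar> \<or> 1 \<le> \<bar>Im w\<bar>" for w z
  proof -
    have "1 \<le> norm w" using that(2) abs_Re_le_cmod[of w] abs_Im_le_cmod[of w] by linarith
    then show ?thesis using that(1) norm_triangle_ineq2[of w z] by linarith
  qed
  have outer: "(\<lambda>z. c * contour_integral (linepath d e) (\<lambda>w. u w / (w - z))) holomorphic_on ball 0 (3/4) \<and>
        (\<forall>z. norm z < 3/4 \<longrightarrow> norm (c * contour_integral (linepath d e) (\<lambda>w. u w / (w - z))) \<le> 4 * B * a)"
    if "p \<in> ?I" "q \<in> ?I" "c = \<xi> p q" "norm (e - d) = a"
      and seg: "\<And>w. w \<in> closed_segment d e \<Longrightarrow> (of_int p - 1/2) * a \<le> Re w \<and> Re w \<le> (of_int p + 1/2) * a \<and> (of_int q - 1/2) * a \<le> Im w \<and> Im w \<le> (of_int q + 1/2) * a"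
      and far1: "\<And>w. w \<in> closed_segment d e \<Longrightarrow> 1 \<le> \<bar>Re w\<bar> \<or> 1 \<le> \<bar>Im w\<bar>" for p q c d e
  proof (cases "good p q")
    case True
    have g: "s / 2 \<le> norm (poly P w) \<and> norm (u w) \<le> B" if "w \<in> closed_segment d e" for w
      using goodP[of p w q] seg[OF that] True \<open>p \<in> ?I\<close> \<open>q \<in> ?I\<close> near[of p w q] uB by blast
    have "(\<lambda>z. contour_integral (linepath d e) (\<lambda>w. u w / (w - z))) holomorphic_on ball 0 (3/4)"
    proof (rule holomorphic_linepath_cauchy_transform)
      show "continuous_on (closed_segment d e) u" using g by (intro ucont) blast
      show "ball 0 (3/4) \<inter> closed_segment d e = {}"
        using far far1 by fastforce
    qed auto
    moreover have "norm (contour_integral (linepath d e) (\<lambda>w. u w / (w - z))) \<le> 4 * B * a" if "norm z < 3/4" for z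
    proof -
      have "norm (contour_integral (linepath d e) (\<lambda>w. u w / (w - z))) \<le> B / (1/4) * a"
        by (rule bound) (use \<open>norm (e - d) = a\<close> g far far1 that in auto)
      then show ?thesis by (simp add: mult_ac)
    qed
    ultimately show ?thesis using True \<open>c = \<xi> p q\<close> by (simp add: \<xi>_def)
  next
    case False
    then show ?thesis using that B a by (auto simp: \<xi>_def)
  qed
  have on: "(of_int (?N + 1) - 1/2) * a \<ge> 1" "(of_int (-?N) - 1/2) * a \<le> -1"
    using an a by (auto simp: algebra_simps)
  have o1: "(\<lambda>z. \<xi> ?N q * V z (?N+1) q) holomorphic_on ball 0 (3/4) \<and> (\<forall>z. norm z < 3/4 \<longrightarrow> norm (\<xi> ?N q * V z (?N+1) q) \<le> 4 * B * a)" if "q \<in> ?I" for q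
    unfolding V_def vedge_def
  proof (rule outer[of ?N q])
    show "norm (corner a (?N+1) (q+1) - corner a (?N+1) q) = a" using corner_length[OF a] by simp
    fix w assume w: "w \<in> closed_segment (corner a (?N+1) q) (corner a (?N+1) (q+1))"
    show "(of_int ?N - 1/2) * a \<le> Re w \<and> Re w \<le> (of_int ?N + 1/2) * a \<and> (of_int q - 1/2) * a \<le> Im w \<and> Im w \<le> (of_int q + 1/2) * a"
      by (rule vseg'[OF w])
    show "1 \<le> \<bar>Re w\<bar> \<or> 1 \<le> \<bar>Im w\<bar>" using vedge_points(1)[OF w a] on by linarith
  qed (use that in auto)
  have o2: "(\<lambda>z. \<xi> (-?N) q * V z (-?N) q) holomorphic_on ball 0 (3/4) \<and> (\<forall>z. norm z < 3/4 \<longrightarrow> norm (\<xi> (-?N) q * V z (-?N) q) \<le> 4 * B * a)" if "q \<in> ?I" for q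
    unfolding V_def vedge_def
  proof (rule outer[of "-?N" q])
    show "norm (corner a (-?N) (q+1) - corner a (-?N) q) = a" using corner_length[OF a] by simp
    fix w assume w: "w \<in> closed_segment (corner a (-?N) q) (corner a (-?N) (q+1))"
    show "(of_int (-?N) - 1/2) * a \<le> Re w \<and> Re w \<le> (of_int (-?N) + 1/2) * a \<and> (of_int q - 1/2) * a \<le> Im w \<and> Im w \<le> (of_int q + 1/2) * a"
      by (rule vseg[OF w])
    show "1 \<le> \<bar>Re w\<bar> \<or> 1 \<le> \<bar>Im w\<bar>" using vedge_points(1)[OF w a] on by linarith
  qed (use that in auto)
  have o3: "(\<lambda>z. \<xi> p ?N * H z p (?N+1)) holomorphic_on ball 0 (3/4) \<and> (\<forall>z. norm z < 3/4 \<longrightarrow> norm (\<xi> p ?N * H z p (?N+1)) \<le> 4 * B * a)" if "p \<in> ?I" for p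
    unfolding H_def hedge_def
  proof (rule outer[of p ?N])
    show "norm (corner a (p+1) (?N+1) - corner a p (?N+1)) = a" using corner_length[OF a] by simp
    fix w assume w: "w \<in> closed_segment (corner a p (?N+1)) (corner a (p+1) (?N+1))"
    show "(of_int p - 1/2) * a \<le> Re w \<and> Re w \<le> (of_int p + 1/2) * a \<and> (of_int ?N - 1/2) * a \<le> Im w \<and> Im w \<le> (of_int ?N + 1/2) * a"
      by (rule hseg'[OF w])
    show "1 \<le> \<bar>Re w\<bar> \<or> 1 \<le> \<bar>Im w\<bar>" using hedge_points(1)[OF w a] on by linarith
  qed (use that in auto)
  have o4: "(\<lambda>z. \<xi> p (-?N) * H z p (-?N)) holomorphic_on ball 0 (3/4) \<and> (\<forall>z. norm z < 3/4 \<longrightarrow> norm (\<xi> p (-?N) * H z p (-?N)) \<le> 4 * B * a)" if "p \<in> ?I" for p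
    unfolding H_def hedge_def
  proof (rule outer[of p "-?N"])
    show "norm (corner a (p+1) (-?N) - corner a p (-?N)) = a" using corner_length[OF a] by simp
    fix w assume w: "w \<in> closed_segment (corner a p (-?N)) (corner a (p+1) (-?N))"
    show "(of_int p - 1/2) * a \<le> Re w \<and> Re w \<le> (of_int p + 1/2) * a \<and> (of_int (-?N) - 1/2) * a \<le> Im w \<and> Im w \<le> (of_int (-?N) + 1/2) * a"
      by (rule hseg[OF w])
    show "1 \<le> \<bar>Re w\<bar> \<or> 1 \<le> \<bar>Im w\<bar>" using hedge_points(1)[OF w a] on by linarith
  qed (use that in auto)
  have Ghol: "G holomorphic_on ball 0 (3/4)"
    unfolding G_def by (intro holomorphic_on_add holomorphic_on_sum holomorphic_on_diff) (use o1 o2 o3 o4 in blast)+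
  \<comment> \<open>Four sides of \<open>2 * n + 1\<close> edges, each of length \<open>a\<close>
    and at distance at least 1/4 from \<open>z\<close>, give at most \<open>48 * B\<close>. The
    rounded 96 becomes 16 after division by 2 pi > 6.\<close>
  have Gbd: "norm (G z) \<le> 96 * B" if z: "norm z < 3/4" for z
  proof -
    have cardI: "card ?I = 2 * n + 1" by simp
    have "norm (\<Sum>q\<in>?I. \<xi> ?N q * V z (?N+1) q - \<xi> (-?N) q * V z (-?N) q) \<le> of_nat (card ?I) * (4 * B * a + 4 * B * a)"
      by (intro sum_norm_bound norm_triangle_le_diff add_mono) (use o1 o2 z in blast)+
    moreover have "norm (\<Sum>p\<in>?I. \<xi> p (-?N) * H z p (-?N) - \<xi> p ?N * H z p (?N+1)) \<le> of_nat (card ?I) * (4 * B * a + 4 * B * a)"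
      by (intro sum_norm_bound norm_triangle_le_diff add_mono) (use o3 o4 z in blast)+
    ultimately have "norm (G z) \<le> of_nat (card ?I) * (4 * B * a + 4 * B * a) + of_nat (card ?I) * (4 * B * a + 4 * B * a)"
      unfolding G_def by (intro norm_triangle_mono)
    also have "\<dots> = 32 * B * (real n * a) + 16 * B * a" unfolding cardI by (simp add: algebra_simps)
    also have "\<dots> \<le> 32 * B + 16 * B * 1" unfolding an using B a2 by (intro add_mono mult_left_mono) auto
    finally show ?thesis using B by linarith
  qed
  have sc: "\<beta> / (a * m / 2) * a = 2 * \<beta> * (1 / m)" if "m > 0" for m
    using that a by (simp add: field_simps)
  have main: "norm (G (cen p0 0) - 2 * pi * \<i> * (if good p0 0 then u (cen p0 0) else 0)) \<le> 16 * real k * \<beta> * (1 + 2 * harm (2 * n))"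
    if p0: "p0 \<in> ?I" for p0
  proof -
    let ?z = "cen p0 0"
    let ?V = "V ?z" and ?H = "H ?z"
    \<comment> \<open>Cauchy's formula times the indicator: a bad square, where \<open>u\<close> may
      have poles, is multiplied by 0, and among the good ones only the square around the pole
      contributes.\<close>
    have sq: "\<xi> p q * (?H p q + ?V (p+1) q - ?H p (q+1) - ?V p q) = (if p = p0 \<and> q = 0 then 2 * pi * \<i> * (if good p0 0 then u ?z else 0) else 0)"
      if "p \<in> ?I" "q \<in> ?I" for p q
    proof (cases "good p q")
      case True
      have "u holomorphic_on grid_sq a p q"
        unfolding u_def
      proof (intro holomorphic_intros)
        fix w assume "w \<in> grid_sq a p q"
        then have "(of_int p - 1/2) * a \<le> Re w \<and> Re w \<le> (of_int p + 1/2) * a \<and> (of_int q - 1/2) * a \<le> Im w \<and> Im w \<le> (of_int q + 1/2) * a"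
          by (auto simp: in_cbox_complex_iff corner_def algebra_simps)
        then show "poly P w \<noteq> 0" using goodP[of p w q] True that P0 by blast
      qed
      from cauchy_square[OF a this, of ?z p0 0] show ?thesis
        using True by (auto simp: H_def V_def cen_def \<xi>_def)
    qed (auto simp: \<xi>_def)
    have "2 * pi * \<i> * (if good p0 0 then u ?z else 0) = (\<Sum>p\<in>?I. \<Sum>q\<in>?I. (if p = p0 \<and> q = 0 then 2 * pi * \<i> * (if good p0 0 then u ?z else 0) else 0))"
    proof -
      have "(\<Sum>q\<in>?I. (if p = p0 \<and> q = 0 then C else 0)) = (if p = p0 then C else 0)" for p and C :: complex
        by (cases "p = p0") simp_all
      then show ?thesis using p0 by simp
    qed
    also have "\<dots> = (\<Sum>p\<in>?I. \<Sum>q\<in>?I. \<xi> p q * (?H p q + ?V (p+1) q - ?H p (q+1) - ?V p q))"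
      by (intro sum.cong refl sq[symmetric])
    also have "\<dots> = (\<Sum>p\<in>?I. \<Sum>q\<in>?I. \<xi> p q * (?V (p+1) q - ?V p q)) - (\<Sum>p\<in>?I. \<Sum>q\<in>?I. \<xi> p q * (?H p (q+1) - ?H p q))"
      by (simp only: sum_subtractf[symmetric]) (intro sum.cong refl, simp add: algebra_simps)
    also have "(\<Sum>p\<in>?I. \<Sum>q\<in>?I. \<xi> p q * (?V (p+1) q - ?V p q)) = (\<Sum>q\<in>?I. \<Sum>p\<in>?I. \<xi> p q * (?V (p+1) q - ?V p q))"
      by (rule sum.swap)
    also have "\<dots> = (\<Sum>q\<in>?I. \<xi> ?N q * ?V (?N+1) q - \<xi> (-?N) q * ?V (-?N) q - (\<Sum>p\<in>{-?N..<?N}. (\<xi> (p+1) q - \<xi> p q) * ?V (p+1) q))"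
      by (intro sum.cong refl sum_by_parts_int) auto
    also have "(\<Sum>p\<in>?I. \<Sum>q\<in>?I. \<xi> p q * (?H p (q+1) - ?H p q)) = (\<Sum>p\<in>?I. \<xi> p ?N * ?H p (?N+1) - \<xi> p (-?N) * ?H p (-?N) - (\<Sum>q\<in>{-?N..<?N}. (\<xi> p (q+1) - \<xi> p q) * ?H p (q+1)))"
      by (intro sum.cong refl sum_by_parts_int) auto
    finally have eq: "G ?z - 2 * pi * \<i> * (if good p0 0 then u ?z else 0) =
        (\<Sum>q\<in>?I. \<Sum>p\<in>{-?N..<?N}. (\<xi> (p+1) q - \<xi> p q) * ?V (p+1) q) - (\<Sum>p\<in>?I. \<Sum>q\<in>{-?N..<?N}. (\<xi> p (q+1) - \<xi> p q) * ?H p (q+1))"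
      unfolding G_def by (simp add: sum_subtractf)
    have v1: "norm (\<Sum>p\<in>{-?N..<?N}. (\<xi> (p+1) q - \<xi> p q) * ?V (p+1) q) \<le> real (4 * k) * (2 * \<beta> * (1 / max 1 \<bar>real_of_int (q - 0)\<bar>))"
      if q: "q \<in> ?I" for q
    proof (rule norm_sum_le_card_bound[where R = "\<lambda>p. good (p+1) q \<noteq> good p q"])
      have c: "cen p q = of_real (of_int q * a) * \<i> + of_real (of_int p * a) * 1" for p
        by (simp add: cen_def complex_eq_iff)
      show "card {p \<in> {-?N..<?N}. good (p + 1) q \<noteq> good p q} \<le> 4 * k"
        unfolding good_def c by (rule card_level_transitions[OF a deg s])
      fix p assume p: "p \<in> {-?N..<?N}"
      show "norm ((\<xi> (p+1) q - \<xi> p q) * ?V (p+1) q) \<le> (if good (p+1) q \<noteq> good p q then 2 * \<beta> * (1 / max 1 \<bar>real_of_int (q - 0)\<bar>) else 0)"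
      proof (cases "good (p+1) q = good p q")
        case False
        \<comment> \<open>Distance of the edge from the pole: a vertical edge lies at a half-integer
          multiple of \<open>a\<close> from the pole horizontally, so at least \<open>a / 2\<close>
          away, and the row index \<open>q\<close> measures the vertical offset.\<close>
        let ?\<rho> = "a * max 1 \<bar>real_of_int q\<bar> / 2"
        have "norm (?V (p+1) q) \<le> \<beta> / ?\<rho> * a"
          unfolding V_def vedge_def
        proof (rule bound)
          show "norm (corner a (p+1) (q+1) - corner a (p+1) q) = a" using corner_length[OF a] by simp
          show "?\<rho> > 0" using a by simp
          fix w assume w: "w \<in> closed_segment (corner a (p+1) q) (corner a (p+1) (q+1))"
          have pI: "p \<in> ?I" "p+1 \<in> ?I" using p by auto
          have g: "s / 2 \<le> norm (poly P w)" "norm (poly P w) \<le> 2 * s"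
            using False goodP[of "p" w q] goodP[of "p+1" w q] badP[of p w q] badP[of "p+1" w q] pI q vseg[OF w] vseg'[OF w] by blast+
          have "norm w \<le> 2" using near[of p w q] vseg'[OF w] pI q by blast
          then have "norm (u w) \<le> \<beta>" using g u\<beta> by blast
          moreover have "?\<rho> \<le> norm (w - ?z)"
          proof -
            have "a / 2 \<le> \<bar>Re (w - ?z)\<bar>"
            proof -
              have "Re (w - ?z) = (of_int (p + 1 - p0) - 1/2) * a"
                using vedge_points[OF w a] by (simp add: cen_def algebra_simps)
              moreover have "1/2 \<le> \<bar>real_of_int (p + 1 - p0) - 1/2\<bar>" by (cases "p + 1 - p0 \<le> 0") auto
              ultimately show ?thesis using a by (simp add: abs_mult)
            qed
            moreover have "a * \<bar>real_of_int q\<bar> / 2 \<le> \<bar>Im (w - ?z)\<bar>"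
            proof -
              have i: "(of_int q - 1/2) * a \<le> Im (w - ?z)" "Im (w - ?z) \<le> (of_int q + 1/2) * a"
                using vedge_points[OF w a] by (simp_all add: cen_def)
              from abs_grid_offset[OF a i] show ?thesis .
            qed
            ultimately show ?thesis using abs_Re_le_cmod[of "w - ?z"] abs_Im_le_cmod[of "w - ?z"] by (simp add: max_def)
          qed
          ultimately show "s / 2 \<le> norm (poly P w) \<and> norm (u w) \<le> \<beta> \<and> ?\<rho> \<le> norm (w - ?z)" using g by blast
        qed
        moreover have "norm (\<xi> (p+1) q - \<xi> p q) = 1" using False by (auto simp: \<xi>_def)
        ultimately have "norm ((\<xi> (p+1) q - \<xi> p q) * ?V (p+1) q) \<le> \<beta> / ?\<rho> * a" by (simp only: norm_mult mult_1)
        also have "\<dots> = 2 * \<beta> * (1 / max 1 \<bar>real_of_int (q - 0)\<bar>)" using sc[of "max 1 \<bar>real_of_int q\<bar>"] by simp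
        finally show ?thesis using False by (simp only: simp_thms if_True)
      qed (simp add: \<xi>_def)
    qed (use \<beta> in auto)
    have h1: "norm (\<Sum>q\<in>{-?N..<?N}. (\<xi> p (q+1) - \<xi> p q) * ?H p (q+1)) \<le> real (4 * k) * (2 * \<beta> * (1 / max 1 \<bar>real_of_int (p - p0)\<bar>))"
      if p: "p \<in> ?I" for p
    proof (rule norm_sum_le_card_bound[where R = "\<lambda>q. good p (q+1) \<noteq> good p q"])
      have c: "cen p q = of_real (of_int p * a) + of_real (of_int q * a) * \<i>" for q
        by (simp add: cen_def complex_eq_iff)
      show "card {q \<in> {-?N..<?N}. good p (q + 1) \<noteq> good p q} \<le> 4 * k"
        unfolding good_def c by (rule card_level_transitions[OF a deg s])
      fix q assume q: "q \<in> {-?N..<?N}"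
      show "norm ((\<xi> p (q+1) - \<xi> p q) * ?H p (q+1)) \<le> (if good p (q+1) \<noteq> good p q then 2 * \<beta> * (1 / max 1 \<bar>real_of_int (p - p0)\<bar>) else 0)"
      proof (cases "good p (q+1) = good p q")
        case False
        let ?\<rho> = "a * max 1 \<bar>real_of_int (p - p0)\<bar> / 2"
        have "norm (?H p (q+1)) \<le> \<beta> / ?\<rho> * a"
          unfolding H_def hedge_def
        proof (rule bound)
          show "norm (corner a (p+1) (q+1) - corner a p (q+1)) = a" using corner_length[OF a] by simp
          show "?\<rho> > 0" using a by simp
          fix w assume w: "w \<in> closed_segment (corner a p (q+1)) (corner a (p+1) (q+1))"
          have qI: "q \<in> ?I" "q+1 \<in> ?I" using q by auto
          have g: "s / 2 \<le> norm (poly P w)" "norm (poly P w) \<le> 2 * s"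
            using False goodP[of p w q] goodP[of p w "q+1"] badP[of p w q] badP[of p w "q+1"] qI p hseg[OF w] hseg'[OF w] by blast+
          have "norm w \<le> 2" using near[of p w q] hseg'[OF w] qI p by blast
          then have "norm (u w) \<le> \<beta>" using g u\<beta> by blast
          moreover have "?\<rho> \<le> norm (w - ?z)"
          proof -
            have "a / 2 \<le> \<bar>Im (w - ?z)\<bar>"
            proof -
              have "Im (w - ?z) = (of_int (q + 1) - 1/2) * a"
                using hedge_points[OF w a] by (simp add: cen_def algebra_simps)
              moreover have "1/2 \<le> \<bar>real_of_int (q + 1) - 1/2\<bar>" by (cases "q + 1 \<le> 0") auto
              ultimately show ?thesis using a by (simp add: abs_mult)
            qed
            moreover have "a * \<bar>real_of_int (p - p0)\<bar> / 2 \<le> \<bar>Re (w - ?z)\<bar>"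
            proof -
              have i: "(of_int (p - p0) - 1/2) * a \<le> Re (w - ?z)" "Re (w - ?z) \<le> (of_int (p - p0) + 1/2) * a"
                using hedge_points[OF w a] by (simp_all add: cen_def algebra_simps)
              from abs_grid_offset[OF a i] show ?thesis .
            qed
            ultimately show ?thesis using abs_Re_le_cmod[of "w - ?z"] abs_Im_le_cmod[of "w - ?z"] by (simp add: max_def)
          qed
          ultimately show "s / 2 \<le> norm (poly P w) \<and> norm (u w) \<le> \<beta> \<and> ?\<rho> \<le> norm (w - ?z)" using g by blast
        qed
        moreover have "norm (\<xi> p (q+1) - \<xi> p q) = 1" using False by (auto simp: \<xi>_def)
        ultimately have "norm ((\<xi> p (q+1) - \<xi> p q) * ?H p (q+1)) \<le> \<beta> / ?\<rho> * a" by (simp only: norm_mult mult_1)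
        also have "\<dots> = 2 * \<beta> * (1 / max 1 \<bar>real_of_int (p - p0)\<bar>)" by (rule sc) simp
        finally show ?thesis using False by (simp only: simp_thms if_True)
      qed (simp add: \<xi>_def)
    qed (use \<beta> in auto)
    have tot: "(\<Sum>q\<in>?I. real (4 * k) * (2 * \<beta> * (1 / max 1 \<bar>real_of_int (q - r)\<bar>))) \<le> 8 * real k * \<beta> * (1 + 2 * harm (2 * n))"
      if "r \<in> ?I" for r
    proof -
      have "(\<Sum>q\<in>?I. real (4 * k) * (2 * \<beta> * (1 / max 1 \<bar>real_of_int (q - r)\<bar>))) = 8 * real k * \<beta> * (\<Sum>q\<in>?I. 1 / max 1 \<bar>real_of_int (q - r)\<bar>)"
        unfolding sum_distrib_left by (intro sum.cong refl) simp
      also have "\<dots> \<le> 8 * real k * \<beta> * (1 + 2 * harm (nat (2 * ?N)))"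
        using that \<beta> by (intro mult_left_mono sum_inverse_distance) auto
      finally show ?thesis by (simp add: nat_mult_distrib)
    qed
    have "norm (G ?z - 2 * pi * \<i> * (if good p0 0 then u ?z else 0)) \<le>
        (\<Sum>q\<in>?I. real (4 * k) * (2 * \<beta> * (1 / max 1 \<bar>real_of_int (q - 0)\<bar>))) + (\<Sum>p\<in>?I. real (4 * k) * (2 * \<beta> * (1 / max 1 \<bar>real_of_int (p - p0)\<bar>)))"
      unfolding eq by (intro norm_triangle_le_diff add_mono sum_norm_le v1 h1)
    also have "\<dots> \<le> 8 * real k * \<beta> * (1 + 2 * harm (2 * n)) + 8 * real k * \<beta> * (1 + 2 * harm (2 * n))"
      using tot[of 0] tot[of p0] p0 by (intro add_mono) auto
    finally show ?thesis by linarith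
  qed
  define F where "F = (\<lambda>z. G z / (2 * pi * \<i>))"
  show ?thesis
  proof
    show "F holomorphic_on ball 0 (3/4)" unfolding F_def by (intro holomorphic_intros Ghol) auto
    show "norm (F z) \<le> 16 * B" if "norm z < 3/4" for z
    proof -
      have "norm (F z) = norm (G z) / (2 * pi)" by (simp add: F_def norm_divide norm_mult)
      also have "\<dots> \<le> 96 * B / (2 * 3)" using Gbd[OF that] B pi_gt3 by (intro frac_le mult_left_mono) auto
      finally show ?thesis by simp
    qed
    fix p assume "\<bar>p\<bar> \<le> int n"
    then have p: "p \<in> ?I" by auto
    have z: "cen p 0 = of_real (of_int p / real n)" by (simp add: cen_def a_def complex_eq_iff)
    have "norm (F (cen p 0) - (if good p 0 then u (cen p 0) else 0)) = norm (G (cen p 0) - 2 * pi * \<i> * (if good p 0 then u (cen p 0) else 0)) / (2 * pi)"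
    proof -
      have "F (cen p 0) - (if good p 0 then u (cen p 0) else 0) = (G (cen p 0) - 2 * pi * \<i> * (if good p 0 then u (cen p 0) else 0)) / (2 * pi * \<i>)"
        by (simp add: F_def field_simps)
      then show ?thesis by (simp add: norm_divide norm_mult)
    qed
    also have "\<dots> \<le> norm (G (cen p 0) - 2 * pi * \<i> * (if good p 0 then u (cen p 0) else 0)) / 1"
      using pi_gt3 by (intro divide_left_mono) auto
    also have "\<dots> \<le> 16 * real k * \<beta> * (1 + 2 * harm (2 * n))" using main[OF p] by (simp only: div_by_1)
    finally show "norm (F (of_real (of_int p / real n)) - (let z = of_real (of_int p / real n) in if s \<le> norm (poly P z) then u z else 0))
        \<le> 16 * real k * \<beta> * (1 + 2 * harm (2 * n))"
      unfolding z[symmetric] good_def Let_def .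
  qed
qed

section \<open>Quotients of polynomials with almost integral power\<close>

lemma lipschitz_of_bounded_holomorphic:
  fixes f :: "complex \<Rightarrow> complex"
  assumes f: "f holomorphic_on ball 0 R" and B: "\<And>z. norm z < R \<Longrightarrow> norm (f z) \<le> B"
    and \<rho>: "\<rho> > 0" "r + \<rho> < R" and wc: "norm w \<le> r" "norm c \<le> r"
  shows "norm (f w - f c) \<le> B / \<rho> * norm (w - c)"
proof (rule field_differentiable_bound[where S = "cball 0 r" and f' = "deriv f"])
  fix z :: complex assume z: "z \<in> cball 0 r"
  have sub: "cball z \<rho> \<subseteq> ball 0 R"
  proof
    fix v assume "v \<in> cball z \<rho>"
    then have "norm v \<le> r + \<rho>" using z norm_triangle_ineq[of z "v - z"] by (simp add: dist_norm norm_minus_commute)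
    then show "v \<in> ball 0 R" using \<rho> by simp
  qed
  have zin: "z \<in> ball 0 R" using z \<rho> by auto
  then show "(f has_field_derivative deriv f z) (at z within cball 0 r)"
    using f by (simp add: holomorphic_derivI)
  have "norm ((deriv ^^ 1) f z) \<le> fact 1 * B / \<rho> ^ 1"
  proof (rule Cauchy_inequality)
    show "f holomorphic_on ball z \<rho>" using f sub by (meson ball_subset_cball holomorphic_on_subset order_trans)
    show "continuous_on (cball z \<rho>) f" using f sub by (meson holomorphic_on_imp_continuous_on holomorphic_on_subset)
    show "norm (f x) \<le> B" if "norm (z - x) = \<rho>" for x
      using sub that by (intro B) (auto simp: dist_norm subset_iff)
  qed (use \<rho> in auto)
  then show "norm (deriv f z) \<le> B / \<rho>" by simp
qed (use wc in auto)

lemma harm_le_ln: "n > 0 \<Longrightarrow> harm n \<le> 1 + ln (real n)"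
  using decseqD[OF decseq_harm_diff_ln, of 0 "n - 1"] by (simp add: harm_def)

lemma power_le_imp_bound:
  fixes x C t :: real
  assumes "x \<ge> 0" "x ^ j \<le> C * t ^ j" "C \<ge> 1" "j \<ge> 1" "t \<ge> 0"
  shows "x \<le> C * t"
proof (rule power_le_imp_le_base)
  have "C \<le> C ^ j" using assms self_le_power[of C j] by simp
  then have "C * t ^ j \<le> (C * t) ^ j" using assms by (simp add: power_mult_distrib mult_right_mono)
  then have "x ^ j \<le> (C * t) ^ j" using assms by linarith
  moreover have "Suc (j - 1) = j" using assms by simp
  ultimately show "x ^ Suc (j - 1) \<le> (C * t) ^ Suc (j - 1)" by presburger
qed (use assms in auto)

text \<open>
  Here \<open>\<tau> ^ (4 * j * Suc j)\<close> is the given error, \<open>s = \<tau> ^ (2 * j)\<close> the cut-off for \<open>\<bar>P\<bar>\<close>; near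
  \<open>\<bar>P\<bar> = s\<close> the quotient is of size \<open>\<tau>\<^sup>2\<close>, and one factor \<open>\<tau>\<close> pays for the harmonic sum.
\<close>

lemma approximate_quotient:
  fixes j :: nat and B :: real
  assumes j: "j \<ge> 1" and B: "B \<ge> 1"
  obtains K where "K > 0"
    and "\<And>k (P :: complex poly) (Q :: complex poly) (\<tau> :: real). \<lbrakk>degree P \<le> k; \<And>z. norm z \<le> 4 \<Longrightarrow> norm (poly P z) \<le> B; \<And>z. norm z \<le> 4 \<Longrightarrow> norm (poly Q z) \<le> B;
       \<And>z. norm z \<le> 2 \<Longrightarrow> norm (poly Q z ^ j - poly P z ^ Suc j) \<le> B * \<tau> ^ (4 * j * Suc j); 0 < \<tau>; \<tau> \<le> 1\<rbrakk> \<Longrightarrow>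
       \<exists>F. F holomorphic_on ball 0 (1/2) \<and> (\<forall>z\<in>ball 0 (1/2). norm (F z) \<le> K) \<and>
         (\<forall>x::real. \<forall>y. \<bar>x\<bar> < 1/2 \<longrightarrow> norm (y ^ j - poly P (of_real x)) \<le> B * \<tau> ^ (4 * j * Suc j) \<longrightarrow>
            norm (y ^ Suc j - poly Q (of_real x)) \<le> B * \<tau> ^ (4 * j * Suc j) \<longrightarrow>
            norm (F (of_real x) - y) \<le> K * (real k + 1) * \<tau>)"
proof -
  define C where "C = 2 + 2 ^ j * B + B"
  \<comment> \<open>The summands belong to three errors: moving \<open>x\<close> to a grid point,
    replacing the cut quotient by the holomorphic \<open>F\<close>, and comparing \<open>y\<close>
    with the cut quotient at the grid point.\<close>
  define K where "K = 256 * C + 16 * C * (3 + 2 * ln (18 * B) + 8 * real j) + 4 * C * B + C"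
  have C1: "C \<ge> 1" "C \<ge> 2 * B" "C \<ge> 2 + B" "C \<ge> B + B * 2 ^ j" "C \<ge> 2 + B * 2 ^ j"
  proof -
    have "B * 1 \<le> B * 2 ^ j" using B by (intro mult_left_mono) auto
    then have "B \<le> 2 ^ j * B" by (simp only: mult_1_right mult.commute)
    then show "C \<ge> 1" "C \<ge> 2 * B" "C \<ge> 2 + B" "C \<ge> B + B * 2 ^ j" "C \<ge> 2 + B * 2 ^ j"
      using B by (simp_all only: C_def mult.commute[of B])
  qed
  have lnB: "ln (18 * B) \<ge> 0" using B by simp
  have K16: "16 * C \<le> K"
  proof -
    have "0 \<le> 16 * C * (3 + 2 * ln (18 * B) + 8 * real j)" "0 \<le> 4 * C * B" using C1 lnB B by auto
    then show ?thesis using C1 unfolding K_def by linarith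
  qed
  show ?thesis
  proof
    show "K > 0" using K16 C1 by linarith
    fix k and P Q :: "complex poly" and \<tau> :: real
    assume deg: "degree P \<le> k"
      and PB: "\<And>z. norm z \<le> 4 \<Longrightarrow> norm (poly P z) \<le> B"
      and QB: "\<And>z. norm z \<le> 4 \<Longrightarrow> norm (poly Q z) \<le> B"
      and PQ: "\<And>z. norm z \<le> 2 \<Longrightarrow> norm (poly Q z ^ j - poly P z ^ Suc j) \<le> B * \<tau> ^ (4 * j * Suc j)"
      and \<tau>: "0 < \<tau>" "\<tau> \<le> 1"
    define \<delta> where "\<delta> = \<tau> ^ (4 * j * Suc j)"
    define s where "s = \<tau> ^ (2 * j)"
    define u where "u = (\<lambda>w. poly Q w / poly P w)"
    \<comment> \<open>The mesh is of order s^2 rather than \<open>s\<close>: the variation of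
      \<open>P\<close> and \<open>Q\<close> over one mesh is later divided by \<bar>P\<bar> \<ge>
      \<open>s\<close> and must still be of order \<open>s\<close>.\<close>
    define n where "n = nat \<lceil>8 * B / s\<^sup>2\<rceil>"
    have s: "0 < s" "s \<le> 1" using \<tau> by (auto simp: s_def power_le_one)
    \<comment> \<open>One factor \<open>s ^ j\<close> is spent on the denominator \<bar>P\<bar>^j in
      \<open>ub\<close>; the rest is still at most \<open>s\<close>.\<close>
    have \<delta>s: "\<delta> = s ^ j * s ^ 2 * s ^ j"
      unfolding \<delta>_def s_def by (simp add: power_mult[symmetric] power_add[symmetric] algebra_simps)
    have "s ^ j \<le> 1" "s ^ 2 \<le> s" using s by (auto simp: power_le_one power2_eq_square mult_left_le_one_le)
    have \<delta>: "0 < \<delta>" "\<delta> \<le> s ^ 2"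
    proof -
      show "0 < \<delta>" using \<tau> by (simp add: \<delta>_def)
      have "s ^ j * s ^ 2 * s ^ j \<le> 1 * s ^ 2 * 1" using s \<open>s ^ j \<le> 1\<close> by (intro mult_mono) auto
      then show "\<delta> \<le> s ^ 2" by (simp add: \<delta>s)
    qed
    have s2s: "s\<^sup>2 \<le> s" by fact
    have s\<tau>: "s \<le> \<tau> ^ 2"
    proof -
      have "\<tau> ^ (2 * j) \<le> \<tau> ^ 2" using j \<tau> by (intro power_decreasing) auto
      then show ?thesis by (simp add: s_def)
    qed
    have \<tau>2: "\<tau> ^ 2 \<le> \<tau>" using \<tau> by (simp add: power2_eq_square mult_left_le_one_le)
    have s_pow: "s = (\<tau> ^ 2) ^ j" by (simp add: s_def power_mult)
    have n8: "8 * B / s\<^sup>2 \<le> real n" unfolding n_def by linarith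
    have big: "8 \<le> 8 * B / s\<^sup>2"
    proof -
      have "8 * s\<^sup>2 \<le> 8 * B" using s2s s B by linarith
      then show ?thesis using s by (simp add: field_simps)
    qed
    have n: "real n \<ge> 8" using n8 big by linarith
    have n9: "real n \<le> 9 * B / s\<^sup>2"
    proof -
      have "real n \<le> 8 * B / s\<^sup>2 + 1" unfolding n_def using big by linarith
      also have "1 \<le> B / s\<^sup>2" using big by simp
      finally show ?thesis by simp
    qed
    define a where "a = 1 / real n"
    have a: "0 < a" "a \<le> 1/8" "a * B \<le> s\<^sup>2 / 8"
    proof -
      show "0 < a" "a \<le> 1/8" using n by (auto simp: a_def field_simps)
      show "a * B \<le> s\<^sup>2 / 8" using n8 n s by (simp add: a_def field_simps)
    qed
    have aB: "a \<le> s\<^sup>2 / 8" using a(3) B mult_left_mono[of 1 B a] a(1) by linarith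
    have lipP: "norm (poly R w - poly R c) \<le> B * norm (w - c)"
      if "norm w \<le> 2" "norm c \<le> 2" "\<And>z. norm z \<le> 4 \<Longrightarrow> norm (poly R z) \<le> B" for R :: "complex poly" and w c
    proof -
      have "norm (poly R w - poly R c) \<le> B / 1 * norm (w - c)"
        by (rule lipschitz_of_bounded_holomorphic[where R = 4 and r = 2])
          (use that in \<open>auto intro!: holomorphic_intros\<close>)
      then show ?thesis by simp
    qed
    have ub: "norm (u w) ^ j \<le> norm (poly P w) + B * 2 ^ j * s"
      if "norm w \<le> 2" "s / 2 \<le> norm (poly P w)" for w
    proof -
      have P0: "norm (poly P w) > 0" using that s by linarith
      have "norm (poly Q w) ^ j \<le> norm (poly P w) ^ Suc j + B * \<delta>"
      proof -
        have "norm (poly Q w ^ j) \<le> norm (poly P w ^ Suc j) + norm (poly Q w ^ j - poly P w ^ Suc j)"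
          by (rule norm_triangle_sub)
        also have "norm (poly Q w ^ j - poly P w ^ Suc j) \<le> B * \<delta>" using PQ[OF that(1)] by (simp add: \<delta>_def)
        finally show ?thesis by (simp only: norm_power)
      qed
      then have "norm (u w) ^ j \<le> (norm (poly P w) ^ Suc j + B * \<delta>) / norm (poly P w) ^ j"
        by (simp add: u_def norm_divide power_divide divide_right_mono)
      also have "\<dots> = norm (poly P w) + B * \<delta> / norm (poly P w) ^ j"
        using P0 by (simp add: add_divide_distrib)
      also have "B * \<delta> / norm (poly P w) ^ j \<le> B * \<delta> / (s / 2) ^ j"
        using that s B \<delta> by (intro divide_left_mono power_mono mult_pos_pos zero_less_power) auto
      also have "\<dots> = B * 2 ^ j * (s ^ 2 * s ^ j)"
        using s by (simp add: \<delta>s power_divide)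
      also have "\<dots> \<le> B * 2 ^ j * (s * 1)"
        using s s2s \<open>s ^ j \<le> 1\<close> B by (intro mult_left_mono mult_mono) auto
      finally show ?thesis by simp
    qed
    have root: "x \<le> C * \<tau> ^ 2" if "x ^ j \<le> C * s" "x \<ge> 0" for x
      by (rule power_le_imp_bound) (use that j C1 s_pow in auto)
    have root1: "x \<le> C" if "x ^ j \<le> C" "x \<ge> 0" for x
      using power_le_imp_bound[of x j C 1] that j C1 by auto
    obtain F where F: "F holomorphic_on ball 0 (3/4)"
      and FB: "\<And>z. norm z < 3/4 \<Longrightarrow> norm (F z) \<le> 16 * C"
      and Fu: "\<And>p. \<bar>p\<bar> \<le> int n \<Longrightarrow>
      norm (F (of_real (of_int p / real n)) - (let z = of_real (of_int p / real n) in if s \<le> norm (poly P z) then poly Q z / poly P z else 0))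
        \<le> 16 * real k * (C * \<tau> ^ 2) * (1 + 2 * harm (2 * n))"
    proof (rule grid_approximation[of n s C "C * \<tau> ^ 2" P k Q])
      show "n \<ge> 2" using n by simp
      show "norm (poly P w - poly P c) \<le> s / 2" if "norm w \<le> 2" "norm c \<le> 2" "norm (w - c) \<le> 1 / real n" for w c
      proof -
        have "norm (poly P w - poly P c) \<le> B * norm (w - c)" using that PB by (intro lipP) auto
        also have "\<dots> \<le> B * a" using that B by (intro mult_left_mono) (auto simp: a_def)
        finally show ?thesis using a s2s s by (simp add: mult.commute)
      qed
      show "norm (poly Q w / poly P w) \<le> C" if "norm w \<le> 2" "s / 2 \<le> norm (poly P w)" for w
      proof -
        have "B * 2 ^ j * s \<le> B * 2 ^ j * 1" using s B by (intro mult_left_mono) auto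
        then have "norm (u w) ^ j \<le> B + B * 2 ^ j * 1"
          using ub[OF that] PB[of w] that(1) by linarith
        then show ?thesis using C1 root1[of "norm (u w)"] unfolding u_def by simp
      qed
      show "norm (poly Q w / poly P w) \<le> C * \<tau>\<^sup>2" if "norm w \<le> 2" "s / 2 \<le> norm (poly P w)" "norm (poly P w) \<le> 2 * s" for w
      proof -
        have "norm (u w) ^ j \<le> (2 + B * 2 ^ j) * s"
          using ub[OF that(1,2)] that(3) by (simp add: algebra_simps)
        also have "\<dots> \<le> C * s" using C1 s by (intro mult_right_mono) auto
        finally show ?thesis using root[of "norm (u w)"] unfolding u_def by simp
      qed
    qed (use s C1 \<tau> deg in auto)
    \<comment> \<open>The mesh is a power of \<open>\<tau>\<close> up to constants, so the harmonic
      sum is of size ln (1 / \<tau>). The crude bound by 1 / \<tau> spends one of the two factors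
      \<open>\<tau>\<close>.\<close>
    have Hn: "\<tau> ^ 2 * (1 + 2 * harm (2 * n)) \<le> (3 + 2 * ln (18 * B) + 8 * real j) * \<tau>"
    proof -
      have ln_inv: "ln (1 / \<tau>) \<le> 1 / \<tau>" using \<tau> ln_le_minus_one[of "1 / \<tau>"] by simp
      have "harm (2 * n) \<le> 1 + ln (real (2 * n))" using n by (intro harm_le_ln) auto
      also have "real (2 * n) \<le> 18 * B / s\<^sup>2" using n9 by simp
      then have "ln (real (2 * n)) \<le> ln (18 * B / s\<^sup>2)" using n by simp
      also have "\<dots> = ln (18 * B) + 4 * j * ln (1 / \<tau>)"
        using s B \<tau> by (simp add: ln_div ln_realpow s_def)
      also have "\<dots> \<le> ln (18 * B) + 4 * j * (1 / \<tau>)" using ln_inv by (intro add_left_mono mult_left_mono) auto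
      finally have "harm (2 * n) \<le> 1 + (ln (18 * B) + 4 * j * (1 / \<tau>))" by simp
      then have "\<tau> ^ 2 * (1 + 2 * harm (2 * n)) \<le> \<tau> ^ 2 * (1 + 2 * (1 + (ln (18 * B) + 4 * j * (1 / \<tau>))))"
        by (intro mult_left_mono) auto
      also have "\<dots> = \<tau> ^ 2 * (3 + 2 * ln (18 * B)) + 8 * real j * \<tau>" using \<tau> by (simp add: field_simps power2_eq_square)
      also have "\<dots> \<le> \<tau> * (3 + 2 * ln (18 * B)) + 8 * real j * \<tau>" using \<tau>2 lnB \<tau> by (intro add_mono mult_right_mono) auto
      finally show ?thesis by (simp add: algebra_simps)
    qed
    have main: "norm (F x - y) \<le> K * (real k + 1) * \<tau>"
      if x: "\<bar>x\<bar> < 1/2" and yP: "norm (y ^ j - poly P x) \<le> B * \<delta>" and yQ: "norm (y ^ Suc j - poly Q x) \<le> B * \<delta>" for x :: real and y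
    proof -
      \<comment> \<open>\<open>F\<close> is compared with the quotient at real grid points only, so
        \<open>x\<close> is moved to the one on its left; the bound of \<open>F\<close> on the
        larger disc turns into the Lipschitz estimate that pays for this.\<close>
      define p where "p = \<lfloor>x * real n\<rfloor>"
      define c where "c = of_int p / real n"
      have "of_int p \<le> x * real n" "x * real n < of_int p + 1" unfolding p_def by linarith+
      then have "c \<le> x" "x \<le> c + a" using n by (auto simp: c_def a_def field_simps)
      then have xc: "\<bar>x - c\<bar> \<le> a" by simp
      have c58: "\<bar>c\<bar> \<le> 5/8" using xc x a by linarith
      have "\<bar>real_of_int p\<bar> \<le> real n" using c58 n by (auto simp: c_def field_simps)
      then have pn: "\<bar>p\<bar> \<le> int n" by linarith
      have nxc: "norm (complex_of_real x - of_real c) \<le> a" using xc by (simp flip: of_real_diff)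
      have e1: "norm (F x - F c) \<le> 256 * C * \<tau>"
      proof -
        have "norm (F x - F c) \<le> (16 * C) / (1/16) * norm (complex_of_real x - of_real c)"
          by (rule lipschitz_of_bounded_holomorphic[OF F, where r = "5/8"]) (use FB x c58 in auto)
        also have "\<dots> \<le> (16 * C) / (1/16) * \<tau>"
          using nxc aB s2s s\<tau> \<tau>2 s C1 by (intro mult_left_mono) auto
        finally show ?thesis by simp
      qed
      define U where "U = (if s \<le> norm (poly P c) then u c else 0)"
      have e2: "norm (F c - U) \<le> 16 * C * (3 + 2 * ln (18 * B) + 8 * real j) * real k * \<tau>"
      proof -
        have "norm (F c - U) \<le> 16 * real k * (C * \<tau> ^ 2) * (1 + 2 * harm (2 * n))"
          using Fu[OF pn] unfolding U_def u_def c_def Let_def .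
        also have "\<dots> = 16 * real k * C * (\<tau> ^ 2 * (1 + 2 * harm (2 * n)))" by simp
        also have "\<dots> \<le> 16 * real k * C * ((3 + 2 * ln (18 * B) + 8 * real j) * \<tau>)"
          using C1 by (intro mult_left_mono Hn) auto
        finally show ?thesis by (simp add: mult_ac)
      qed
      have x2: "norm (complex_of_real x) \<le> 2" "norm (complex_of_real c) \<le> 2" using x c58 by auto
      have Pxc: "norm (poly P x - poly P c) \<le> s\<^sup>2 / 8" and Qxc: "norm (poly Q x - poly Q c) \<le> s\<^sup>2 / 8"
      proof -
        have "B * norm (complex_of_real x - of_real c) \<le> B * a" using nxc B by (intro mult_left_mono) auto
        then have *: "B * norm (complex_of_real x - of_real c) \<le> s\<^sup>2 / 8" using a(3) by (simp add: mult.commute)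
        show "norm (poly P x - poly P c) \<le> s\<^sup>2 / 8" using lipP[OF x2 PB] * by linarith
        show "norm (poly Q x - poly Q c) \<le> s\<^sup>2 / 8" using lipP[OF x2 QB] * by linarith
      qed
      have yj: "norm y ^ j \<le> norm (poly P x) + B * \<delta>"
        using norm_triangle_sub[of "y ^ j" "poly P x"] yP by (simp add: norm_power)
      have \<delta>1: "\<delta> \<le> 1" using \<delta> s2s s by linarith
      have yC: "norm y \<le> C"
      proof (rule root1)
        have "norm (poly P x) \<le> B" using PB[of x] x by simp
        moreover have "B * \<delta> \<le> B * 1" using \<delta>1 B by (intro mult_left_mono) auto
        ultimately show "norm y ^ j \<le> C" using yj C1(2) by linarith
      qed simp
      have e3: "norm (U - y) \<le> (4 * C * B + C) * \<tau>"
      proof (cases "s \<le> norm (poly P c)")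
        case True
        then have P0: "poly P c \<noteq> 0" using s by auto
        \<comment> \<open>The terms \<open>y ^ Suc j\<close> cancel. Closeness of the two powers of
          \<open>y\<close> to \<open>P\<close> and \<open>Q\<close> thus fixes \<open>y\<close> up
          to a division by \<open>P\<close>, and no regularity of \<open>y\<close> in
          \<open>x\<close> enters.\<close>
        have "poly Q c - y * poly P c = y * (poly P x - poly P c) + y * (y ^ j - poly P x) - (y ^ Suc j - poly Q x) - (poly Q x - poly Q c)"
          by (simp add: algebra_simps)
        also have "norm \<dots> \<le> C * (s\<^sup>2 / 8) + C * (B * \<delta>) + B * \<delta> + s\<^sup>2 / 8"
        proof -
          have t: "norm (v1 + v2 - v3 - v4) \<le> b1 + b2 + b3 + b4"
            if "norm v1 \<le> b1" "norm v2 \<le> b2" "norm v3 \<le> b3" "norm v4 \<le> b4" for v1 v2 v3 v4 :: complex and b1 b2 b3 b4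
            using that norm_triangle_ineq4[of "v1 + v2 - v3" v4] norm_triangle_ineq4[of "v1 + v2" v3] norm_triangle_ineq[of v1 v2] by linarith
          show ?thesis
            by (rule t[OF _ _ yQ Qxc]; unfold norm_mult; rule mult_mono[OF yC]) (use Pxc yP C1 in auto)
        qed
        also have "\<dots> \<le> C * (B * s\<^sup>2) + C * (B * s\<^sup>2) + C * (B * s\<^sup>2) + C * (B * s\<^sup>2)"
        proof -
          have "s\<^sup>2 / 8 \<le> B * s\<^sup>2" using B s mult_right_mono[of 1 B "s\<^sup>2"] by simp
          moreover have "B * \<delta> \<le> B * s\<^sup>2" using \<delta> B by (intro mult_left_mono) auto
          moreover have "B * s\<^sup>2 \<le> C * (B * s\<^sup>2)" using C1 B s mult_right_mono[of 1 C "B * s\<^sup>2"] by simp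
          moreover have "C * (s\<^sup>2 / 8) \<le> C * (B * s\<^sup>2)" "C * (B * \<delta>) \<le> C * (B * s\<^sup>2)"
            using calculation(1,2) C1(1) by (auto intro!: mult_left_mono)
          ultimately show ?thesis by linarith
        qed
        finally have D: "norm (poly Q c - y * poly P c) \<le> 4 * C * B * s * s" by (simp add: power2_eq_square mult_ac)
        have "U - y = (poly Q c - y * poly P c) / poly P c" using True P0 by (simp add: U_def u_def field_simps)
        then have "norm (U - y) = norm (poly Q c - y * poly P c) / norm (poly P c)" by (simp add: norm_divide)
        also have "\<dots> \<le> (4 * C * B * s * s) / s" using True s D C1 B by (intro frac_le) auto
        also have "\<dots> = 4 * C * B * s" using s by simp
        also have "\<dots> \<le> 4 * C * B * \<tau>" using s\<tau> \<tau>2 C1 B by (intro mult_left_mono) auto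
        also have "\<dots> \<le> (4 * C * B + C) * \<tau>" using C1 \<tau> by (simp add: algebra_simps)
        finally show ?thesis .
      next
        case False
        \<comment> \<open>Below the level the cut quotient is 0, and \<open>y\<close> is small as
          well because \<bar>y\<bar>^j is close to \<bar>P\<bar>.\<close>
        have "norm (poly P x) \<le> norm (poly P c) + norm (poly P x - poly P c)" by (rule norm_triangle_sub)
        then have "norm (poly P x) \<le> 2 * s" using False Pxc s2s s by linarith
        moreover have "B * \<delta> \<le> B * s" using \<delta> s2s B by (intro mult_left_mono) auto
        ultimately have "norm y ^ j \<le> (2 + B) * s" using yj by (simp add: algebra_simps)
        also have "\<dots> \<le> C * s" using C1 s by (intro mult_right_mono) auto
        finally have "norm y \<le> C * \<tau> ^ 2" by (intro root) auto
        also have "\<dots> \<le> C * \<tau>" using \<tau>2 C1 by (intro mult_left_mono) auto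
        also have "\<dots> \<le> (4 * C * B + C) * \<tau>" using C1 B \<tau> by (simp add: algebra_simps)
        finally show ?thesis using False by (simp add: U_def)
      qed
      have "F x - y = (F x - F c) + (F c - U) + (U - y)" by simp
      also have "norm \<dots> \<le> 256 * C * \<tau> + 16 * C * (3 + 2 * ln (18 * B) + 8 * real j) * real k * \<tau> + (4 * C * B + C) * \<tau>"
        by (intro norm_triangle_le add_mono e1 e2 e3)
      also have "\<dots> \<le> K * (real k + 1) * \<tau>"
      proof -
        define L where "L = 16 * C * (3 + 2 * ln (18 * B) + 8 * real j)"
        have "0 \<le> (256 * C + 4 * C * B + C) * real k * \<tau>" "0 \<le> L * \<tau>" using C1 B \<tau> lnB by (auto simp: L_def)
        moreover have "K * (real k + 1) * \<tau> = 256 * C * \<tau> + L * real k * \<tau> + (4 * C * B + C) * \<tau> + ((256 * C + 4 * C * B + C) * real k * \<tau> + L * \<tau>)"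
          by (simp add: K_def L_def algebra_simps)
        ultimately show ?thesis unfolding L_def by linarith
      qed
      finally show ?thesis .
    qed
    show "\<exists>F. F holomorphic_on ball 0 (1/2) \<and> (\<forall>z\<in>ball 0 (1/2). norm (F z) \<le> K) \<and>
         (\<forall>x::real. \<forall>y. \<bar>x\<bar> < 1/2 \<longrightarrow> norm (y ^ j - poly P (of_real x)) \<le> B * \<tau> ^ (4 * j * Suc j) \<longrightarrow>
            norm (y ^ Suc j - poly Q (of_real x)) \<le> B * \<tau> ^ (4 * j * Suc j) \<longrightarrow>
            norm (F (of_real x) - y) \<le> K * (real k + 1) * \<tau>)"
    proof (intro exI[of _ F] conjI ballI allI impI)
      show "F holomorphic_on ball 0 (1/2)" using F by (rule holomorphic_on_subset) auto
      show "norm (F z) \<le> K" if "z \<in> ball 0 (1/2)" for z using FB[of z] that K16 by auto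
    qed (use main in \<open>simp add: \<delta>_def\<close>)
  qed
qed

section \<open>Taylor polynomials of two consecutive powers\<close>

text \<open>The mean value form of the remainder is available for real functions only. Rotating by
  the conjugate phase \<open>u\<close> of the remainder \<open>R\<close> makes \<open>R\<close> real
  and positive, so the real theorem for Re (u D) recovers its full modulus without a loss in the
  constant.\<close>

lemma taylor_remainder_complex:
  fixes D :: "nat \<Rightarrow> real \<Rightarrow> complex"
  assumes der: "\<And>i y. i < k \<Longrightarrow> y \<in> {c..d} \<Longrightarrow> (D i has_vector_derivative D (Suc i) y) (at y)"
    and M: "\<And>y. y \<in> {c..d} \<Longrightarrow> norm (D k y) \<le> M" and x: "x \<in> {c..d}" "x0 \<in> {c..d}"
  shows "norm (D 0 x - (\<Sum>i<k. D i x0 * of_real ((x - x0) ^ i / fact i))) \<le> M * \<bar>x - x0\<bar> ^ k / fact k"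
proof (cases "k = 0 \<or> x = x0")
  case True
  have M0: "M \<ge> 0" using M[OF x(1)] norm_ge_zero order_trans by blast
  show ?thesis
  proof (cases "k = 0")
    case True
    then show ?thesis using M[OF x(1)] by simp
  next
    case False
    then have "x = x0" using True by simp
    moreover have "(\<Sum>i<k. D i x0 * of_real (0 ^ i / fact i)) = (\<Sum>i<k. if i = 0 then D 0 x0 else 0)"
      by (intro sum.cong refl) (auto simp: zero_power)
    ultimately show ?thesis using False M0 by simp
  qed
next
  case False
  define R where "R = D 0 x - (\<Sum>i<k. D i x0 * of_real ((x - x0) ^ i / fact i))"
  define u where "u = cnj (sgn R)"
  have uR: "Re (u * R) = norm R"
  proof (cases "R = 0")
    case False
    then have "u * R = of_real (norm R)"
      by (simp add: u_def sgn_eq complex_norm_square[symmetric] field_simps power2_eq_square)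
    then show ?thesis by simp
  qed simp
  have un: "norm u \<le> 1" by (simp add: u_def norm_sgn)
  define diff where "diff = (\<lambda>i y. Re (u * D i y))"
  have "\<exists>t. (if x < x0 then x < t \<and> t < x0 else x0 < t \<and> t < x) \<and>
      diff 0 x = (\<Sum>i<k. (diff i x0 / fact i) * (x - x0) ^ i) + (diff k t / fact k) * (x - x0) ^ k"
  proof (rule Taylor[where diff = diff and f = "diff 0"])
    show "\<forall>i t. i < k \<and> c \<le> t \<and> t \<le> d \<longrightarrow> DERIV (diff i) t :> diff (Suc i) t"
    proof (intro allI impI)
      fix i t assume *: "i < k \<and> c \<le> t \<and> t \<le> d"
      have "((\<lambda>y. u * D i y) has_vector_derivative u * D (Suc i) t) (at t)"
        using der[of i t] * by (intro has_vector_derivative_mult_right) auto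
      then have "((\<lambda>y. Re (u * D i y)) has_vector_derivative Re (u * D (Suc i) t)) (at t)"
        by (rule bounded_linear.has_vector_derivative[OF bounded_linear_Re])
      then show "DERIV (diff i) t :> diff (Suc i) t"
        by (simp add: diff_def has_real_derivative_iff_has_vector_derivative)
    qed
  qed (use False x in auto)
  then obtain t where a: "if x < x0 then x < t \<and> t < x0 else x0 < t \<and> t < x"
    and T: "diff 0 x = (\<Sum>i<k. (diff i x0 / fact i) * (x - x0) ^ i) + (diff k t / fact k) * (x - x0) ^ k"
    by blast
  have t: "t \<in> {c..d}" using a x by (auto split: if_splits)
  have Re_scale: "Re (of_real a * z) = a * Re z" for a z by simp
  have "Re (u * (\<Sum>i<k. D i x0 * of_real ((x - x0) ^ i / fact i))) = (\<Sum>i<k. (diff i x0 / fact i) * (x - x0) ^ i)"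
    unfolding sum_distrib_left Re_sum
  proof (intro sum.cong refl)
    fix i
    have "u * (D i x0 * of_real ((x - x0) ^ i / fact i)) = of_real ((x - x0) ^ i / fact i) * (u * D i x0)" by simp
    then show "Re (u * (D i x0 * of_real ((x - x0) ^ i / fact i))) = diff i x0 / fact i * (x - x0) ^ i"
      unfolding diff_def by (simp only: Re_scale) (simp only: times_divide_eq_left times_divide_eq_right mult.commute)
  qed
  then have "norm R = diff k t / fact k * (x - x0) ^ k"
    using T uR by (simp add: R_def diff_def right_diff_distrib)
  also have "\<dots> \<le> \<bar>diff k t\<bar> * \<bar>x - x0\<bar> ^ k / fact k"
    using abs_ge_self[of "diff k t / fact k * (x - x0) ^ k"] by (simp add: abs_mult power_abs)
  also have "\<bar>diff k t\<bar> \<le> M"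
  proof -
    have "\<bar>diff k t\<bar> \<le> norm (u * D k t)" unfolding diff_def by (rule abs_Re_le_cmod)
    also have "\<dots> \<le> 1 * norm (D k t)" unfolding norm_mult using un by (intro mult_right_mono) auto
    finally show ?thesis using M[OF t] by simp
  qed
  finally show ?thesis by (simp add: R_def mult_right_mono divide_right_mono)
qed

section \<open>Coefficients of powers of truncated Taylor polynomials\<close>

lemma coeff_eq_0_of_small:
  fixes p :: "complex poly"
  assumes "\<And>x::real. 0 < x \<Longrightarrow> x \<le> 1 \<Longrightarrow> norm (poly p (of_real x)) \<le> C * x ^ k" and "i < k"
  shows "coeff p i = 0"
  using assms
proof (induction k arbitrary: p i)
  case (Suc k)
  obtain c r where p: "p = pCons c r" by (cases p)
  have "c = 0"
  proof -
    have "((\<lambda>x::real. norm (poly p (of_real x))) \<longlongrightarrow> norm (poly p (of_real 0))) (at_right 0)"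
      by (intro tendsto_intros)
    moreover have "((\<lambda>x::real. C * x ^ Suc k) \<longlongrightarrow> C * 0 ^ Suc k) (at_right 0)" by (intro tendsto_intros)
    moreover have "\<forall>\<^sub>F x in at_right 0. norm (poly p (of_real x)) \<le> C * x ^ Suc k"
      by (rule eventually_mono[OF eventually_at_right_real[of 0 "1::real"]]) (use Suc.prems(1) in auto)
    ultimately have "norm (poly p (of_real 0)) \<le> C * 0 ^ Suc k"
      by (intro tendsto_le[OF trivial_limit_at_right_real])
    then show ?thesis by (simp add: p)
  qed
  show ?case
  proof (cases i)
    case 0
    then show ?thesis using \<open>c = 0\<close> by (simp add: p)
  next
    case (Suc i')
    have "coeff r i' = 0"
    proof (rule Suc.IH)
      fix x :: real assume x: "0 < x" "x \<le> 1"
      have "x * norm (poly r (of_real x)) \<le> x * (C * x ^ k)"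
        using Suc.prems(1)[OF x] x \<open>c = 0\<close> by (simp add: p norm_mult mult_ac)
      then show "norm (poly r (of_real x)) \<le> C * x ^ k" using x by simp
    qed (use Suc Suc.prems in simp)
    then show ?thesis by (simp add: p Suc)
  qed
qed simp

text \<open>The factor 4 is 2 times 2: once for the defect allowed in the hypothesis on
  \<open>v\<close>, once for the \<open>Suc i\<close> terms of the convolution, which number at most
  2^i.\<close>

lemma coeff_mult_majorant:
  fixes p q :: "complex poly" and v :: "nat \<Rightarrow> real"
  assumes v: "\<And>i. v i \<ge> 0" "\<And>a b. v a * v b \<le> 2 ^ (a + b) * v (a + b)" and "\<theta> \<ge> 0" "A \<ge> 0" "A' \<ge> 0"
    and p: "\<And>i. norm (coeff p i) \<le> A * \<theta> ^ i * v i" and q: "\<And>i. norm (coeff q i) \<le> A' * \<theta> ^ i * v i"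
  shows "norm (coeff (p * q) i) \<le> A * A' * (4 * \<theta>) ^ i * v i"
proof -
  have "norm (coeff (p * q) i) \<le> (\<Sum>a\<le>i. norm (coeff p a * coeff q (i - a)))"
    unfolding coeff_mult by (rule norm_sum)
  also have "\<dots> \<le> (\<Sum>a\<le>i. A * A' * \<theta> ^ i * (2 ^ i * v i))"
  proof (rule sum_mono)
    fix a assume "a \<in> {..i}"
    then have a: "a + (i - a) = i" by simp
    have "norm (coeff p a * coeff q (i - a)) \<le> (A * \<theta> ^ a * v a) * (A' * \<theta> ^ (i - a) * v (i - a))"
      unfolding norm_mult by (rule mult_mono[OF p q]) (use v(1) assms(3-5) in simp_all)
    also have "\<dots> = A * A' * \<theta> ^ (a + (i - a)) * (v a * v (i - a))" by (simp only: power_add mult_ac)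
    also have "\<dots> \<le> A * A' * \<theta> ^ (a + (i - a)) * (2 ^ (a + (i - a)) * v (a + (i - a)))"
      by (rule mult_left_mono[OF v(2)]) (use assms(3-5) in simp)
    finally show "norm (coeff p a * coeff q (i - a)) \<le> A * A' * \<theta> ^ i * (2 ^ i * v i)" unfolding a .
  qed
  also have "\<dots> = real (Suc i) * (A * A' * (2 * \<theta>) ^ i * v i)" by (simp add: power_mult_distrib)
  also have "\<dots> \<le> 2 ^ i * (A * A' * (2 * \<theta>) ^ i * v i)"
  proof (rule mult_right_mono)
    have "Suc i \<le> 2 ^ i" by (simp add: Suc_leI)
    then have "real (Suc i) \<le> real (2 ^ i)" by (simp only: of_nat_le_iff)
    then show "real (Suc i) \<le> 2 ^ i" by simp
  qed (use v(1) assms(3-5) in simp)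
  also have "\<dots> = A * A' * (4 * \<theta>) ^ i * v i"
  proof -
    have four: "(4 * \<theta>) ^ i = 2 ^ i * (2 * \<theta>) ^ i" using power_mult_distrib[of 2 "2 * \<theta>" i] by simp
    show ?thesis unfolding four by (simp only: mult_ac)
  qed
  finally show ?thesis .
qed

lemma coeff_power_majorant:
  fixes p :: "complex poly" and v :: "nat \<Rightarrow> real"
  assumes v: "v 0 = 1" "\<And>i. v i \<ge> 0" "\<And>a b. v a * v b \<le> 2 ^ (a + b) * v (a + b)" and "\<theta> \<ge> 0" "A \<ge> 0"
    and p: "\<And>i. norm (coeff p i) \<le> A * \<theta> ^ i * v i"
  shows "norm (coeff (p ^ n) i) \<le> A ^ n * (4 ^ n * \<theta>) ^ i * v i"
proof (induction n arbitrary: i)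
  case 0
  then show ?case using v assms by (cases i) auto
next
  case (Suc n)
  have "norm (coeff (p * p ^ n) i) \<le> A * A ^ n * (4 * (4 ^ n * \<theta>)) ^ i * v i"
  proof (rule coeff_mult_majorant[OF v(2,3)])
    fix i
    have "1 * \<theta> \<le> 4 ^ n * \<theta>" using assms by (intro mult_right_mono) auto
    then have "\<theta> ^ i \<le> (4 ^ n * \<theta>) ^ i" using assms by (intro power_mono) auto
    then have "A * \<theta> ^ i * v i \<le> A * (4 ^ n * \<theta>) ^ i * v i" using assms by (intro mult_right_mono mult_left_mono) auto
    then show "norm (coeff p i) \<le> A * (4 ^ n * \<theta>) ^ i * v i" using p[of i] by linarith
  qed (use assms Suc in auto)
  then show ?case by (simp add: mult.assoc)
qed

lemma sum_half_powers: "(\<Sum>i\<in>{k..d}. (1/2::real) ^ i) \<le> 2 * (1/2) ^ k"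
proof (cases "k \<le> d")
  case True
  have "(\<Sum>i\<in>{k..d}. (1/2::real) ^ i) = 2 * (1/2) ^ k - (1/2) ^ d"
    using True by (induction d rule: dec_induct) simp_all
  then show ?thesis by simp
qed simp

lemma norm_power_diff_le:
  fixes a b :: complex
  assumes "norm a \<le> L" "norm b \<le> L" "L \<ge> 1"
  shows "norm (a ^ n - b ^ n) \<le> real n * L ^ n * norm (a - b)"
proof -
  let ?L = "complex_of_real L"
  have L: "L > 0" using assms by simp
  have "norm ((a / ?L) ^ n - (b / ?L) ^ n) \<le> n * norm (a / ?L - b / ?L)"
    using assms L by (intro norm_power_diff) (auto simp: norm_divide)
  moreover have "(a / ?L) ^ n - (b / ?L) ^ n = (a ^ n - b ^ n) / ?L ^ n" by (simp add: power_divide diff_divide_distrib)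
  moreover have "a / ?L - b / ?L = (a - b) / ?L" by (simp add: diff_divide_distrib)
  ultimately have "norm (a ^ n - b ^ n) / L ^ n \<le> n * (norm (a - b) / L)"
    using L by (simp add: norm_divide norm_power)
  also have "\<dots> \<le> n * (norm (a - b) / 1)" using assms by (intro mult_left_mono divide_left_mono) auto
  finally show ?thesis using L by (simp add: field_simps)
qed

text \<open>Freezing \<open>w\<close> at index \<open>k\<close> yields a majorant for the
  coefficients of powers of a truncated polynomial also beyond degree \<open>k\<close>, where it
  supplies the factor \<open>w k\<close>. If \<open>a\<close> and \<open>b\<close> are below
  \<open>k\<close> but their sum is above, \<open>w b\<close> is first enlarged to
  \<open>w (k - a)\<close>.\<close>

lemma min_majorant:
  fixes w :: "nat \<Rightarrow> real"
  assumes w0: "w 0 = 1" and pos: "\<And>i. w i > 0" and dec: "\<And>i. i < k \<Longrightarrow> w (Suc i) \<le> w i"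
    and mult: "\<And>a b. w a * w b \<le> 2 ^ (a + b) * w (a + b)"
  shows "w (min a k) * w (min b k) \<le> 2 ^ (a + b) * w (min (a + b) k)"
proof -
  have anti: "w y \<le> w x" if "x \<le> y" "y \<le> k" for x y
    using that by (induction y rule: dec_induct) (auto intro: order_trans[OF dec])
  have le1: "w x \<le> 1" if "x \<le> k" for x using anti[of 0 x] that w0 by simp
  have p1: "1 \<le> (2::real) ^ (a + b)" by simp
  consider "a \<ge> k" | "b \<ge> k" | "a + b \<le> k" | "a < k" "b < k" "a + b > k" by linarith
  then show ?thesis
  proof cases
    case 1
    have "w k * w (min b k) \<le> w k * 1" using pos[of k] by (intro mult_left_mono le1) auto
    also have "\<dots> \<le> 2 ^ (a + b) * w k" using pos[of k] p1 mult_right_mono[OF p1, of "w k"] by simp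
    finally show ?thesis using 1 by (simp add: min_absorb2)
  next
    case 2
    have "w (min a k) * w k \<le> 1 * w k" using pos[of k] by (intro mult_right_mono le1) auto
    also have "\<dots> \<le> 2 ^ (a + b) * w k" using pos[of k] p1 mult_right_mono[OF p1, of "w k"] by simp
    finally show ?thesis using 2 by (simp add: min_absorb2)
  next
    case 3
    then show ?thesis using mult[of a b] by (simp add: min_absorb1)
  next
    case 4
    have "w a * w b \<le> w a * w (k - a)" using 4 pos[of a] by (intro mult_left_mono anti) auto
    also have "\<dots> \<le> 2 ^ (a + (k - a)) * w (a + (k - a))" by (rule mult)
    also have "\<dots> = 2 ^ k * w k" using 4 by simp
    also have "\<dots> \<le> 2 ^ (a + b) * w k" using 4 pos[of k] by (intro mult_right_mono power_increasing) auto
    finally show ?thesis using 4 by (simp add: min_absorb2 min_absorb1)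
  qed
qed

text \<open>Bernoulli's inequality for 1 / \<beta>. It disposes of the factor \<open>k + 1\<close>
  that counting edges by the degree has produced.\<close>

lemma linear_times_geometric_bounded:
  fixes \<beta> :: real
  assumes "0 < \<beta>" "\<beta> < 1"
  obtains C where "C > 0" "\<And>k. (real k + 1) * \<beta> ^ k \<le> C"
proof -
  define x where "x = 1 / \<beta> - 1"
  have x: "x > 0" using assms by (simp add: x_def field_simps)
  define C where "C = max 1 (1 / x)"
  have C: "1 \<le> C" "1 / x \<le> C" by (auto simp: C_def)
  show ?thesis
  proof
    show "C > 0" using C by simp
    fix k
    have "1 + real k * x \<le> (1 + x) ^ k" using x by (intro Bernoulli_inequality) auto
    then have b: "(1 + real k * x) * \<beta> ^ k \<le> 1" using assms by (simp add: x_def power_divide field_simps)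
    have "1 \<le> C * x" using C x by (simp add: field_simps)
    then have "real k * 1 \<le> real k * (C * x)" by (intro mult_left_mono) auto
    then have "real k + 1 \<le> C * (1 + real k * x)" using C by (simp add: algebra_simps)
    then have "(real k + 1) * \<beta> ^ k \<le> C * (1 + real k * x) * \<beta> ^ k" using assms by (intro mult_right_mono) auto
    also have "\<dots> \<le> C * 1" using b C mult_left_mono[OF b, of C] by (simp add: mult.assoc)
    finally show "(real k + 1) * \<beta> ^ k \<le> C" by simp
  qed
qed

text \<open>
  The Taylor polynomials \<open>P\<close>, \<open>Q\<close> of \<open>\<phi> ^ j\<close>, \<open>\<phi> ^ Suc j\<close> satisfy \<open>Q ^ j = P ^ Suc j\<close> up to order
  \<open>k\<close>; the remaining coefficients are controlled by \<open>w k\<close>, which bounds products \<open>w a * w b\<close> with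
  \<open>a + b \<ge> k\<close> up to geometric factors.
\<close>

lemma local_approximation:
  fixes j :: nat and C0 :: real
  assumes j: "j \<ge> 1" and C0: "C0 \<ge> 1"
  defines "\<theta> \<equiv> 1 / 4 ^ (j + 2)"
  obtains K where "K \<ge> 1"
    and "\<And>(w :: nat \<Rightarrow> real) k (p :: nat \<Rightarrow> complex) q \<phi>. \<lbrakk>w 0 = 1; \<And>i. w i > 0; \<And>i. i < k \<Longrightarrow> w (Suc i) \<le> w i;
       \<And>a b. w a * w b \<le> 2 ^ (a + b) * w (a + b);
       \<And>i. norm (p i) \<le> C0 * \<theta> ^ i * w i; \<And>i. norm (q i) \<le> C0 * \<theta> ^ i * w i;
       \<And>x::real. \<bar>x\<bar> \<le> 1 \<Longrightarrow> norm (\<phi> x ^ j) \<le> C0; \<And>x::real. \<bar>x\<bar> \<le> 1 \<Longrightarrow> norm (\<phi> x ^ Suc j) \<le> C0;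
       \<And>x::real. \<bar>x\<bar> \<le> 1 \<Longrightarrow> norm (\<phi> x ^ j - (\<Sum>i<k. p i * of_real x ^ i)) \<le> C0 * \<theta> ^ k * w k * \<bar>x\<bar> ^ k;
       \<And>x::real. \<bar>x\<bar> \<le> 1 \<Longrightarrow> norm (\<phi> x ^ Suc j - (\<Sum>i<k. q i * of_real x ^ i)) \<le> C0 * \<theta> ^ k * w k * \<bar>x\<bar> ^ k\<rbrakk> \<Longrightarrow>
       \<exists>F. F holomorphic_on ball 0 (1/2) \<and> (\<forall>z\<in>ball 0 (1/2). norm (F z) \<le> K) \<and>
         (\<forall>x::real. \<bar>x\<bar> < 1/2 \<longrightarrow> norm (F (of_real x) - \<phi> x) \<le> K * root (4 * j * Suc j) (w k))"
proof -
  \<comment> \<open>A factor 2 for the two terms of \<open>Q ^ j - P ^ Suc j\<close>, and another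
    for the geometric tail beyond order \<open>k\<close>.\<close>
  define B where "B = 4 * C0 ^ Suc j"
  define N where "N = 4 * j * Suc j"
  have N: "N > 0" using j by (simp add: N_def)
  have C0j: "C0 \<le> C0 ^ Suc j" using C0 by (intro self_le_power) auto
  have B: "B \<ge> 1" "2 * C0 \<le> B" using C0 C0j unfolding B_def by linarith+
  obtain K where K: "K > 0"
    and key: "\<And>k (P :: complex poly) (Q :: complex poly) (\<tau> :: real). \<lbrakk>degree P \<le> k; \<And>z. norm z \<le> 4 \<Longrightarrow> norm (poly P z) \<le> B; \<And>z. norm z \<le> 4 \<Longrightarrow> norm (poly Q z) \<le> B;
       \<And>z. norm z \<le> 2 \<Longrightarrow> norm (poly Q z ^ j - poly P z ^ Suc j) \<le> B * \<tau> ^ N; 0 < \<tau>; \<tau> \<le> 1\<rbrakk> \<Longrightarrow>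
       \<exists>F. F holomorphic_on ball 0 (1/2) \<and> (\<forall>z\<in>ball 0 (1/2). norm (F z) \<le> K) \<and>
         (\<forall>x::real. \<forall>y. \<bar>x\<bar> < 1/2 \<longrightarrow> norm (y ^ j - poly P (of_real x)) \<le> B * \<tau> ^ N \<longrightarrow>
            norm (y ^ Suc j - poly Q (of_real x)) \<le> B * \<tau> ^ N \<longrightarrow>
            norm (F (of_real x) - y) \<le> K * (real k + 1) * \<tau>)"
    using approximate_quotient[OF j B(1)] unfolding N_def by blast
  \<comment> \<open>All errors below carry a spare (1/2)^k; its N-th root outweighs the linear
    factor in the degree.\<close>
  define \<beta> where "\<beta> = root N (1/2)"
  have \<beta>: "0 < \<beta>" "\<beta> < 1" using N real_root_lt_1_iff[of N "1/2"] by (auto simp: \<beta>_def)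
  obtain C where C: "C > 0" "\<And>k. (real k + 1) * \<beta> ^ k \<le> C" using linear_times_geometric_bounded[OF \<beta>] by blast
  \<comment> \<open>Raising to the power \<open>Suc j\<close> multiplies \<open>\<theta>\<close> by
    \<open>4 ^ Suc j\<close>; the choice leaves ratio 1/4, so that coefficients sum up on the disc
    of radius 2. The bound for \<open>4 * \<theta>\<close> does the same for \<open>P\<close> and
    \<open>Q\<close> on radius 4.\<close>
  have \<theta>: "\<theta> > 0" "4 ^ Suc j * \<theta> = 1/4" "4 ^ j * \<theta> \<le> 1/4" "4 * \<theta> \<le> 1/2" "\<theta> \<le> 1/2"
  proof -
    show "\<theta> > 0" by (simp add: \<theta>_def)
    show "4 ^ Suc j * \<theta> = 1/4" "4 ^ j * \<theta> \<le> 1/4" by (simp_all add: \<theta>_def power_add)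
    have "(4::real) ^ 2 \<le> 4 ^ (j + 2)" by (intro power_increasing) auto
    then have "\<theta> \<le> 1 / 16" by (simp add: \<theta>_def field_simps)
    then show "4 * \<theta> \<le> 1/2" "\<theta> \<le> 1/2" by auto
  qed
  define K' where "K' = max 1 (max K (K * C))"
  have K': "K' \<ge> 1" "K' \<ge> K" "K' \<ge> K * C" by (auto simp: K'_def)
  show ?thesis
  proof
    show "K' \<ge> 1" by fact
    fix w :: "nat \<Rightarrow> real" and k :: nat and p q :: "nat \<Rightarrow> complex" and \<phi>
    assume w0: "w 0 = 1" and wpos: "\<And>i. w i > 0" and dec: "\<And>i. i < k \<Longrightarrow> w (Suc i) \<le> w i"
      and wmult: "\<And>a b. w a * w b \<le> 2 ^ (a + b) * w (a + b)"
      and p: "\<And>i. norm (p i) \<le> C0 * \<theta> ^ i * w i" and q: "\<And>i. norm (q i) \<le> C0 * \<theta> ^ i * w i"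
      and gB: "\<And>x::real. \<bar>x\<bar> \<le> 1 \<Longrightarrow> norm (\<phi> x ^ j) \<le> C0" and hB: "\<And>x::real. \<bar>x\<bar> \<le> 1 \<Longrightarrow> norm (\<phi> x ^ Suc j) \<le> C0"
      and gP: "\<And>x::real. \<bar>x\<bar> \<le> 1 \<Longrightarrow> norm (\<phi> x ^ j - (\<Sum>i<k. p i * of_real x ^ i)) \<le> C0 * \<theta> ^ k * w k * \<bar>x\<bar> ^ k"
      and hQ: "\<And>x::real. \<bar>x\<bar> \<le> 1 \<Longrightarrow> norm (\<phi> x ^ Suc j - (\<Sum>i<k. q i * of_real x ^ i)) \<le> C0 * \<theta> ^ k * w k * \<bar>x\<bar> ^ k"
    define v where "v = (\<lambda>i. w (min i k))"
    have v: "v 0 = 1" "\<And>i. v i \<ge> 0" "\<And>a b. v a * v b \<le> 2 ^ (a + b) * v (a + b)"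
      using w0 wpos min_majorant[OF w0 wpos dec wmult] by (auto simp: v_def less_imp_le)
    have w1: "w i \<le> 1" if "i \<le> k" for i
      using that
    proof (induction i)
      case (Suc i)
      then show ?case using dec[of i] by linarith
    qed (simp add: w0)
    define P Q where "P = (\<Sum>i<k. monom (p i) i)" and "Q = (\<Sum>i<k. monom (q i) i)"
    have cP: "coeff P i = (if i < k then p i else 0)" and cQ: "coeff Q i = (if i < k then q i else 0)" for i
      by (auto simp: P_def Q_def coeff_sum)
    have pP: "poly P z = (\<Sum>i<k. p i * z ^ i)" and pQ: "poly Q z = (\<Sum>i<k. q i * z ^ i)" for z
      by (auto simp: P_def Q_def poly_sum poly_monom)
    have bd4: "norm (\<Sum>i<k. r i * z ^ i) \<le> 2 * C0" if r: "\<And>i. norm (r i) \<le> C0 * \<theta> ^ i * w i" and z: "norm z \<le> 4" for r :: "nat \<Rightarrow> complex" and z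
    proof -
      have "norm (\<Sum>i<k. r i * z ^ i) \<le> (\<Sum>i<k. C0 * (1/2) ^ i)"
      proof (rule sum_norm_le)
        fix i assume "i \<in> {..<k}"
        have "norm (r i * z ^ i) \<le> (C0 * \<theta> ^ i * 1) * 4 ^ i"
          unfolding norm_mult norm_power
        proof (rule mult_mono)
          show "norm (r i) \<le> C0 * \<theta> ^ i * 1"
          proof -
            have "C0 * \<theta> ^ i * w i \<le> C0 * \<theta> ^ i * 1"
              using w1[of i] \<open>i \<in> {..<k}\<close> C0 \<theta> by (intro mult_left_mono) auto
            then show ?thesis using r[of i] by linarith
          qed
        qed (use z C0 \<theta> in \<open>auto intro: power_mono\<close>)
        also have "\<dots> = C0 * (4 * \<theta>) ^ i" by (simp add: power_mult_distrib)
        also have "\<dots> \<le> C0 * (1/2) ^ i" using \<theta> C0 by (intro mult_left_mono power_mono) auto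
        finally show "norm (r i * z ^ i) \<le> C0 * (1/2) ^ i" .
      qed
      also have "\<dots> \<le> C0 * (\<Sum>i\<in>{0..k}. (1/2) ^ i)"
        unfolding sum_distrib_left using C0 by (intro sum_mono2) auto
      also have "\<dots> \<le> C0 * (2 * (1/2) ^ 0)" using C0 by (intro mult_left_mono sum_half_powers) auto
      finally show ?thesis by simp
    qed
    define \<eta> where "\<eta> = Q ^ j - P ^ Suc j"
    have maj: "norm (coeff \<eta> i) \<le> 2 * C0 ^ Suc j * (1/4) ^ i * v i" for i
    proof -
      have "norm (coeff P i) \<le> C0 * \<theta> ^ i * v i" "norm (coeff Q i) \<le> C0 * \<theta> ^ i * v i" for i
        using p q C0 \<theta> v by (auto simp: cP cQ v_def min_absorb1 less_imp_le wpos)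
      then have "norm (coeff (Q ^ j) i) \<le> C0 ^ j * (4 ^ j * \<theta>) ^ i * v i" "norm (coeff (P ^ Suc j) i) \<le> C0 ^ Suc j * (4 ^ Suc j * \<theta>) ^ i * v i"
        using \<theta> C0 by (intro coeff_power_majorant v; auto)+
      moreover have "C0 ^ j * (4 ^ j * \<theta>) ^ i * v i \<le> C0 ^ Suc j * (1/4) ^ i * v i"
        using \<theta> C0 v by (intro mult_right_mono mult_mono power_mono power_increasing) auto
      moreover have "norm (coeff \<eta> i) \<le> norm (coeff (Q ^ j) i) + norm (coeff (P ^ Suc j) i)"
        unfolding \<eta>_def coeff_diff by (rule norm_triangle_ineq4)
      ultimately show ?thesis unfolding \<theta>(2) by linarith
    qed
    \<comment> \<open>On the real axis both \<open>Q ^ j\<close> and \<open>P ^ Suc j\<close> are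
      within O(x^k) of \<open>\<phi> x ^ (j * Suc j)\<close>. The root \<open>\<phi>\<close> may be
      rough, but the comparison is between polynomials, so the low coefficients vanish
      exactly.\<close>
    have van: "coeff \<eta> i = 0" if "i < k" for i
    proof (rule coeff_eq_0_of_small[OF _ that])
      fix x :: real assume x: "0 < x" "x \<le> 1"
      let ?E = "C0 * \<theta> ^ k * w k * x ^ k" and ?L = "2 * C0"
      have ax: "\<bar>x\<bar> \<le> 1" "\<bar>x\<bar> = x" and nx: "norm (complex_of_real x) \<le> 4" using x by auto
      have e1: "norm (poly Q (of_real x) ^ j - (\<phi> x ^ Suc j) ^ j) \<le> real j * ?L ^ j * ?E"
      proof -
        have "norm (poly Q (of_real x) ^ j - (\<phi> x ^ Suc j) ^ j) \<le> real j * ?L ^ j * norm (poly Q (of_real x) - \<phi> x ^ Suc j)"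
          using bd4[OF q nx] hB[OF ax(1)] C0 by (intro norm_power_diff_le) (auto simp: pQ)
        also have "\<dots> \<le> real j * ?L ^ j * ?E"
          using hQ[OF ax(1)] C0 unfolding ax(2) pQ norm_minus_commute[of "sum _ _"] by (intro mult_left_mono) auto
        finally show ?thesis .
      qed
      have e2: "norm ((\<phi> x ^ j) ^ Suc j - poly P (of_real x) ^ Suc j) \<le> real (Suc j) * ?L ^ Suc j * ?E"
      proof -
        have "norm ((\<phi> x ^ j) ^ Suc j - poly P (of_real x) ^ Suc j) \<le> real (Suc j) * ?L ^ Suc j * norm (\<phi> x ^ j - poly P (of_real x))"
          using bd4[OF p nx] gB[OF ax(1)] C0 by (intro norm_power_diff_le) (auto simp: pP)
        also have "\<dots> \<le> real (Suc j) * ?L ^ Suc j * ?E"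
          using gP[OF ax(1)] C0 unfolding ax(2) pP by (intro mult_left_mono) auto
        finally show ?thesis .
      qed
      have "poly \<eta> (of_real x) = (poly Q (of_real x) ^ j - (\<phi> x ^ Suc j) ^ j) + ((\<phi> x ^ j) ^ Suc j - poly P (of_real x) ^ Suc j)"
      proof -
        have "(\<phi> x ^ Suc j) ^ j = (\<phi> x ^ j) ^ Suc j" by (simp only: power_mult[symmetric] mult.commute)
        then show ?thesis by (simp add: \<eta>_def)
      qed
      also have "norm \<dots> \<le> real j * ?L ^ j * ?E + real (Suc j) * ?L ^ Suc j * ?E"
        by (intro norm_triangle_le add_mono e1 e2)
      finally show "norm (poly \<eta> (of_real x)) \<le> ((real j * ?L ^ j + real (Suc j) * ?L ^ Suc j) * (C0 * \<theta> ^ k * w k)) * x ^ k"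
        by (simp add: algebra_simps)
    qed
    define \<delta> where "\<delta> = w k * (1/2) ^ k"
    have \<delta>: "0 < \<delta>" "\<delta> \<le> 1" using wpos[of k] w1[of k] by (auto simp: \<delta>_def power_le_one intro: mult_le_one)
    define \<tau> where "\<tau> = root N \<delta>"
    have \<tau>: "0 < \<tau>" "\<tau> \<le> 1" "\<tau> ^ N = \<delta>" using \<delta> N by (auto simp: \<tau>_def)
    have \<tau>eq: "\<tau> = root N (w k) * \<beta> ^ k" by (simp add: \<tau>_def \<delta>_def \<beta>_def real_root_mult real_root_power N)
    have \<eta>B: "norm (poly \<eta> z) \<le> B * \<delta>" if z: "norm z \<le> 2" for z
    proof -
      have "norm (poly \<eta> z) \<le> (\<Sum>i\<le>degree \<eta>. if k \<le> i then 2 * C0 ^ Suc j * w k * (1/2) ^ i else 0)"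
        unfolding poly_altdef
      proof (rule sum_norm_le)
        fix i
        show "norm (coeff \<eta> i * z ^ i) \<le> (if k \<le> i then 2 * C0 ^ Suc j * w k * (1/2) ^ i else 0)"
        proof (cases "k \<le> i")
          case True
          have "norm (coeff \<eta> i * z ^ i) \<le> (2 * C0 ^ Suc j * (1/4) ^ i * v i) * 2 ^ i"
            unfolding norm_mult norm_power using z C0 v by (intro mult_mono maj power_mono) auto
          also have "\<dots> = 2 * C0 ^ Suc j * v i * ((1/4) ^ i * 2 ^ i)" by simp
          also have "(1/4) ^ i * 2 ^ i = (1/2::real) ^ i" by (simp flip: power_mult_distrib)
          finally show ?thesis using True by (simp add: v_def min_absorb2)
        qed (simp add: van)
      qed
      also have "\<dots> = 2 * C0 ^ Suc j * w k * (\<Sum>i\<in>{k..degree \<eta>}. (1/2) ^ i)"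
      proof -
        have "{i \<in> {..degree \<eta>}. k \<le> i} = {k..degree \<eta>}" by auto
        then show ?thesis by (simp add: sum.inter_filter[symmetric] sum_distrib_left)
      qed
      also have "\<dots> \<le> 2 * C0 ^ Suc j * w k * (2 * (1/2) ^ k)"
        using C0 wpos[of k] by (intro mult_left_mono sum_half_powers) auto
      finally show ?thesis by (simp add: B_def \<delta>_def)
    qed
    have rem: "C0 * \<theta> ^ k * w k * \<bar>x\<bar> ^ k \<le> B * \<delta>" if "\<bar>x\<bar> \<le> 1" for x :: real
    proof -
      have "C0 * \<theta> ^ k * w k * \<bar>x\<bar> ^ k \<le> B * (1/2) ^ k * w k * 1"
        using C0 B \<theta> wpos[of k] that by (intro mult_mono power_mono power_le_one mult_nonneg_nonneg) auto
      then show ?thesis by (simp add: \<delta>_def mult_ac)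
    qed
    have "degree P \<le> k" unfolding P_def by (intro degree_sum_le) (auto intro: order_trans[OF degree_monom_le])
    then have "\<exists>F. F holomorphic_on ball 0 (1/2) \<and> (\<forall>z\<in>ball 0 (1/2). norm (F z) \<le> K) \<and>
         (\<forall>x::real. \<forall>y. \<bar>x\<bar> < 1/2 \<longrightarrow> norm (y ^ j - poly P (of_real x)) \<le> B * \<tau> ^ N \<longrightarrow>
            norm (y ^ Suc j - poly Q (of_real x)) \<le> B * \<tau> ^ N \<longrightarrow>
            norm (F (of_real x) - y) \<le> K * (real k + 1) * \<tau>)"
    proof (rule key)
      show "norm (poly P z) \<le> B" if "norm z \<le> 4" for z using bd4[OF p that] B unfolding pP by linarith
      show "norm (poly Q z) \<le> B" if "norm z \<le> 4" for z using bd4[OF q that] B unfolding pQ by linarith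
      show "norm (poly Q z ^ j - poly P z ^ Suc j) \<le> B * \<tau> ^ N" if "norm z \<le> 2" for z
        using \<eta>B[OF that] unfolding \<tau>(3) by (simp add: \<eta>_def)
    qed (use \<tau> in auto)
    then obtain F where F: "F holomorphic_on ball 0 (1/2)" "\<forall>z\<in>ball 0 (1/2). norm (F z) \<le> K"
      and Fy: "\<And>(x::real) y. \<bar>x\<bar> < 1/2 \<Longrightarrow> norm (y ^ j - poly P (of_real x)) \<le> B * \<tau> ^ N \<Longrightarrow>
            norm (y ^ Suc j - poly Q (of_real x)) \<le> B * \<tau> ^ N \<Longrightarrow>
            norm (F (of_real x) - y) \<le> K * (real k + 1) * \<tau>"
      by blast
    have "norm (F (of_real x) - \<phi> x) \<le> K' * root N (w k)" if x: "\<bar>x\<bar> < 1/2" for x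
    proof -
      have x1: "\<bar>x\<bar> \<le> 1" using x by simp
      have "norm (F (of_real x) - \<phi> x) \<le> K * (real k + 1) * \<tau>"
        using gP[OF x1] hQ[OF x1] rem[OF x1] unfolding \<tau>(3) by (intro Fy[OF x]) (auto simp: pP pQ \<tau>(3))
      also have "\<dots> = K * ((real k + 1) * \<beta> ^ k) * root N (w k)" by (simp add: \<tau>eq)
      also have "\<dots> \<le> K * C * root N (w k)"
        using C K wpos[of k] N by (intro mult_right_mono mult_left_mono) (auto intro: less_imp_le)
      also have "\<dots> \<le> K' * root N (w k)" using K' wpos[of k] N by (intro mult_right_mono) (auto intro: less_imp_le)
      finally show ?thesis .
    qed
    then show "\<exists>F. F holomorphic_on ball 0 (1/2) \<and> (\<forall>z\<in>ball 0 (1/2). norm (F z) \<le> K') \<and>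
         (\<forall>x::real. \<bar>x\<bar> < 1/2 \<longrightarrow> norm (F (of_real x) - \<phi> x) \<le> K' * root (4 * j * Suc j) (w k))"
      using F K' unfolding N_def by (intro exI[of _ F]) (auto intro: order_trans)
  qed
qed

section \<open>Smoothness from holomorphic approximation at all scales\<close>

text \<open>
  Multiply the four rotations of \<open>G\<close> about \<open>z\<close>: on each side of the square centred at \<open>z\<close> with one
  side on the real axis, one of the factors is evaluated at a real point.
\<close>

lemma two_constants_near_real_axis:
  fixes G :: "complex \<Rightarrow> complex" and x0 \<rho> e B :: real
  assumes G: "G holomorphic_on ball (of_real x0) \<rho>"
    and B: "\<And>z. z \<in> ball (of_real x0) \<rho> \<Longrightarrow> norm (G z) \<le> B"
    and e: "\<And>x::real. \<bar>x - x0\<bar> < \<rho> \<Longrightarrow> norm (G (of_real x)) \<le> e"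
    and eB: "e \<le> B" and z: "z \<in> ball (of_real x0) (\<rho> / 4)"
  shows "norm (G z) ^ 4 \<le> e * B ^ 3"
proof (cases "Im z = 0")
  case True
  have z': "norm (of_real x0 - z) < \<rho> / 4" using z by (simp add: dist_norm)
  then have \<rho>: "\<rho> > 0" using norm_ge_zero[of "of_real x0 - z"] by linarith
  have zr: "z = of_real (Re z)" using True by (simp add: complex_eq_iff)
  have "norm (of_real x0 - z) = \<bar>x0 - Re z\<bar>" by (subst zr) (simp flip: of_real_diff)
  then have "\<bar>Re z - x0\<bar> < \<rho>" using z' \<rho> by linarith
  then have Ge: "norm (G z) \<le> e" using e[of "Re z"] zr by simp
  then have "0 \<le> e" using norm_ge_zero order_trans by blast
  then have "norm (G z) * norm (G z) ^ 3 \<le> e * B ^ 3"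
    using Ge eB by (intro mult_mono power_mono) auto
  then show ?thesis by (simp add: power4_eq_xxxx power3_eq_cube)
next
  case False
  define y where "y = \<bar>Im z\<bar>"
  have y: "y > 0" using False by (simp add: y_def)
  define H where "H = (\<lambda>w. G (z + w) * G (z + \<i> * w) * G (z - w) * G (z - \<i> * w))"
  define S where "S = cbox (Complex (-y) (-y)) (Complex y y)"
  have zb: "norm (z - of_real x0) < \<rho> / 4" using z by (simp add: dist_norm norm_minus_commute)
  have y4: "y < \<rho> / 4" using abs_Im_le_cmod[of "z - of_real x0"] zb by (simp add: y_def)
  have wS: "norm w \<le> 2 * y" if "w \<in> S" for w
    using that cmod_le[of w] by (auto simp: S_def in_cbox_complex_iff)
  have inb: "z + v \<in> ball (of_real x0) \<rho>" if "norm v \<le> 2 * y" for v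
  proof -
    have "norm (z + v - of_real x0) \<le> norm (z - of_real x0) + norm v"
      using norm_triangle_ineq[of "z - of_real x0" v] by (simp add: algebra_simps)
    then show ?thesis using that zb y4 y by (simp add: dist_norm norm_minus_commute)
  qed
  have inbs: "z + w \<in> ball (of_real x0) \<rho>" "z + \<i> * w \<in> ball (of_real x0) \<rho>" "z - w \<in> ball (of_real x0) \<rho>" "z - \<i> * w \<in> ball (of_real x0) \<rho>"
    if "w \<in> S" for w
    using inb[of w] inb[of "\<i> * w"] inb[of "-w"] inb[of "-\<i> * w"] wS[OF that] by (auto simp: norm_mult)
  have comp: "(\<lambda>w. G (g w)) holomorphic_on S" if "g holomorphic_on S" "\<And>w. w \<in> S \<Longrightarrow> g w \<in> ball (of_real x0) \<rho>" for g
  proof -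
    have "(G \<circ> g) holomorphic_on S" using that by (intro holomorphic_on_compose_gen[OF _ G]) auto
    then show ?thesis by (simp add: o_def)
  qed
  have hol: "H holomorphic_on S"
    unfolding H_def using inbs by (intro holomorphic_intros comp) auto
  have small: "norm (G (z + v)) \<le> e" if "norm v \<le> 2 * y" "Im v = - Im z" for v
  proof -
    have r: "z + v = of_real (Re (z + v))" using that(2) by (simp add: complex_eq_iff)
    have "norm (of_real x0 - (z + v)) < \<rho>" using inb[OF that(1)] by (simp add: dist_norm)
    then have "\<bar>Re (z + v) - x0\<bar> < \<rho>" using abs_Re_le_cmod[of "of_real x0 - (z + v)"] by simp
    then show ?thesis using e[of "Re (z + v)"] r by metis
  qed
  have "norm (H 0) \<le> e * B ^ 3"
  proof (rule maximum_modulus_frontier[where f = H and S = S])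
    show "H holomorphic_on interior S" using hol by (rule holomorphic_on_subset[OF _ interior_subset])
    show "continuous_on (closure S) H" using hol by (simp add: S_def holomorphic_on_imp_continuous_on)
    show "bounded S" by (simp add: S_def)
    show "0 \<in> S" using y by (simp add: S_def in_cbox_complex_iff)
    fix w assume "w \<in> frontier S"
    then have w: "w \<in> S" "\<bar>Re w\<bar> = y \<or> \<bar>Im w\<bar> = y"
      by (auto simp: S_def frontier_def in_cbox_complex_iff in_box_complex_iff)
    have Bs: "norm (G (z + w)) \<le> B" "norm (G (z + \<i> * w)) \<le> B" "norm (G (z - w)) \<le> B" "norm (G (z - \<i> * w)) \<le> B"
      using inbs[OF w(1)] B by auto
    have B0: "B \<ge> 0" using Bs(1) norm_ge_zero order_trans by blast
    have n: "norm w \<le> 2 * y" "norm (\<i> * w) \<le> 2 * y" "norm (- w) \<le> 2 * y" "norm (- (\<i> * w)) \<le> 2 * y"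
      using wS[OF w(1)] by (auto simp: norm_mult)
    have cases4: "Im w = - Im z \<or> Re w = - Im z \<or> - Im w = - Im z \<or> - Re w = - Im z"
      using w(2) by (auto simp: y_def)
    have p: "a * b * c * d \<le> e * B ^ 3"
      if "0 \<le> a" "0 \<le> b" "0 \<le> c" "0 \<le> d" "a \<le> B" "b \<le> B" "c \<le> B" "d \<le> B" "a \<le> e \<or> b \<le> e \<or> c \<le> e \<or> d \<le> e" for a b c d
    proof -
      have *: "a * b * c * d \<le> e * B ^ 3"
        if "0 \<le> a" "0 \<le> b" "0 \<le> c" "0 \<le> d" "a \<le> e" "b \<le> B" "c \<le> B" "d \<le> B" for a b c d
      proof -
        have "a * b * c * d \<le> e * B * B * B" using that B0 by (intro mult_mono mult_nonneg_nonneg) auto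
        then show ?thesis by (simp add: power3_eq_cube mult.assoc)
      qed
      show ?thesis using that *[of a b c d] *[of b a c d] *[of c a b d] *[of d a b c]
        by (auto simp: mult_ac)
    qed
    show "norm (H w) \<le> e * B ^ 3"
      unfolding H_def norm_mult
      by (rule p) (use Bs small[OF n(1)] small[OF n(2)] small[OF n(3)] small[OF n(4)] cases4 in auto)
  qed
  then show ?thesis by (simp add: H_def norm_mult power4_eq_xxxx)
qed

section \<open>Derivatives as limits over dyadic scales\<close>

lemma deriv_bound_of_bound:
  fixes f :: "complex \<Rightarrow> complex"
  assumes f: "f holomorphic_on ball c r" and B: "\<And>z. z \<in> ball c r \<Longrightarrow> norm (f z) \<le> B" and r: "r > 0"
  shows "norm ((deriv ^^ l) f c) \<le> fact l * B * (2 / r) ^ l"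
proof -
  have "norm ((deriv ^^ l) f c) \<le> fact l * B / (r / 2) ^ l"
  proof (rule Cauchy_inequality)
    have sub: "cball c (r/2) \<subseteq> ball c r" using r by auto
    show "f holomorphic_on ball c (r/2)" by (rule holomorphic_on_subset[OF f]) (use r in auto)
    show "continuous_on (cball c (r/2)) f" using f sub by (meson holomorphic_on_imp_continuous_on holomorphic_on_subset)
    show "norm (f x) \<le> B" if "norm (c - x) = r/2" for x using that r by (intro B) (auto simp: dist_norm)
  qed (use r in auto)
  then show ?thesis by (simp add: power_divide)
qed

lemma higher_deriv_real_segment_Taylor:
  fixes F :: "complex \<Rightarrow> complex"
  assumes F: "F holomorphic_on ball (of_real x0) r" and x: "\<bar>x - x0\<bar> < r"
    and M: "\<And>y. y \<in> closed_segment x0 x \<Longrightarrow> norm ((deriv ^^ Suc (Suc l)) F (of_real y)) \<le> M"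
  shows "norm ((deriv ^^ l) F (of_real x) - (deriv ^^ l) F (of_real x0) - of_real (x - x0) * (deriv ^^ Suc l) F (of_real x0))
     \<le> M * \<bar>x - x0\<bar> ^ 2"
proof -
  let ?S = "closed_segment (complex_of_real x0) (of_real x)"
  have S: "\<exists>y. z = of_real y \<and> y \<in> closed_segment x0 x \<and> \<bar>y - x0\<bar> \<le> \<bar>x - x0\<bar>" if z: "z \<in> ?S" for z
  proof -
    obtain y where "z = of_real y" "y \<in> closed_segment x0 x" using z unfolding closed_segment_of_real by blast
    then show ?thesis by (auto simp: closed_segment_eq_real_ivl split: if_splits)
  qed
  have sub: "?S \<subseteq> ball (of_real x0) r"
  proof
    fix z assume "z \<in> ?S"
    then obtain y where "z = of_real y" "\<bar>y - x0\<bar> \<le> \<bar>x - x0\<bar>" using S by blast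
    then show "z \<in> ball (of_real x0) r" using x by (simp add: dist_norm abs_minus_commute flip: of_real_diff)
  qed
  have "norm ((deriv ^^ (l + 0)) F (of_real x) - (\<Sum>i\<le>1. (deriv ^^ (l + i)) F (of_real x0) * (of_real x - of_real x0) ^ i / fact i))
      \<le> M * norm (complex_of_real x - of_real x0) ^ (Suc 1) / fact 1"
  proof (rule complex_Taylor[where f = "\<lambda>i. (deriv ^^ (l + i)) F"])
    show "convex ?S" by simp
    fix i z assume "z \<in> ?S"
    then have "z \<in> ball (of_real x0) r" using sub by blast
    moreover have "(deriv ^^ (l + i)) F holomorphic_on ball (of_real x0) r"
      using F by (intro holomorphic_higher_deriv) auto
    ultimately show "((deriv ^^ (l + i)) F has_field_derivative (deriv ^^ (l + Suc i)) F z) (at z within ?S)"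
      by (simp add: holomorphic_derivI)
  next
    fix z assume "z \<in> ?S"
    then obtain y where "z = of_real y" "y \<in> closed_segment x0 x" using S by blast
    then show "norm ((deriv ^^ (l + Suc 1)) F z) \<le> M" using M by simp
  qed auto
  then show ?thesis by (simp add: mult.commute diff_diff_add norm_minus_commute power2_eq_square flip: of_real_diff)
qed

lemma geometric_increments:
  fixes a :: "nat \<Rightarrow> complex" and c :: "nat \<Rightarrow> real"
  assumes a: "\<And>n. norm (a n - a (Suc n)) \<le> c n" and c: "\<And>n. c (Suc n) \<le> c n / 2"
  shows "convergent a" and "a \<longlonglongrightarrow> L \<Longrightarrow> norm (a n - L) \<le> 2 * c n"
proof -
  \<comment> \<open>Keeping the negative term lets the induction close, since c (n + m) + 2 c (n + m
    + 1) \<le> 2 c (n + m).\<close>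
  have tele: "norm (a (n + m) - a n) \<le> 2 * c n - 2 * c (n + m)" for n m
  proof (induction m)
    case (Suc m)
    have "norm (a (n + Suc m) - a n) \<le> norm (a (n + m) - a n) + norm (a (n + m) - a (Suc (n + m)))"
      using norm_triangle_ineq4[of "a (n + m) - a n" "a (n + m) - a (Suc (n + m))"] by simp
    then show ?case using Suc a[of "n + m"] c[of "n + m"] by simp
  qed simp
  have c0: "0 \<le> c n" for n using a[of n] norm_ge_zero order_trans by blast
  have tele': "norm (a m - a n) \<le> 2 * c n" if "n \<le> m" for m n
    using tele[of n "m - n"] c0[of m] that by simp
  have cpow: "c n \<le> c 0 * (1/2) ^ n" for n
  proof (induction n)
    case (Suc n)
    then show ?case using c[of n] by simp
  qed simp
  have "(\<lambda>n. c 0 * (1/2) ^ n) \<longlonglongrightarrow> c 0 * 0"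
    by (intro tendsto_mult tendsto_const LIMSEQ_power_zero) simp
  then have clim: "(\<lambda>n. 2 * c n) \<longlonglongrightarrow> 0"
    using tendsto_sandwich[of "\<lambda>_. 0" c sequentially "\<lambda>n. c 0 * (1/2) ^ n" 0] cpow c0
    by (auto intro!: tendsto_mult_right_zero)
  have "Cauchy a"
  proof (rule metric_CauchyI)
    fix e :: real assume "0 < e"
    then have "eventually (\<lambda>n. 2 * c n < e / 2) sequentially" using order_tendstoD(2)[OF clim, of "e / 2"] by simp
    then obtain N where N: "2 * c N < e / 2" by (auto simp: eventually_sequentially)
    have "dist (a m) (a n) < e" if "m \<ge> N" "n \<ge> N" for m n
    proof -
      have "dist (a m) (a n) \<le> dist (a m) (a N) + dist (a n) (a N)" by (rule dist_triangle2)
      then show ?thesis using tele'[OF that(1)] tele'[OF that(2)] N by (simp add: dist_norm)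
    qed
    then show "\<exists>M. \<forall>m\<ge>M. \<forall>n\<ge>M. dist (a m) (a n) < e" by blast
  qed
  then show "convergent a" by (simp add: Cauchy_convergent_iff)
  assume L: "a \<longlonglongrightarrow> L"
  have "(\<lambda>m. norm (a m - a n)) \<longlonglongrightarrow> norm (L - a n)" by (intro tendsto_intros L)
  moreover have "\<forall>\<^sub>F m in sequentially. norm (a m - a n) \<le> 2 * c n"
    using tele' by (auto simp: eventually_sequentially)
  ultimately have "norm (L - a n) \<le> 2 * c n" by (intro tendsto_upperbound) auto
  then show "norm (a n - L) \<le> 2 * c n" by (simp add: norm_minus_commute)
qed

lemma has_vector_derivative_of_quadratic_error:
  fixes g :: "real \<Rightarrow> complex"
  assumes S: "open S" "x0 \<in> S" and r: "r > 0"
    and le: "\<And>x. x \<in> S \<Longrightarrow> \<bar>x - x0\<bar> < r \<Longrightarrow> norm (g x - g x0 - of_real (x - x0) * d) \<le> C * \<bar>x - x0\<bar> ^ 2"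
  shows "(g has_vector_derivative d) (at x0)"
proof -
  have "((\<lambda>x. norm (g x - g x0 - (x - x0) *\<^sub>R d) / norm (x - x0)) \<longlongrightarrow> 0) (at x0)"
  proof (rule Lim_null_comparison)
    have "((\<lambda>x. C * \<bar>x - x0\<bar>) \<longlongrightarrow> C * \<bar>x0 - x0\<bar>) (at x0)" by (intro tendsto_intros)
    then show "((\<lambda>x. C * \<bar>x - x0\<bar>) \<longlongrightarrow> 0) (at x0)" by simp
    have "\<forall>\<^sub>F x in at x0. x \<in> S" using S by (simp add: eventually_at_in_open')
    moreover have "\<forall>\<^sub>F x in at x0. \<bar>x - x0\<bar> < r" using r by (auto simp: eventually_at dist_real_def)
    moreover have "\<forall>\<^sub>F x in at x0. x \<noteq> x0" by (simp add: eventually_neq_at_within)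
    ultimately show "\<forall>\<^sub>F x in at x0. norm (norm (g x - g x0 - (x - x0) *\<^sub>R d) / norm (x - x0)) \<le> C * \<bar>x - x0\<bar>"
    proof eventually_elim
      case (elim x)
      have "norm (g x - g x0 - (x - x0) *\<^sub>R d) \<le> C * \<bar>x - x0\<bar> * \<bar>x - x0\<bar>"
        using le[of x] elim by (simp add: scaleR_conv_of_real power2_eq_square)
      then show ?case using elim by (simp add: divide_le_eq)
    qed
  qed
  then show ?thesis
    by (simp add: has_vector_derivative_def has_derivative_iff_norm bounded_linear_scaleR_left)
qed

text \<open>Two approximants agree on the real axis up to their errors. Carrying this to a complex
  disc costs a fourth root, whence the fourth power in the hypothesis; Cauchy's estimate for
  \<open>l\<close> derivatives then costs \<open>l\<close> powers of the scale. As the error is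
  bounded for every order at once, order \<open>l + q\<close> leaves \<open>q\<close> powers: one
  makes the derivatives converge along dyadic scales, which puts \<open>A (Suc l)\<close> into the
  conclusion, and two give a quadratic error in the difference quotient.\<close>

theorem smooth_of_local_approximations:
  fixes f :: "real \<Rightarrow> complex" and S :: "real set" and B \<epsilon>0 :: real and A :: "nat \<Rightarrow> real"
  assumes S: "open S" "is_interval S" and B: "B \<ge> 1" and \<epsilon>0: "\<epsilon>0 > 0" and A: "\<And>l. A l \<ge> 0"
    and approx: "\<And>x0 \<epsilon>. x0 \<in> S \<Longrightarrow> 0 < \<epsilon> \<Longrightarrow> \<epsilon> \<le> \<epsilon>0 \<Longrightarrow>
      \<exists>F. F holomorphic_on ball (of_real x0) \<epsilon> \<and> (\<forall>z\<in>ball (of_real x0) \<epsilon>. norm (F z) \<le> B) \<and>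
        (\<forall>x l. \<bar>x - x0\<bar> < \<epsilon> \<longrightarrow> norm (F (of_real x) - f x) \<le> (A l * \<epsilon> ^ l) ^ 4)"
  obtains D :: "nat \<Rightarrow> real \<Rightarrow> complex" where "\<And>x. x \<in> S \<Longrightarrow> D 0 x = f x"
    and "\<And>l x. x \<in> S \<Longrightarrow> (D l has_vector_derivative D (Suc l) x) (at x)"
    and "\<And>l x. x \<in> S \<Longrightarrow> norm (D l x) \<le> fact l * B * (2 / \<epsilon>0) ^ l + 2 * (fact l * 16 ^ l * 2 * B * A (Suc l)) * \<epsilon>0"
proof -
  obtain F where Fh: "\<And>x0 \<epsilon>. x0 \<in> S \<Longrightarrow> 0 < \<epsilon> \<Longrightarrow> \<epsilon> \<le> \<epsilon>0 \<Longrightarrow> F x0 \<epsilon> holomorphic_on ball (of_real x0) \<epsilon>"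
    and FB: "\<And>x0 \<epsilon> z. x0 \<in> S \<Longrightarrow> 0 < \<epsilon> \<Longrightarrow> \<epsilon> \<le> \<epsilon>0 \<Longrightarrow> z \<in> ball (of_real x0) \<epsilon> \<Longrightarrow> norm (F x0 \<epsilon> z) \<le> B"
    and Fe: "\<And>x0 \<epsilon> x l. x0 \<in> S \<Longrightarrow> 0 < \<epsilon> \<Longrightarrow> \<epsilon> \<le> \<epsilon>0 \<Longrightarrow> \<bar>x - x0\<bar> < \<epsilon> \<Longrightarrow> norm (F x0 \<epsilon> (of_real x) - f x) \<le> (A l * \<epsilon> ^ l) ^ 4"
  proof -
    have "\<forall>x0. \<exists>G. \<forall>\<epsilon>. x0 \<in> S \<longrightarrow> 0 < \<epsilon> \<longrightarrow> \<epsilon> \<le> \<epsilon>0 \<longrightarrow> G \<epsilon> holomorphic_on ball (of_real x0) \<epsilon> \<and> (\<forall>z\<in>ball (of_real x0) \<epsilon>. norm (G \<epsilon> z) \<le> B) \<and>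
        (\<forall>x l. \<bar>x - x0\<bar> < \<epsilon> \<longrightarrow> norm (G \<epsilon> (of_real x) - f x) \<le> (A l * \<epsilon> ^ l) ^ 4)"
      by (intro allI choice) (use approx in blast)
    from choice[OF this] obtain G where G: "\<forall>x0 \<epsilon>. x0 \<in> S \<longrightarrow> 0 < \<epsilon> \<longrightarrow> \<epsilon> \<le> \<epsilon>0 \<longrightarrow> G x0 \<epsilon> holomorphic_on ball (of_real x0) \<epsilon> \<and> (\<forall>z\<in>ball (of_real x0) \<epsilon>. norm (G x0 \<epsilon> z) \<le> B) \<and>
        (\<forall>x l. \<bar>x - x0\<bar> < \<epsilon> \<longrightarrow> norm (G x0 \<epsilon> (of_real x) - f x) \<le> (A l * \<epsilon> ^ l) ^ 4)" by blast
    show ?thesis by (rule that[of G]) (use G in blast)+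
  qed
  have cmp: "norm ((deriv ^^ l) (F x0 \<epsilon>) (of_real x1) - (deriv ^^ l) (F x1 \<epsilon>') (of_real x1)) \<le> fact l * (2 * B * (A p * \<epsilon> ^ p)) * (8 / \<rho>) ^ l"
    if x: "x0 \<in> S" "x1 \<in> S" and \<epsilon>: "0 < \<epsilon>'" "\<epsilon>' \<le> \<epsilon>" "\<epsilon> \<le> \<epsilon>0" and \<rho>: "0 < \<rho>" "\<rho> \<le> \<epsilon>'" "\<bar>x1 - x0\<bar> + \<rho> \<le> \<epsilon>"
    for x0 x1 \<epsilon> \<epsilon>' \<rho> l p
  proof -
    let ?G = "\<lambda>z. F x0 \<epsilon> z - F x1 \<epsilon>' z"
    let ?b = "ball (complex_of_real x1)"
    have sub1: "?b \<rho> \<subseteq> ball (of_real x0) \<epsilon>"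
    proof
      fix z assume "z \<in> ?b \<rho>"
      moreover have "dist (of_real x0) z \<le> dist (complex_of_real x0) (of_real x1) + dist (of_real x1) z" by (rule dist_triangle)
      moreover have "dist (complex_of_real x0) (of_real x1) = \<bar>x1 - x0\<bar>" by (simp add: dist_real_def abs_minus_commute)
      ultimately show "z \<in> ball (of_real x0) \<epsilon>" using \<rho> by auto
    qed
    have sub2: "?b \<rho> \<subseteq> ball (of_real x1) \<epsilon>'" using \<rho> by auto
    have h1: "F x0 \<epsilon> holomorphic_on ?b \<rho>" by (rule holomorphic_on_subset[OF Fh sub1]) (use x \<epsilon> in auto)
    have h2: "F x1 \<epsilon>' holomorphic_on ?b \<rho>" by (rule holomorphic_on_subset[OF Fh sub2]) (use x \<epsilon> in auto)
    have hG: "?G holomorphic_on ?b \<rho>" using h1 h2 by (intro holomorphic_intros)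
    define e where "e = (A p * \<epsilon> ^ p) ^ 4"
    have e0: "e \<ge> 0" by (simp add: e_def)
    have e': "(A p * \<epsilon>' ^ p) ^ 4 \<le> e"
      unfolding e_def using A \<epsilon> by (intro power_mono mult_left_mono) auto
    have GB: "norm (?G z) \<le> 2 * B" if "z \<in> ?b \<rho>" for z
    proof -
      have "norm (F x0 \<epsilon> z) \<le> B" "norm (F x1 \<epsilon>' z) \<le> B" using FB x \<epsilon> sub1 sub2 that by auto
      then show ?thesis using norm_triangle_ineq4[of "F x0 \<epsilon> z" "F x1 \<epsilon>' z"] by linarith
    qed
    have Ge: "norm (?G (of_real y)) \<le> 2 * e" if "\<bar>y - x1\<bar> < \<rho>" for y
    proof -
      have "norm (F x0 \<epsilon> (of_real y) - f y) \<le> e" unfolding e_def using that x \<epsilon> \<rho> by (intro Fe) auto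
      moreover have "norm (F x1 \<epsilon>' (of_real y) - f y) \<le> (A p * \<epsilon>' ^ p) ^ 4" using that x \<epsilon> \<rho> by (intro Fe) auto
      moreover have "norm (?G (of_real y)) \<le> norm (F x0 \<epsilon> (of_real y) - f y) + norm (F x1 \<epsilon>' (of_real y) - f y)"
        using norm_triangle_ineq4[of "F x0 \<epsilon> (of_real y) - f y" "F x1 \<epsilon>' (of_real y) - f y"] by simp
      ultimately show ?thesis using e' by linarith
    qed
    have small: "norm (?G z) \<le> 2 * B * (A p * \<epsilon> ^ p)" if z: "z \<in> ?b (\<rho> / 4)" for z
    proof -
      \<comment> \<open>The two-constants bound presupposes an error below the global bound; a
        larger error makes the claim trivial. Afterwards \<open>B\<close> \<ge> 1 raises B^3 to B^4,
        so that a fourth root can be taken.\<close>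
      have "norm (?G z) ^ 4 \<le> 2 * e * (2 * B) ^ 3"
      proof (cases "2 * e \<le> 2 * B")
        case True
        show ?thesis by (rule two_constants_near_real_axis[OF hG GB Ge True z])
      next
        case False
        have "norm (?G z) \<le> 2 * B" using z \<rho> by (intro GB) auto
        then have "norm (?G z) * norm (?G z) ^ 3 \<le> 2 * e * (2 * B) ^ 3"
          using False B by (intro mult_mono power_mono) auto
        then show ?thesis by (simp add: power4_eq_xxxx power3_eq_cube)
      qed
      also have "\<dots> = 16 * B ^ 3 * 1 * e" by (simp add: power_mult_distrib)
      also have "\<dots> \<le> 16 * B ^ 3 * B * e" using B e0 by (intro mult_right_mono mult_left_mono) auto
      also have "\<dots> = (2 * B * (A p * \<epsilon> ^ p)) ^ 4" by (simp add: e_def power_mult_distrib eval_nat_numeral)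
      finally have "norm (?G z) ^ Suc 3 \<le> (2 * B * (A p * \<epsilon> ^ p)) ^ Suc 3" by simp
      then show ?thesis by (rule power_le_imp_le_base) (use B A \<epsilon> in auto)
    qed
    have "norm ((deriv ^^ l) ?G (of_real x1)) \<le> fact l * (2 * B * (A p * \<epsilon> ^ p)) * (2 / (\<rho> / 4)) ^ l"
      by (rule deriv_bound_of_bound[OF holomorphic_on_subset[OF hG] small]) (use \<rho> in auto)
    moreover have "(deriv ^^ l) ?G (of_real x1) = (deriv ^^ l) (F x0 \<epsilon>) (of_real x1) - (deriv ^^ l) (F x1 \<epsilon>') (of_real x1)"
      by (rule higher_deriv_diff[OF h1 h2]) (use \<rho> in auto)
    ultimately show ?thesis by simp
  qed
  define \<epsilon> where "\<epsilon> = (\<lambda>n. \<epsilon>0 / 2 ^ n)"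
  have \<epsilon>: "0 < \<epsilon> n" "\<epsilon> n \<le> \<epsilon>0" "\<epsilon> (Suc n) = \<epsilon> n / 2" for n
    using \<epsilon>0 by (auto simp: \<epsilon>_def field_simps)
  define \<Phi> where "\<Phi> = (\<lambda>x n l z. (deriv ^^ l) (F x (\<epsilon> n)) z)"
  \<comment> \<open>The 16 is 8 / (1/2): approximants are compared on discs of radius
    \<open>\<epsilon> n / 2\<close>, with the constant 8 of \<open>cmp\<close>.\<close>
  define K where "K = (\<lambda>l q. fact l * 16 ^ l * 2 * B * A (l + q))"
  have K0: "K l q \<ge> 0" for l q using A B by (simp add: K_def)
  have Keq: "fact l * (2 * B * (A (l + q) * \<epsilon> n ^ (l + q))) * (8 / (\<epsilon> n / 2)) ^ l = K l q * \<epsilon> n ^ q" for l q n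
    using \<epsilon>(1)[of n] by (simp add: K_def power_add power_divide field_simps power_mult_distrib)
  have S1: "norm (\<Phi> x n l (of_real y) - \<Phi> y n l (of_real y)) \<le> K l q * \<epsilon> n ^ q"
    if "x \<in> S" "y \<in> S" "\<bar>y - x\<bar> \<le> \<epsilon> n / 2" for x y n l q
    using cmp[of x y "\<epsilon> n" "\<epsilon> n" "\<epsilon> n / 2" l "l + q"] that \<epsilon>[of n] unfolding Keq \<Phi>_def by simp
  have S2: "norm (\<Phi> x n l (of_real x) - \<Phi> x (Suc n) l (of_real x)) \<le> K l q * \<epsilon> n ^ q"
    if "x \<in> S" for x n l q
    using cmp[of x x "\<epsilon> (Suc n)" "\<epsilon> n" "\<epsilon> n / 2" l "l + q"] that \<epsilon>[of n] unfolding Keq \<Phi>_def by (simp add: \<epsilon>(3))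
  define D where "D = (\<lambda>l x. lim (\<lambda>n. \<Phi> x n l (of_real x)))"
  have half: "K l q * \<epsilon> (Suc n) ^ q \<le> K l q * \<epsilon> n ^ q / 2" if "q \<ge> 1" for l q n
  proof -
    have "(2::real) ^ 1 \<le> 2 ^ q" using that by (intro power_increasing) auto
    then have "\<epsilon> n ^ q / 2 ^ q \<le> \<epsilon> n ^ q / 2" using \<epsilon>(1)[of n] by (intro divide_left_mono) auto
    then show ?thesis using K0[of l q] mult_left_mono[of "\<epsilon> n ^ q / 2 ^ q" "\<epsilon> n ^ q / 2" "K l q"] by (simp add: \<epsilon>(3) power_divide)
  qed
  have lim: "(\<lambda>n. \<Phi> x n l (of_real x)) \<longlonglongrightarrow> D l x" if "x \<in> S" for x l
  proof -
    have "convergent (\<lambda>n. \<Phi> x n l (of_real x))"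
      by (rule geometric_increments(1)[of _ "\<lambda>n. K l 1 * \<epsilon> n ^ 1"]) (use S2[OF that, of _ l 1] half[of 1 l] in auto)
    then show ?thesis by (simp add: D_def convergent_LIMSEQ_iff)
  qed
  have S3: "norm (\<Phi> x n l (of_real x) - D l x) \<le> 2 * (K l q * \<epsilon> n ^ q)" if "x \<in> S" "q \<ge> 1" for x n l q
    using geometric_increments(2)[of "\<lambda>n. \<Phi> x n l (of_real x)" "\<lambda>n. K l q * \<epsilon> n ^ q" "D l x" n]
      S2[OF that(1), of _ l q] half[OF that(2), of l] lim[OF that(1)] by simp
  have S4: "norm (\<Phi> x n l (of_real y) - D l y) \<le> 3 * (K l 2 * \<epsilon> n ^ 2)" if "x \<in> S" "y \<in> S" "\<bar>y - x\<bar> \<le> \<epsilon> n / 2" for x y n l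
  proof -
    have "norm (\<Phi> x n l (of_real y) - D l y) \<le> norm (\<Phi> x n l (of_real y) - \<Phi> y n l (of_real y)) + norm (\<Phi> y n l (of_real y) - D l y)"
      using norm_triangle_ineq[of "\<Phi> x n l (of_real y) - \<Phi> y n l (of_real y)" "\<Phi> y n l (of_real y) - D l y"] by simp
    then show ?thesis using S1[OF that, of l 2] S3[OF that(2), of 2 n l] by linarith
  qed
  have bound: "norm (D l x) \<le> fact l * B * (2 / \<epsilon>0) ^ l + 2 * (fact l * 16 ^ l * 2 * B * A (Suc l)) * \<epsilon>0" if "x \<in> S" for l x
  proof -
    have "norm (\<Phi> x 0 l (of_real x)) \<le> fact l * B * (2 / \<epsilon> 0) ^ l"
      unfolding \<Phi>_def by (rule deriv_bound_of_bound[OF Fh FB]) (use that \<epsilon> in auto)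
    moreover have "norm (D l x) \<le> norm (\<Phi> x 0 l (of_real x)) + norm (\<Phi> x 0 l (of_real x) - D l x)"
      using norm_triangle_ineq4[of "\<Phi> x 0 l (of_real x)" "\<Phi> x 0 l (of_real x) - D l x"] by simp
    ultimately show ?thesis using S3[OF that, of 1 0 l] by (simp add: \<epsilon>_def K_def)
  qed
  have D0: "D 0 x = f x" if "x \<in> S" for x
  proof -
    have \<epsilon>lim: "\<epsilon> \<longlonglongrightarrow> 0"
      unfolding \<epsilon>_def using tendsto_mult[OF tendsto_const[of \<epsilon>0] LIMSEQ_power_zero[of "1/2::real"]]
      by (simp add: power_divide)
    have "(\<lambda>n. (A 1 * \<epsilon> n ^ 1) ^ 4) \<longlonglongrightarrow> (A 1 * 0 ^ 1) ^ 4" by (intro tendsto_intros \<epsilon>lim)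
    then have "(\<lambda>n. (A 1 * \<epsilon> n ^ 1) ^ 4) \<longlonglongrightarrow> 0" by simp
    then have "(\<lambda>n. \<Phi> x n 0 (of_real x) - f x) \<longlonglongrightarrow> 0"
    proof (rule Lim_null_comparison[rotated])
      have "norm (\<Phi> x n 0 (of_real x) - f x) \<le> (A 1 * \<epsilon> n ^ 1) ^ 4" for n
        unfolding \<Phi>_def funpow_0 by (rule Fe) (use that \<epsilon> in auto)
      then show "\<forall>\<^sub>F n in sequentially. norm (\<Phi> x n 0 (of_real x) - f x) \<le> (A 1 * \<epsilon> n ^ 1) ^ 4" by simp
    qed
    then have "(\<lambda>n. \<Phi> x n 0 (of_real x)) \<longlonglongrightarrow> f x" by (simp add: LIM_zero_iff)
    then show ?thesis using lim[OF that] LIMSEQ_unique by blast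
  qed
  have der: "(D l has_vector_derivative D (Suc l) x0) (at x0)" if x0: "x0 \<in> S" for l x0
  proof -
    \<comment> \<open>Bounds the derivative of order \<open>l + 2\<close> of every approximant,
      uniformly in the scale: the bound for the limit \<open>D (l + 2)\<close> plus the distance of
      an approximant from it.\<close>
    define M where "M = fact (l+2) * B * (2 / \<epsilon>0) ^ (l+2) + 2 * (fact (l+2) * 16 ^ (l+2) * 2 * B * A (Suc (l+2))) * \<epsilon>0 + 3 * (K (l+2) 2 * \<epsilon>0 ^ 2)"
    define C where "C = 3 * K l 2 * 16 + M + 3 * K l 2 * 16 + 3 * K (Suc l) 2 * 16 * \<epsilon>0"
    show ?thesis
    proof (rule has_vector_derivative_of_quadratic_error[OF S(1) x0])
      show "\<epsilon>0 / 2 > 0" using \<epsilon>0 by simp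
      fix x assume x: "x \<in> S" "\<bar>x - x0\<bar> < \<epsilon>0 / 2"
      define h where "h = \<bar>x - x0\<bar>"
      show "norm (D l x - D l x0 - of_real (x - x0) * D (Suc l) x0) \<le> C * \<bar>x - x0\<bar> ^ 2"
      proof (cases "h = 0")
        case True
        then show ?thesis by (simp add: h_def)
      next
        case False
        then have h: "0 < h" "h < \<epsilon>0 / 2" using x by (auto simp: h_def)
        obtain m where m: "\<epsilon> m / 2 < h"
        proof -
          obtain m where "(1/2) ^ m < h / \<epsilon>0" using real_arch_pow_inv[of "h / \<epsilon>0" "1/2"] h \<epsilon>0 by auto
          then have "\<epsilon> m < h" using \<epsilon>0 by (simp add: \<epsilon>_def field_simps)
          then show ?thesis using \<epsilon>(1)[of m] that[of m] by linarith
        qed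
        \<comment> \<open>The predecessor \<open>n\<close> of \<open>m0\<close> is the finest scale
          whose half still covers \<open>h\<close>. Then \<open>\<epsilon> n\<close> lies between
          \<open>2 * h\<close> and \<open>4 * h\<close>, so errors of order
          \<open>\<epsilon> n ^ 2\<close> are of order \<open>h ^ 2\<close>.\<close>
        define m0 where "m0 = (LEAST m. \<epsilon> m / 2 < h)"
        have m0: "\<epsilon> m0 / 2 < h" unfolding m0_def by (rule LeastI) (rule m)
        have "m0 \<noteq> 0"
        proof
          assume "m0 = 0"
          then show False using m0 h by (simp add: \<epsilon>_def)
        qed
        then obtain n where n: "m0 = Suc n" using not0_implies_Suc by blast
        have hn: "h \<le> \<epsilon> n / 2" using not_less_Least[of n "\<lambda>m. \<epsilon> m / 2 < h"] n by (simp add: m0_def)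
        have n4: "\<epsilon> n < 4 * h" using m0 by (simp add: n \<epsilon>(3))
        have "\<epsilon> n ^ 2 \<le> (4 * h) ^ 2" using n4 \<epsilon>(1)[of n] by (intro power_mono) auto
        then have n16: "\<epsilon> n ^ 2 \<le> 16 * h ^ 2" by (simp add: power_mult_distrib)
        have s4: "norm (\<Phi> x0 n i (of_real y) - D i y) \<le> 3 * K i 2 * 16 * h ^ 2" if "y \<in> S" "\<bar>y - x0\<bar> \<le> h" for y i
        proof -
          have "norm (\<Phi> x0 n i (of_real y) - D i y) \<le> 3 * (K i 2 * \<epsilon> n ^ 2)" using S4[OF x0 that(1), of n i] that hn by simp
          also have "\<dots> \<le> 3 * (K i 2 * (16 * h ^ 2))" using n16 K0 by (intro mult_left_mono) auto
          finally show ?thesis by simp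
        qed
        have T: "norm (\<Phi> x0 n l (of_real x) - \<Phi> x0 n l (of_real x0) - of_real (x - x0) * \<Phi> x0 n (Suc l) (of_real x0)) \<le> M * h ^ 2"
          unfolding \<Phi>_def h_def
        proof (rule higher_deriv_real_segment_Taylor)
          show "F x0 (\<epsilon> n) holomorphic_on ball (of_real x0) (\<epsilon> n)" using Fh x0 \<epsilon> by blast
          show "\<bar>x - x0\<bar> < \<epsilon> n" using hn \<epsilon>(1)[of n] by (simp add: h_def)
          fix y assume "y \<in> closed_segment x0 x"
          then have yS: "y \<in> S" and y: "\<bar>y - x0\<bar> \<le> \<bar>x - x0\<bar>"
            using x0 x(1) S(2) closed_segment_subset[of x0 S x]
            by (auto simp: is_interval_convex closed_segment_eq_real_ivl split: if_splits)
          have "norm (\<Phi> x0 n (l+2) (of_real y) - D (l+2) y) \<le> 3 * (K (l+2) 2 * \<epsilon> n ^ 2)"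
            using S4[OF x0 yS, of n "l+2"] y hn by (simp add: h_def)
          also have "\<dots> \<le> 3 * (K (l+2) 2 * \<epsilon>0 ^ 2)" using \<epsilon>[of n] K0 by (intro mult_left_mono power_mono) auto
          finally have "norm (\<Phi> x0 n (l+2) (of_real y) - D (l+2) y) \<le> 3 * (K (l+2) 2 * \<epsilon>0 ^ 2)" .
          moreover have "norm (\<Phi> x0 n (l+2) (of_real y)) \<le> norm (D (l+2) y) + norm (\<Phi> x0 n (l+2) (of_real y) - D (l+2) y)"
            by (rule norm_triangle_sub)
          ultimately have "norm (\<Phi> x0 n (l+2) (of_real y)) \<le> M" using bound[OF yS, of "l+2"] unfolding M_def by linarith
          then show "norm ((deriv ^^ Suc (Suc l)) (F x0 (\<epsilon> n)) (of_real y)) \<le> M" by (simp add: \<Phi>_def)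
        qed
        have "D l x - D l x0 - of_real (x - x0) * D (Suc l) x0 =
            - (\<Phi> x0 n l (of_real x) - D l x) + (\<Phi> x0 n l (of_real x) - \<Phi> x0 n l (of_real x0) - of_real (x - x0) * \<Phi> x0 n (Suc l) (of_real x0))
            + (\<Phi> x0 n l (of_real x0) - D l x0) + of_real (x - x0) * (\<Phi> x0 n (Suc l) (of_real x0) - D (Suc l) x0)"
          by (simp add: algebra_simps)
        also have "norm \<dots> \<le> 3 * K l 2 * 16 * h ^ 2 + M * h ^ 2 + 3 * K l 2 * 16 * h ^ 2 + \<epsilon>0 * (3 * K (Suc l) 2 * 16 * h ^ 2)"
        proof (intro norm_triangle_le add_mono)
          show "norm (- (\<Phi> x0 n l (of_real x) - D l x)) \<le> 3 * K l 2 * 16 * h ^ 2" using s4[OF x(1), of l] unfolding norm_minus_cancel h_def by simp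
          show "norm (\<Phi> x0 n l (of_real x0) - D l x0) \<le> 3 * K l 2 * 16 * h ^ 2" using s4[OF x0, of l] h by simp
          have "h * norm (\<Phi> x0 n (Suc l) (of_real x0) - D (Suc l) x0) \<le> \<epsilon>0 * (3 * K (Suc l) 2 * 16 * h ^ 2)"
            using s4[OF x0, of "Suc l"] h \<epsilon>0 by (intro mult_mono) auto
          then show "norm (of_real (x - x0) * (\<Phi> x0 n (Suc l) (of_real x0) - D (Suc l) x0)) \<le> \<epsilon>0 * (3 * K (Suc l) 2 * 16 * h ^ 2)"
            unfolding norm_mult norm_of_real h_def .
        qed (rule T)
        also have "\<dots> = C * h ^ 2" by (simp add: C_def algebra_simps)
        finally show ?thesis by (simp add: h_def)
      qed
    qed
  qed
  show ?thesis by (rule that[of D]) (use D0 der bound in auto)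
qed

section \<open>Weight sequences\<close>

lemma weight_sequence_props:
  assumes "weight_sequence M"
  shows "M 0 = 1" "M k > 0" "M a * M b \<le> M (a + b)"
proof -
  obtain mu where mu: "\<And>k. mu k > 0" "mono mu" "\<And>k. M k = (\<Prod>i\<in>{1..k}. mu i)"
    using assms by (auto simp: weight_sequence_def)
  show "M 0 = 1" by (simp add: mu)
  show pos: "M k > 0" for k unfolding mu(3) by (intro prod_pos) (use mu in auto)
  show "M a * M b \<le> M (a + b)"
  proof (induction b)
    case 0
    then show ?case by (simp add: mu)
  next
    case (Suc b)
    have S: "M (Suc k) = M k * mu (Suc k)" for k by (simp add: mu(3) prod.nat_ivl_Suc' mult.commute)
    have "M a * M (Suc b) = (M a * M b) * mu (Suc b)" by (simp add: S)
    also have "\<dots> \<le> M (a + b) * mu (Suc (a + b))"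
      using Suc pos[of a] pos[of b] pos[of "a+b"] mu(1)[of "Suc b"] monoD[OF mu(2), of "Suc b" "Suc (a + b)"]
      by (intro mult_mono) auto
    finally show ?case by (simp add: S)
  qed
qed

text \<open>The inequality \<open>M a * M b \<le> M (a + b)\<close> need not survive division by
  factorials; the defect is the binomial coefficient of \<open>a + b\<close> over \<open>a\<close>,
  at most 2^(a + b).\<close>

lemma lower_props:
  assumes "weight_sequence M"
  shows "lower M 0 = 1" "lower M k > 0" "lower M a * lower M b \<le> 2 ^ (a + b) * lower M (a + b)"
proof -
  note w = weight_sequence_props[OF assms]
  show "lower M 0 = 1" "lower M k > 0" by (simp_all add: lower_def w)
  have "real ((a + b) choose a) \<le> real (2 ^ (a + b))" using binomial_le_pow2[of "a + b" a] by (simp only: of_nat_le_iff)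
  then have b: "fact (a + b) \<le> 2 ^ (a + b) * (fact a * fact b :: real)"
    by (simp add: binomial_fact field_simps)
  have "lower M a * lower M b = M a * M b / (fact a * fact b)" by (simp add: lower_def)
  also have "\<dots> \<le> M (a + b) / (fact a * fact b)" using w by (intro divide_right_mono) auto
  also have "\<dots> \<le> M (a + b) * (2 ^ (a + b) / fact (a + b))"
  proof -
    have "1 / (fact a * fact b) \<le> (2 ^ (a + b) / fact (a + b) :: real)" using b by (simp add: field_simps)
    then have "M (a + b) * (1 / (fact a * fact b)) \<le> M (a + b) * (2 ^ (a + b) / fact (a + b))"
      using w(2)[of "a + b"] by (intro mult_left_mono) auto
    then show ?thesis by simp
  qed
  finally show "lower M a * lower M b \<le> 2 ^ (a + b) * lower M (a + b)" by (simp add: lower_def mult.commute)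
qed

section \<open>Growth of sequences and their counting functions\<close>

lemma powr_inverse_power: "x > 0 \<Longrightarrow> n \<ge> 1 \<Longrightarrow> (x powr (1 / real n)) ^ n = x"
  by (simp add: powr_powr flip: powr_realpow)

lemma power_le_of_root_at_top:
  fixes m :: "nat \<Rightarrow> real"
  assumes lim: "filterlim (\<lambda>k. m k powr (1 / real k)) at_top sequentially" and pos: "\<And>k. m k > 0" and R: "R > 0"
  obtains L where "\<And>k. k \<ge> L \<Longrightarrow> R ^ k \<le> m k"
proof -
  have "\<forall>\<^sub>F k in sequentially. R \<le> m k powr (1 / real k)" using lim by (simp add: filterlim_at_top)
  then obtain L where L: "\<And>k. k \<ge> L \<Longrightarrow> R \<le> m k powr (1 / real k)" by (auto simp: eventually_sequentially)
  show ?thesis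
  proof (rule that[of "max 1 L"])
    fix k assume k: "k \<ge> max 1 L"
    have "R ^ k \<le> (m k powr (1 / real k)) ^ k" using L[of k] k R by (intro power_mono) auto
    also have "\<dots> = m k" using k pos[of k] by (intro powr_inverse_power) auto
    finally show "R ^ k \<le> m k" .
  qed
qed

lemma power_le_const_mult:
  fixes m :: "nat \<Rightarrow> real"
  assumes lim: "filterlim (\<lambda>k. m k powr (1 / real k)) at_top sequentially" and pos: "\<And>k. m k > 0" and R: "R > 0"
  obtains C where "C > 0" "\<And>k. R ^ k \<le> C * m k"
proof -
  obtain L where L: "\<And>k. k \<ge> L \<Longrightarrow> R ^ k \<le> m k" using power_le_of_root_at_top[OF lim pos R] by blast
  define C where "C = 1 + (\<Sum>k<L. R ^ k / m k)"
  have s0: "0 \<le> (\<Sum>k<L. R ^ k / m k)" using R pos by (intro sum_nonneg) (simp add: less_imp_le)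
  show ?thesis
  proof
    show "C > 0" using s0 by (simp add: C_def)
    fix k
    show "R ^ k \<le> C * m k"
    proof (cases "k < L")
      case True
      then have "R ^ k / m k \<le> (\<Sum>k<L. R ^ k / m k)" using R pos by (intro member_le_sum) (auto simp: less_imp_le)
      then have "R ^ k / m k \<le> C" by (simp add: C_def)
      then show ?thesis using pos[of k] by (simp add: field_simps)
    next
      case False
      then have "R ^ k \<le> 1 * m k" using L by simp
      also have "\<dots> \<le> C * m k" using s0 pos[of k] by (intro mult_right_mono) (auto simp: C_def)
      finally show ?thesis .
    qed
  qed
qed

text \<open>\<open>Gamma_over\<close> is the least index where a term equals an infimum, so it means
  something only if the infimum is attained. It is: by the root condition all late terms are at
  least 1, the value of the term of index 0, and finitely many remain.\<close>

lemma Gamma_over_attains: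
  assumes lim: "filterlim (\<lambda>k. m k powr (1 / real k)) at_top sequentially" and pos: "\<And>k. m k > 0" and m0: "m 0 = 1" and s: "s > 0"
  shows "m (Gamma_over m s) * s ^ Gamma_over m s \<le> m l * s ^ l"
proof -
  let ?v = "\<lambda>k. m k * s ^ k"
  obtain L where L: "\<And>k. k \<ge> L \<Longrightarrow> (1 / s) ^ k \<le> m k" using power_le_of_root_at_top[OF lim pos, of "1 / s"] s by auto
  have big: "1 \<le> ?v k" if "k \<ge> L" for k using L[OF that] s by (simp add: power_divide field_simps)
  obtain k where k: "k \<le> L" "\<And>i. i \<le> L \<Longrightarrow> ?v k \<le> ?v i"
  proof -
    have "Min (?v ` {..L}) \<in> ?v ` {..L}" by (rule Min_in) auto
    then obtain k where k: "k \<le> L" "Min (?v ` {..L}) = ?v k" by (elim imageE) simp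
    show ?thesis
    proof (rule that[OF k(1)])
      show "?v k \<le> ?v i" if "i \<le> L" for i unfolding k(2)[symmetric] by (rule Min_le) (use that in auto)
    qed
  qed
  have min: "?v k \<le> ?v i" for i
  proof (cases "i \<le> L")
    case False
    have "?v k \<le> ?v 0" by (rule k(2)) simp
    also have "\<dots> \<le> ?v i" using False big[of i] m0 by simp
    finally show ?thesis .
  qed (use k in simp)
  have "h_fun m s = ?v k" unfolding h_fun_def by (rule cInf_eq_minimum) (use min in auto)
  then have "h_fun m s = ?v (Gamma_over m s)" unfolding Gamma_over_def by (rule LeastI)
  then show ?thesis using min[of l] \<open>h_fun m s = ?v k\<close> by simp
qed

lemma Gamma_under_props:
  assumes lim: "filterlim (\<lambda>k. m k powr (1 / real k)) at_top sequentially" and pos: "\<And>k. m k > 0" and m0: "m 0 = 1" and t: "t > 0"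
  shows "i < Gamma_under m t \<Longrightarrow> m (Suc i) * t \<le> m i"
    and "m (Suc k) / m k \<ge> 1 / t \<Longrightarrow> Gamma_under m t \<le> k"
proof -
  show "m (Suc i) * t \<le> m i" if "i < Gamma_under m t"
    using not_less_Least[OF that[unfolded Gamma_under_def]] pos[of i] t by (simp add: field_simps not_le)
  show "Gamma_under m t \<le> k" if "m (Suc k) / m k \<ge> 1 / t"
    unfolding Gamma_under_def using that by (rule Least_le)
qed

text \<open>
  At scale \<open>t\<close> the index \<open>k = Gamma_under m t\<close> will be the degree of the Taylor polynomials: the terms
  \<open>m i * t ^ i\<close> decrease up to \<open>k\<close>, and the \<open>k\<close>-th one is already below \<open>h_fun n (C * t)\<close>.
\<close>

definition log_adapted :: "(nat \<Rightarrow> real) \<Rightarrow> (nat \<Rightarrow> real) \<Rightarrow> bool" where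
  "log_adapted m n \<longleftrightarrow> (\<exists>C\<ge>1. \<forall>t>0. \<exists>k. (\<forall>i<k. m (Suc i) * t \<le> m i) \<and> (\<forall>l. m k * t ^ k \<le> n l * (C * t) ^ l))"

lemma le_power_of_ratio_le:
  fixes m :: "nat \<Rightarrow> real"
  assumes "\<And>i. i < k \<Longrightarrow> m (Suc i) * t \<le> m i" "l \<le> k" "t > 0"
  shows "m k * t ^ k \<le> m l * t ^ l"
  using assms(2,1)
proof (induction k rule: dec_induct)
  case (step k)
  have "m (Suc k) * t * t ^ k \<le> m k * t ^ k" using step.prems[of k] assms(3) by (intro mult_right_mono) auto
  also have "\<dots> \<le> m l * t ^ l" using step.IH step.prems by simp
  finally show ?case by (simp add: mult_ac)
qed simp

text \<open>
  The condition on the counting functions alone forces \<open>m l \<le> C ^ l * n l\<close>; no comparison between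
  \<open>m\<close> and \<open>n\<close> has to be assumed.
\<close>

lemma log_adapted_of_Gamma:
  assumes limM: "filterlim (\<lambda>k. m k powr (1 / real k)) at_top sequentially" and posm: "\<And>k. m k > 0" and m0: "m 0 = 1"
    and limN: "filterlim (\<lambda>k. n k powr (1 / real k)) at_top sequentially" and posn: "\<And>k. n k > 0" and n0: "n 0 = 1"
    and C: "C \<ge> 1" and G: "\<And>t. t > 0 \<Longrightarrow> Gamma_over n (C * t) \<le> Gamma_under m t"
  shows "log_adapted m n"
proof -
  note over = Gamma_over_attains[OF limN posn n0]
  note under = Gamma_under_props[OF limM posm m0]
  have mn: "m l \<le> C ^ l * n l" for l
  proof (induction l rule: less_induct)
    case (less l)
    show ?case
    proof (cases "l = 0")
      case True
      then show ?thesis by (simp add: m0 n0)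
    next
      case False
      let ?r = "\<lambda>i. m (Suc i) / m i"
      obtain i0 where i0: "i0 < l" "\<And>i. i < l \<Longrightarrow> ?r i \<le> ?r i0"
      proof -
        have "Max (?r ` {..<l}) \<in> ?r ` {..<l}" using False by (intro Max_in) auto
        then obtain k where k: "k < l" "Max (?r ` {..<l}) = ?r k" by (elim imageE) simp
        show ?thesis
        proof (rule that[OF k(1)])
          show "?r i \<le> ?r k" if "i < l" for i unfolding k(2)[symmetric] by (rule Max_ge) (use that in auto)
        qed
      qed
      \<comment> \<open>1 / t is the largest ratio below \<open>l\<close>. Hence the terms
        \<open>m i * t ^ i\<close> do not increase up to \<open>l\<close>, while the ratio at
        \<open>i0\<close> already reaches 1 / t. The hypothesis then places the minimizer
        \<open>k\<close> for \<open>n\<close> below \<open>l\<close>, where the induction hypothesis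
        applies.\<close>
      define t where "t = 1 / ?r i0"
      have t: "t > 0" "1 / t = ?r i0" using posm[of i0] posm[of "Suc i0"] by (auto simp: t_def)
      define k where "k = Gamma_over n (C * t)"
      have "k \<le> Gamma_under m t" using G[OF t(1)] by (simp add: k_def)
      also have "\<dots> \<le> i0" using t by (intro under(2)) auto
      finally have kl: "k < l" using i0(1) by simp
      have Ct: "C * t > 0" using C t by simp
      have "m l * t ^ l \<le> m k * t ^ k"
      proof (rule le_power_of_ratio_le)
        fix i assume "i < l"
        then have "?r i \<le> 1 / t" using i0 t(2) by simp
        then show "m (Suc i) * t \<le> m i" using t(1) posm[of i] by (simp add: field_simps)
      qed (use kl t in auto)
      also have "\<dots> \<le> C ^ k * n k * t ^ k" using less[OF kl] t by (intro mult_right_mono) auto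
      also have "\<dots> = n k * (C * t) ^ k" by (simp add: power_mult_distrib)
      also have "\<dots> \<le> n l * (C * t) ^ l" using over[OF Ct] by (simp add: k_def)
      also have "\<dots> = C ^ l * n l * t ^ l" by (simp add: power_mult_distrib)
      finally show ?thesis using t by simp
    qed
  qed
  show ?thesis unfolding log_adapted_def
  proof (intro exI[of _ C] conjI C allI impI)
    fix t :: real assume t: "t > 0"
    define k where "k = Gamma_under m t"
    define l' where "l' = Gamma_over n (C * t)"
    have l'k: "l' \<le> k" using G[OF t] by (simp add: k_def l'_def)
    have Ct: "C * t > 0" using C t by simp
    have dec: "m (Suc i) * t \<le> m i" if "i < k" for i using under(1)[OF t] that by (simp add: k_def)
    have "m k * t ^ k \<le> n l * (C * t) ^ l" for l
    proof -
      \<comment> \<open>From \<open>k\<close> back along the non-increasing terms to the minimizer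
        for \<open>n\<close>, where the sequences are exchanged; minimality then reaches every
        \<open>l\<close>.\<close>
      have "m k * t ^ k \<le> m l' * t ^ l'" using dec l'k t by (intro le_power_of_ratio_le) auto
      also have "\<dots> \<le> C ^ l' * n l' * t ^ l'" using mn[of l'] t by (intro mult_right_mono) auto
      also have "\<dots> = n l' * (C * t) ^ l'" by (simp add: power_mult_distrib)
      also have "\<dots> \<le> n l * (C * t) ^ l" using over[OF Ct] by (simp add: l'_def)
      finally show ?thesis .
    qed
    with dec show "\<exists>k. (\<forall>i<k. m (Suc i) * t \<le> m i) \<and> (\<forall>l. m k * t ^ k \<le> n l * (C * t) ^ l)" by blast
  qed
qed

section \<open>Moderate growth: trading index for power\<close>

lemma mg_finite_bound:
  assumes mg: "mg_finite M N" and M: "weight_sequence M" and N: "weight_sequence N"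
  obtains C where "C \<ge> 1" "\<And>a b. M (a + b) \<le> C ^ (a + b) * N a * N b"
proof -
  obtain C0 where C0: "\<And>j k. j + k \<ge> 1 \<Longrightarrow> (M (j + k) / (N j * N k)) powr (1 / real (j + k)) \<le> C0"
    using mg by (auto simp: mg_finite_def)
  note wM = weight_sequence_props[OF M] and wN = weight_sequence_props[OF N]
  show ?thesis
  proof (rule that[of "max 1 C0"])
    fix a b
    show "M (a + b) \<le> max 1 C0 ^ (a + b) * N a * N b"
    proof (cases "a + b \<ge> 1")
      case True
      let ?q = "M (a + b) / (N a * N b)"
      have q: "?q > 0" using wM wN by simp
      have "?q = (?q powr (1 / real (a + b))) ^ (a + b)" using powr_inverse_power[OF q True] by simp
      also have "\<dots> \<le> max 1 C0 ^ (a + b)" using C0[OF True] by (intro power_mono) auto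
      finally show ?thesis using wN(2)[of a] wN(2)[of b] by (simp add: field_simps)
    next
      case False
      then have "a = 0" "b = 0" by auto
      then show ?thesis by (simp add: wM wN)
    qed
  qed simp
qed

definition power_dominated :: "nat \<Rightarrow> (nat \<Rightarrow> real) \<Rightarrow> (nat \<Rightarrow> real) \<Rightarrow> bool" where
  "power_dominated p m n \<longleftrightarrow> (\<exists>C\<ge>1. \<forall>l. m (p * l) \<le> C ^ l * n l ^ p)"

text \<open>Moderate growth at two equal indices bounds \<open>N (2 * l)\<close> by the square of
  \<open>L l\<close>, and the factorials help because (l!)^2 \<le> (2 l)!. Iteration reaches every
  power of two as exponent.\<close>

lemma power_dominated_Suc:
  assumes d: "power_dominated p (lower M) (lower N)" and mg: "mg_finite N L"
    and N: "weight_sequence N" and L: "weight_sequence L"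
  shows "power_dominated (2 * p) (lower M) (lower L)"
proof -
  obtain C where C: "C \<ge> 1" "\<And>l. lower M (p * l) \<le> C ^ l * lower N l ^ p" using d by (auto simp: power_dominated_def)
  obtain C' where C': "C' \<ge> 1" "\<And>a b. N (a + b) \<le> C' ^ (a + b) * L a * L b" using mg_finite_bound[OF mg N L] by blast
  have dbl: "lower N (2 * l) \<le> C' ^ (2 * l) * lower L l ^ 2" for l
  proof -
    have f: "fact l * fact l \<le> (fact (2 * l) :: real)"
    proof -
      have "(fact l * fact l :: nat) dvd fact (l + l)" by (rule fact_fact_dvd_fact)
      then have "(fact l * fact l :: nat) \<le> fact (l + l)" by (rule dvd_imp_le) simp
      then have "real (fact l * fact l) \<le> real (fact (l + l))" by (simp only: of_nat_le_iff)
      then show ?thesis by (simp add: mult_2)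
    qed
    have L0: "L l > 0" using weight_sequence_props[OF L] by simp
    have "lower N (2 * l) \<le> C' ^ (2 * l) * L l * L l / fact (2 * l)"
      using C'(2)[of l l] by (simp add: lower_def divide_right_mono mult_2)
    also have "\<dots> \<le> C' ^ (2 * l) * L l * L l / (fact l * fact l)"
      using f L0 C' by (intro divide_left_mono) auto
    finally show ?thesis by (simp add: lower_def power2_eq_square)
  qed
  have n0: "lower N k > 0" for k using lower_props[OF N] by simp
  show ?thesis unfolding power_dominated_def
  proof (intro exI[of _ "C ^ 2 * C' ^ (2 * p)"] conjI allI)
    show "1 \<le> C ^ 2 * C' ^ (2 * p)" using C C' mult_mono[of 1 "C ^ 2" 1 "C' ^ (2 * p)"] by (simp add: one_le_power)
    fix l
    have "lower M (2 * p * l) = lower M (p * (2 * l))" by (simp add: mult_ac)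
    also have "\<dots> \<le> C ^ (2 * l) * lower N (2 * l) ^ p" by (rule C)
    also have "\<dots> \<le> C ^ (2 * l) * (C' ^ (2 * l) * lower L l ^ 2) ^ p"
      using dbl[of l] n0[of "2 * l"] C by (intro mult_left_mono power_mono) auto
    also have "\<dots> = (C ^ 2 * C' ^ (2 * p)) ^ l * lower L l ^ (2 * p)"
      by (simp add: power_mult_distrib mult_ac flip: power_mult)
    finally show "lower M (2 * p * l) \<le> (C ^ 2 * C' ^ (2 * p)) ^ l * lower L l ^ (2 * p)" .
  qed
qed

lemma power_dominated_1: "power_dominated 1 m m"
  unfolding power_dominated_def by (intro exI[of _ 1]) simp

text \<open>
  The only relation between \<open>M\<close> (class of the powers) and \<open>N\<close> (class of the root) that the analytic
  part needs. The exponent \<open>p\<close> is what absorbs the loss of powers in the error estimates.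
\<close>

definition adapted :: "nat \<Rightarrow> (nat \<Rightarrow> real) \<Rightarrow> (nat \<Rightarrow> real) \<Rightarrow> bool" where
  "adapted p M N \<longleftrightarrow> (\<exists>a C. C \<ge> 1 \<and> (\<forall>l. a l \<ge> 0) \<and>
     (\<forall>t>0. \<exists>k. (\<forall>i<k. lower M (Suc i) * t \<le> lower M i) \<and> (\<forall>l. lower M k * t ^ k \<le> (a l * t ^ l) ^ p)) \<and>
     (\<forall>l. fact l * a (Suc l) \<le> C ^ Suc l * N l))"

text \<open>Moderate growth enters twice: at index \<open>p * l\<close>, through \<open>pd\<close>,
  to write the error as a p-th power, and through \<open>mg\<close> at the indices 1 and
  \<open>l\<close>, because a bound for the l-th derivative involves \<open>a (Suc l)\<close> while
  the class offers \<open>N l\<close>.\<close>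

lemma adaptedI:
  assumes la: "log_adapted (lower M) (lower N1)" and pd: "power_dominated p (lower N1) (lower N2)" and p: "p \<ge> 1"
    and mg: "mg_finite N2 N" and N2: "weight_sequence N2" and N: "weight_sequence N"
  shows "adapted p M N"
proof -
  obtain C where C: "C \<ge> 1" "\<And>t. t > 0 \<Longrightarrow> \<exists>k. (\<forall>i<k. lower M (Suc i) * t \<le> lower M i) \<and> (\<forall>l. lower M k * t ^ k \<le> lower N1 l * (C * t) ^ l)"
    using la by (auto simp: log_adapted_def)
  obtain C1 where C1: "C1 \<ge> 1" "\<And>l. lower N1 (p * l) \<le> C1 ^ l * lower N2 l ^ p" using pd by (auto simp: power_dominated_def)
  obtain C2 where C2: "C2 \<ge> 1" "\<And>a b. N2 (a + b) \<le> C2 ^ (a + b) * N a * N b" using mg_finite_bound[OF mg N2 N] by blast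
  define a where "a = (\<lambda>l. (C1 * C) ^ l * lower N2 l)"
  \<comment> \<open>The index shift produces a single factor \<open>N 1\<close>; replaced by its
    maximum with 1 it can be absorbed into a power.\<close>
  define E where "E = C1 * C * C2 * max 1 (N 1)"
  have n2: "lower N2 l > 0" for l using lower_props[OF N2] by simp
  have Npos: "N l > 0" for l using weight_sequence_props[OF N] by simp
  show ?thesis unfolding adapted_def
  proof (intro exI[of _ a] exI[of _ E] conjI allI impI)
    have "1 * 1 * 1 * 1 \<le> C1 * C * C2 * max 1 (N 1)" using C C1 C2 by (intro mult_mono) auto
    then show "1 \<le> E" by (simp add: E_def)
    show "0 \<le> a l" for l using C C1 n2[of l] by (simp add: a_def)
    fix l
    have "fact l * a (Suc l) = (C1 * C) ^ Suc l * (N2 (Suc l) * (fact l / fact (Suc l)))"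
      by (simp add: a_def lower_def)
    also have "\<dots> \<le> (C1 * C) ^ Suc l * (N2 (Suc l) * 1)"
      using C C1 weight_sequence_props(2)[OF N2, of "Suc l"] by (intro mult_left_mono) (auto simp: divide_simps)
    also have "\<dots> \<le> (C1 * C) ^ Suc l * (C2 ^ Suc l * N 1 * N l)"
      using C C1 C2(2)[of 1 l] by (intro mult_left_mono) auto
    also have "\<dots> \<le> (C1 * C) ^ Suc l * (C2 ^ Suc l * max 1 (N 1) ^ Suc l * N l)"
    proof -
      have "N 1 \<le> max 1 (N 1) ^ Suc l" using self_le_power[of "max 1 (N 1)" "Suc l"] by simp
      then show ?thesis using C C1 C2 Npos[of l] by (intro mult_left_mono mult_right_mono) auto
    qed
    also have "\<dots> = E ^ Suc l * N l" by (simp add: E_def power_mult_distrib mult_ac)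
    finally show "fact l * a (Suc l) \<le> E ^ Suc l * N l" .
  next
    fix t :: real assume t: "t > 0"
    obtain k where k: "\<And>i. i < k \<Longrightarrow> lower M (Suc i) * t \<le> lower M i" "\<And>l. lower M k * t ^ k \<le> lower N1 l * (C * t) ^ l"
      using C(2)[OF t] by blast
    have "lower M k * t ^ k \<le> (a l * t ^ l) ^ p" for l
    proof -
      have "lower M k * t ^ k \<le> lower N1 (p * l) * (C * t) ^ (p * l)" by (rule k)
      also have "\<dots> \<le> (C1 ^ l * lower N2 l ^ p) * (C * t) ^ (p * l)" using C1 C t by (intro mult_right_mono) auto
      also have "\<dots> \<le> ((C1 ^ l) ^ p * lower N2 l ^ p) * (C * t) ^ (p * l)"
      proof -
        have "C1 ^ l \<le> (C1 ^ l) ^ p" using C1 p by (intro self_le_power one_le_power) auto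
        then show ?thesis using C t n2[of l] by (intro mult_right_mono) auto
      qed
      also have "\<dots> = (a l * t ^ l) ^ p" by (simp add: a_def power_mult_distrib mult_ac flip: power_mult)
      finally show ?thesis .
    qed
    with k(1) show "\<exists>k. (\<forall>i<k. lower M (Suc i) * t \<le> lower M i) \<and> (\<forall>l. lower M k * t ^ k \<le> (a l * t ^ l) ^ p)" by blast
  qed
qed

lemma log_adapted_of_regular:
  assumes "weight_sequence M" "weight_sequence N" "C \<ge> 1"
    "filterlim (\<lambda>k. lower M k powr (1 / real k)) at_top sequentially" "filterlim (\<lambda>k. lower N k powr (1 / real k)) at_top sequentially"
    "\<And>t. t > 0 \<Longrightarrow> Gamma_over (lower N) (C * t) \<le> Gamma_under (lower M) t"
  shows "log_adapted (lower M) (lower N)"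
  using assms lower_props by (intro log_adapted_of_Gamma[where C = C]) auto

lemma R_adapted:
  assumes W: "weight_matrix MM" and R: "R_regular MM" and G: "R_moderate_growth MM" and M: "M \<in> MM"
  shows "\<exists>N\<in>MM. adapted (2 ^ q) M N"
proof -
  have w: "weight_sequence M" if "M \<in> MM" for M using W that by (simp add: weight_matrix_def)
  have "\<exists>N\<in>MM. \<exists>C\<ge>1. \<forall>t>0. Gamma_over (lower N) (C * t) \<le> Gamma_under (lower M) t"
    using R M unfolding R_regular_def by blast
  then obtain N1 C where N1: "N1 \<in> MM" "C \<ge> 1" "\<And>t. t > 0 \<Longrightarrow> Gamma_over (lower N1) (C * t) \<le> Gamma_under (lower M) t"
    by blast
  have la: "log_adapted (lower M) (lower N1)"
    using R M N1 w by (intro log_adapted_of_regular[where C = C]) (auto simp: R_regular_def)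
  have "\<exists>N\<in>MM. power_dominated (2 ^ q) (lower N1) (lower N)" for q
  proof (induction q)
    case 0
    then show ?case using N1 power_dominated_1 by auto
  next
    case (Suc q)
    then obtain N where N: "N \<in> MM" "power_dominated (2 ^ q) (lower N1) (lower N)" by blast
    obtain L where "L \<in> MM" "mg_finite N L" using G N(1) unfolding R_moderate_growth_def by blast
    then show ?case using power_dominated_Suc[OF N(2)] w N(1) by auto
  qed
  then obtain N2 where N2: "N2 \<in> MM" "power_dominated (2 ^ q) (lower N1) (lower N2)" by blast
  obtain N where N: "N \<in> MM" "mg_finite N2 N" using G N2(1) unfolding R_moderate_growth_def by blast
  then show ?thesis using adaptedI[OF la N2(2) _ N(2)] w N2(1) by auto
qed

text \<open>Now the sequence of the root is given and that of the powers is sought. The chain is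
  built backwards from \<open>N\<close>, so the doubling induction has to generalize over its
  endpoint.\<close>

lemma B_adapted:
  assumes W: "weight_matrix MM" and R: "B_regular MM" and G: "B_moderate_growth MM" and N: "N \<in> MM"
  shows "\<exists>M\<in>MM. adapted (2 ^ q) M N"
proof -
  have w: "weight_sequence M" if "M \<in> MM" for M using W that by (simp add: weight_matrix_def)
  obtain N2 where N2: "N2 \<in> MM" "mg_finite N2 N" using G N unfolding B_moderate_growth_def by blast
  have "\<exists>L\<in>MM. power_dominated (2 ^ q) (lower L) (lower N)" if "N \<in> MM" for q N
    using that
  proof (induction q arbitrary: N)
    case 0
    then show ?case using power_dominated_1 by auto
  next
    case (Suc q)
    obtain N' where N': "N' \<in> MM" "mg_finite N' N" using G Suc.prems unfolding B_moderate_growth_def by blast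
    then obtain L where "L \<in> MM" "power_dominated (2 ^ q) (lower L) (lower N')" using Suc.IH by blast
    then show ?case using power_dominated_Suc[OF _ N'(2)] w N'(1) Suc.prems by auto
  qed
  then obtain N1 where N1: "N1 \<in> MM" "power_dominated (2 ^ q) (lower N1) (lower N2)" using N2 by blast
  have "\<exists>N\<in>MM. \<exists>C\<ge>1. \<forall>t>0. Gamma_over (lower N1) (C * t) \<le> Gamma_under (lower N) t"
    using R N1(1) unfolding B_regular_def by blast
  then obtain M C where M: "M \<in> MM" "C \<ge> 1" "\<And>t. t > 0 \<Longrightarrow> Gamma_over (lower N1) (C * t) \<le> Gamma_under (lower M) t"
    by blast
  have la: "log_adapted (lower M) (lower N1)"
    using R M N1 w by (intro log_adapted_of_regular[where C = C]) (auto simp: B_regular_def)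
  show ?thesis using adaptedI[OF la N1(2) _ N2(2)] w N N2(1) M(1) by auto
qed

section \<open>Roots in ultradifferentiable classes\<close>

text \<open>For \<open>X\<close> below 1 the larger exponent \<open>p\<close> only strengthens the
  bound; for \<open>X\<close> \<ge> 1 the bound is worthless, but \<open>x\<close> \<le> 1
  suffices.\<close>

lemma root_le_power4:
  fixes x X :: real
  assumes n: "n > 0" and x: "0 \<le> x" "x \<le> 1" and X: "0 \<le> X" "x \<le> X ^ p" "4 * n \<le> p"
  shows "root n x \<le> X ^ 4"
proof (cases "X \<ge> 1")
  case True
  have "root n x \<le> 1" using x n by simp
  also have "1 \<le> X ^ 4" using True by simp
  finally show ?thesis .
next
  case False
  have "x \<le> X ^ (4 * n)" using X False power_decreasing[of "4 * n" p X] by linarith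
  then have "root n x \<le> root n ((X ^ 4) ^ n)" using n by (simp add: power_mult)
  also have "\<dots> = X ^ 4" using n X by (simp add: real_root_power_cancel)
  finally show ?thesis .
qed

text \<open>\<open>H\<close> is fixed before \<open>f\<close>, \<open>\<sigma>\<close> and
  \<open>r\<close>, and the new width is linear in \<open>\<sigma>\<close>. This lets one statement
  serve both cases: Roumieu takes \<rho> = H \<sigma>, Beurling starts from \<sigma> = \<rho> / H
  for a prescribed \<rho>.\<close>

lemma B_class_root:
  assumes j: "j \<ge> 1" and M: "weight_sequence M" and N: "weight_sequence N"
    and limN: "filterlim (\<lambda>k. lower N k powr (1 / real k)) at_top sequentially"
    and ad: "adapted p M N" and p: "16 * j * Suc j \<le> p"
  obtains H where "H > 0"
    and "\<And>\<sigma> r f \<rho>. \<lbrakk>\<sigma> > 0; r > 0; B_class M \<sigma> {-2*r<..<2*r} (\<lambda>x. f x ^ j); B_class M \<sigma> {-2*r<..<2*r} (\<lambda>x. f x ^ Suc j); \<rho> \<ge> H * \<sigma>\<rbrakk>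
       \<Longrightarrow> B_class N \<rho> {-r<..<r} f"
proof -
  obtain a C where C: "C \<ge> 1" and a0: "\<And>l. a l \<ge> 0"
    and adk: "\<And>t. t > 0 \<Longrightarrow> \<exists>k. (\<forall>i<k. lower M (Suc i) * t \<le> lower M i) \<and> (\<forall>l. lower M k * t ^ k \<le> (a l * t ^ l) ^ p)"
    and aN: "\<And>l. fact l * a (Suc l) \<le> C ^ Suc l * N l"
    using ad by (auto simp: adapted_def)
  define K where "K = (4::real) ^ (j + 2)"
  have K: "K > 0" by (simp add: K_def)
  \<comment> \<open>32 is 16 from the Cauchy estimates at dyadic scales times 2 from rescaling an
    interval of radius \<open>2 * \<epsilon>\<close>; \<open>K\<close> is the inverse of the ratio
    required of Taylor coefficients, \<open>C\<close> comes from the sequences.\<close>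
  define H where "H = 32 * K * C"
  have H: "H > 0" using K C by (simp add: H_def)
  note lM = lower_props[OF M]
  note Npos = weight_sequence_props(2)[OF N] and Mpos = weight_sequence_props(2)[OF M]
  show ?thesis
  proof (rule that[OF H])
    fix \<sigma> r \<rho> :: real and f
    assume \<sigma>: "\<sigma> > 0" and r: "r > 0" and g: "B_class M \<sigma> {-2*r<..<2*r} (\<lambda>x. f x ^ j)" and h: "B_class M \<sigma> {-2*r<..<2*r} (\<lambda>x. f x ^ Suc j)"
      and \<rho>: "\<rho> \<ge> H * \<sigma>"
    let ?J = "{-2*r<..<2*r}" and ?S = "{-r<..<r}"
    have \<rho>0: "\<rho> > 0" using \<rho> H \<sigma> mult_pos_pos[of H \<sigma>] by linarith
    obtain Dg Cg where Dg: "\<And>x. x \<in> ?J \<Longrightarrow> Dg 0 x = f x ^ j" "\<And>k x. x \<in> ?J \<Longrightarrow> (Dg k has_vector_derivative Dg (Suc k) x) (at x)"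
      "\<And>k x. x \<in> ?J \<Longrightarrow> norm (Dg k x) / (\<sigma> ^ k * M k) \<le> Cg" using g unfolding B_class_def by blast
    obtain Dh Ch where Dh: "\<And>x. x \<in> ?J \<Longrightarrow> Dh 0 x = f x ^ Suc j" "\<And>k x. x \<in> ?J \<Longrightarrow> (Dh k has_vector_derivative Dh (Suc k) x) (at x)"
      "\<And>k x. x \<in> ?J \<Longrightarrow> norm (Dh k x) / (\<sigma> ^ k * M k) \<le> Ch" using h unfolding B_class_def by blast
    define C0 where "C0 = max 1 (max Cg Ch)"
    have C0: "C0 \<ge> 1" "Cg \<le> C0" "Ch \<le> C0" by (auto simp: C0_def)
    have Dbound: "norm z \<le> C0 * (\<sigma> ^ k * M k)" if "norm z / (\<sigma> ^ k * M k) \<le> c" "c \<le> C0" for z :: complex and k c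
    proof -
      have "\<sigma> ^ k * M k > 0" using \<sigma> Mpos[of k] by simp
      moreover have "norm z / (\<sigma> ^ k * M k) \<le> C0" using that by linarith
      ultimately show ?thesis by (simp only: pos_divide_le_eq)
    qed
    have gb: "norm (Dg k x) \<le> C0 * (\<sigma> ^ k * M k)" and hb: "norm (Dh k x) \<le> C0 * (\<sigma> ^ k * M k)" if "x \<in> ?J" for k x
      using Dbound[OF Dg(3)[OF that] C0(2)] Dbound[OF Dh(3)[OF that] C0(3)] by blast+
    obtain L where L: "L \<ge> 1"
      and loc: "\<And>(w :: nat \<Rightarrow> real) k (p :: nat \<Rightarrow> complex) q \<phi>. \<lbrakk>w 0 = 1; \<And>i. w i > 0; \<And>i. i < k \<Longrightarrow> w (Suc i) \<le> w i;
       \<And>a b. w a * w b \<le> 2 ^ (a + b) * w (a + b);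
       \<And>i. norm (p i) \<le> C0 * (1 / K) ^ i * w i; \<And>i. norm (q i) \<le> C0 * (1 / K) ^ i * w i;
       \<And>x::real. \<bar>x\<bar> \<le> 1 \<Longrightarrow> norm (\<phi> x ^ j) \<le> C0; \<And>x::real. \<bar>x\<bar> \<le> 1 \<Longrightarrow> norm (\<phi> x ^ Suc j) \<le> C0;
       \<And>x::real. \<bar>x\<bar> \<le> 1 \<Longrightarrow> norm (\<phi> x ^ j - (\<Sum>i<k. p i * of_real x ^ i)) \<le> C0 * (1 / K) ^ k * w k * \<bar>x\<bar> ^ k;
       \<And>x::real. \<bar>x\<bar> \<le> 1 \<Longrightarrow> norm (\<phi> x ^ Suc j - (\<Sum>i<k. q i * of_real x ^ i)) \<le> C0 * (1 / K) ^ k * w k * \<bar>x\<bar> ^ k\<rbrakk> \<Longrightarrow>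
       \<exists>F. F holomorphic_on ball 0 (1/2) \<and> (\<forall>z\<in>ball 0 (1/2). norm (F z) \<le> L) \<and>
         (\<forall>x::real. \<bar>x\<bar> < 1/2 \<longrightarrow> norm (F (of_real x) - \<phi> x) \<le> L * root (4 * j * Suc j) (w k))"
      using local_approximation[OF j C0(1)] unfolding K_def by blast
    define A where "A = (\<lambda>l. L * (a l * (2 * K * \<sigma>) ^ l))"
    have A0: "A l \<ge> 0" for l using L a0[of l] K \<sigma> by (simp add: A_def)
    \<comment> \<open>Taylor expansion at \<open>x0\<close> uses radius
      \<open>2 * \<epsilon>\<close>, at most \<open>r\<close>, so it stays inside the interval of
      twice the size.\<close>
    define \<epsilon>0 where "\<epsilon>0 = r / 2"
    have \<epsilon>0: "\<epsilon>0 > 0" using r by (simp add: \<epsilon>0_def)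
    have approx: "\<exists>F. F holomorphic_on ball (of_real x0) \<epsilon> \<and> (\<forall>z\<in>ball (of_real x0) \<epsilon>. norm (F z) \<le> L) \<and>
        (\<forall>x l. \<bar>x - x0\<bar> < \<epsilon> \<longrightarrow> norm (F (of_real x) - f x) \<le> (A l * \<epsilon> ^ l) ^ 4)"
      if x0: "x0 \<in> ?S" and \<epsilon>: "0 < \<epsilon>" "\<epsilon> \<le> \<epsilon>0" for x0 \<epsilon>
    proof -
      \<comment> \<open>The local approximants live on radius 1/2, hence the unit is
        \<open>2 * \<epsilon>\<close>. The factor \<open>K\<close> makes the rescaled coefficients
        exhibit the geometric factor (1 / K)^i that the local lemma demands.\<close>
      define t where "t = 2 * K * \<sigma> * \<epsilon>"
      have t: "t > 0" using K \<sigma> \<epsilon> by (simp add: t_def)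
      obtain k where k: "\<And>i. i < k \<Longrightarrow> lower M (Suc i) * t \<le> lower M i" "\<And>l. lower M k * t ^ k \<le> (a l * t ^ l) ^ p"
        using adk[OF t] by blast
      define w where "w = (\<lambda>i. lower M i * t ^ i)"
      have w: "w 0 = 1" "\<And>i. w i > 0" using lM t by (auto simp: w_def)
      have wdec: "w (Suc i) \<le> w i" if "i < k" for i
        using mult_right_mono[OF k(1)[OF that], of "t ^ i"] t by (simp add: w_def mult_ac)
      have wmult: "w i * w i' \<le> 2 ^ (i + i') * w (i + i')" for i i'
        using mult_right_mono[OF lM(3)[of i i'], of "t ^ (i + i')"] t by (simp add: w_def power_add mult_ac)
      have w1: "w i \<le> 1" if "i \<le> k" for i
        using that
      proof (induction i)
        case (Suc i)
        then show ?case using wdec[of i] by linarith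
      qed (simp add: w)
      have wK: "\<sigma> ^ i * M i * (2 * \<epsilon>) ^ i / fact i = (1 / K) ^ i * w i" for i
      proof -
        have "(1 / K) ^ i * t ^ i = (2 * \<epsilon> * \<sigma>) ^ i" unfolding power_mult_distrib[symmetric] using K by (simp add: t_def mult_ac)
        then have "(1 / K) ^ i * w i = lower M i * (2 * \<epsilon> * \<sigma>) ^ i" by (simp add: w_def mult_ac)
        then show ?thesis by (simp add: lower_def power_mult_distrib mult_ac)
      qed
      have inJ: "y \<in> ?J" if "y \<in> {x0 - 2 * \<epsilon>..x0 + 2 * \<epsilon>}" for y using that x0 \<epsilon> by (auto simp: \<epsilon>0_def)
      have x0J: "x0 \<in> {x0 - 2 * \<epsilon>..x0 + 2 * \<epsilon>}" using \<epsilon> by simp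
      have xJ: "x0 + 2 * \<epsilon> * x \<in> {x0 - 2 * \<epsilon>..x0 + 2 * \<epsilon>}" if "\<bar>x\<bar> \<le> 1" for x
      proof -
        have "\<bar>2 * \<epsilon> * x\<bar> \<le> 2 * \<epsilon> * 1" unfolding abs_mult using \<epsilon> that by (intro mult_mono) auto
        then show ?thesis by (simp add: abs_le_iff)
      qed
      define co where "co = (\<lambda>(D :: nat \<Rightarrow> real \<Rightarrow> complex) i. D i x0 * of_real ((2 * \<epsilon>) ^ i / fact i))"
      define \<phi> where "\<phi> = (\<lambda>x. f (x0 + 2 * \<epsilon> * x))"
      have co: "norm (co D i) \<le> C0 * (1 / K) ^ i * w i" if "norm (D i x0) \<le> C0 * (\<sigma> ^ i * M i)" for D i
      proof -
        have "norm (co D i) = norm (D i x0) * ((2 * \<epsilon>) ^ i / fact i)" using \<epsilon> unfolding co_def norm_mult by (simp only: norm_of_real) simp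
        also have "\<dots> \<le> C0 * (\<sigma> ^ i * M i) * ((2 * \<epsilon>) ^ i / fact i)" using that \<epsilon> by (intro mult_right_mono) auto
        also have "\<dots> = C0 * (\<sigma> ^ i * M i * (2 * \<epsilon>) ^ i / fact i)" by simp
        finally show ?thesis unfolding wK by (simp add: mult_ac)
      qed
      have tay: "norm (D 0 (x0 + 2 * \<epsilon> * x) - (\<Sum>i<k. co D i * of_real x ^ i)) \<le> C0 * (1 / K) ^ k * w k * \<bar>x\<bar> ^ k"
        if D: "\<And>i y. y \<in> ?J \<Longrightarrow> (D i has_vector_derivative D (Suc i) y) (at y)" "\<And>i y. y \<in> ?J \<Longrightarrow> norm (D i y) \<le> C0 * (\<sigma> ^ i * M i)"
          and x: "\<bar>x\<bar> \<le> 1" for D x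
      proof -
        have "norm (D 0 (x0 + 2 * \<epsilon> * x) - (\<Sum>i<k. D i x0 * of_real ((x0 + 2 * \<epsilon> * x - x0) ^ i / fact i)))
            \<le> C0 * (\<sigma> ^ k * M k) * \<bar>x0 + 2 * \<epsilon> * x - x0\<bar> ^ k / fact k"
          by (rule taylor_remainder_complex[where D = D and k = k, OF D(1)[OF inJ] D(2)[OF inJ] xJ[OF x] x0J])
        moreover have "D i x0 * of_real ((x0 + 2 * \<epsilon> * x - x0) ^ i / fact i) = co D i * of_real x ^ i" for i
          by (simp add: co_def power_mult_distrib)
        moreover have "C0 * (\<sigma> ^ k * M k) * \<bar>x0 + 2 * \<epsilon> * x - x0\<bar> ^ k / fact k = C0 * (\<sigma> ^ k * M k * (2 * \<epsilon>) ^ k / fact k) * \<bar>x\<bar> ^ k"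
          using \<epsilon> by (simp add: abs_mult power_mult_distrib)
        ultimately show ?thesis unfolding wK by (simp add: mult_ac)
      qed
      have zero: "norm z \<le> C0" if "norm z \<le> C0 * (\<sigma> ^ 0 * M 0)" for z :: complex
        using that weight_sequence_props(1)[OF M] by simp
      have g0: "\<phi> x ^ j = Dg 0 (x0 + 2 * \<epsilon> * x)" and h0: "\<phi> x ^ Suc j = Dh 0 (x0 + 2 * \<epsilon> * x)" if "\<bar>x\<bar> \<le> 1" for x
        using Dg(1)[OF inJ[OF xJ[OF that]]] Dh(1)[OF inJ[OF xJ[OF that]]] by (simp_all add: \<phi>_def)
      have "\<exists>F. F holomorphic_on ball 0 (1/2) \<and> (\<forall>z\<in>ball 0 (1/2). norm (F z) \<le> L) \<and>
         (\<forall>x::real. \<bar>x\<bar> < 1/2 \<longrightarrow> norm (F (of_real x) - \<phi> x) \<le> L * root (4 * j * Suc j) (w k))"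
      proof (rule loc[of w k "co Dg" "co Dh" \<phi>, OF w wdec wmult])
        show "norm (co Dg i) \<le> C0 * (1 / K) ^ i * w i" for i by (rule co[where D = Dg, OF gb[OF inJ[OF x0J]]])
        show "norm (co Dh i) \<le> C0 * (1 / K) ^ i * w i" for i by (rule co[where D = Dh, OF hb[OF inJ[OF x0J]]])
        fix x :: real assume x: "\<bar>x\<bar> \<le> 1"
        show "norm (\<phi> x ^ j) \<le> C0" unfolding g0[OF x] by (rule zero[OF gb[OF inJ[OF xJ[OF x]]]])
        show "norm (\<phi> x ^ Suc j) \<le> C0" unfolding h0[OF x] by (rule zero[OF hb[OF inJ[OF xJ[OF x]]]])
        show "norm (\<phi> x ^ j - (\<Sum>i<k. co Dg i * of_real x ^ i)) \<le> C0 * (1 / K) ^ k * w k * \<bar>x\<bar> ^ k"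
          unfolding g0[OF x] by (rule tay[where D = Dg, OF Dg(2) gb x])
        show "norm (\<phi> x ^ Suc j - (\<Sum>i<k. co Dh i * of_real x ^ i)) \<le> C0 * (1 / K) ^ k * w k * \<bar>x\<bar> ^ k"
          unfolding h0[OF x] by (rule tay[where D = Dh, OF Dh(2) hb x])
      qed
      then obtain F where F: "F holomorphic_on ball 0 (1/2)" "\<And>z. z \<in> ball 0 (1/2) \<Longrightarrow> norm (F z) \<le> L"
        "\<And>x::real. \<bar>x\<bar> < 1/2 \<Longrightarrow> norm (F (of_real x) - \<phi> x) \<le> L * root (4 * j * Suc j) (w k)" by blast
      define F' where "F' = (\<lambda>z. F ((z - of_real x0) / of_real (2 * \<epsilon>)))"
      have sc: "(z - of_real x0) / of_real (2 * \<epsilon>) \<in> ball 0 (1/2)" if "z \<in> ball (of_real x0) \<epsilon>" for z :: complex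
        using that \<epsilon> by (simp add: norm_divide dist_norm norm_minus_commute field_simps)
      show ?thesis
      proof (intro exI[of _ F'] conjI ballI allI impI)
        have "(F \<circ> (\<lambda>z. (z - of_real x0) / of_real (2 * \<epsilon>))) holomorphic_on ball (of_real x0) \<epsilon>"
          using \<epsilon> sc by (intro holomorphic_on_compose_gen[OF _ F(1)] holomorphic_intros) auto
        then show "F' holomorphic_on ball (of_real x0) \<epsilon>" by (simp add: F'_def o_def)
        show "norm (F' z) \<le> L" if "z \<in> ball (of_real x0) \<epsilon>" for z unfolding F'_def by (rule F(2)[OF sc[OF that]])
        fix x l assume x: "\<bar>x - x0\<bar> < \<epsilon>"
        define y where "y = (x - x0) / (2 * \<epsilon>)"
        have y: "\<bar>y\<bar> < 1/2" "x0 + 2 * \<epsilon> * y = x" using x \<epsilon> by (auto simp: y_def abs_divide field_simps)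
        let ?X = "a l * t ^ l"
        have X0: "?X \<ge> 0" using a0[of l] t by simp
        have "F' (of_real x) - f x = F (of_real y) - \<phi> y" by (simp add: F'_def \<phi>_def y(2)) (simp add: y_def)
        then have "norm (F' (of_real x) - f x) \<le> L * root (4 * j * Suc j) (w k)" using F(3)[OF y(1)] by simp
        also have "\<dots> \<le> L * ?X ^ 4"
        proof -
          have "root (4 * j * Suc j) (w k) \<le> ?X ^ 4"
          proof (rule root_le_power4)
            show "w k \<le> ?X ^ p" using k(2) by (simp add: w_def)
            show "4 * (4 * j * Suc j) \<le> p" using p by simp
            show "0 \<le> w k" using w(2)[of k] by simp
          qed (use j w1[of k] X0 in auto)
          then show ?thesis using L by (intro mult_left_mono) auto
        qed
        also have "\<dots> \<le> L ^ 4 * ?X ^ 4" using L self_le_power[of L 4] by (intro mult_right_mono) auto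
        also have "\<dots> = (A l * \<epsilon> ^ l) ^ 4" by (simp add: A_def t_def power_mult_distrib mult_ac)
        finally show "norm (F' (of_real x) - f x) \<le> (A l * \<epsilon> ^ l) ^ 4" .
      qed
    qed
    have S: "open ?S" "is_interval ?S" by (auto simp: is_interval_convex_1)
    obtain D where D: "\<And>x. x \<in> ?S \<Longrightarrow> D 0 x = f x" "\<And>l x. x \<in> ?S \<Longrightarrow> (D l has_vector_derivative D (Suc l) x) (at x)"
      "\<And>l x. x \<in> ?S \<Longrightarrow> norm (D l x) \<le> fact l * L * (2 / \<epsilon>0) ^ l + 2 * (fact l * 16 ^ l * 2 * L * A (Suc l)) * \<epsilon>0"
      using smooth_of_local_approximations[OF S L \<epsilon>0 A0 approx] by blast
    \<comment> \<open>The contribution of the coarsest scale is l! times a geometric term, unrelated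
      to the sequences; it is absorbed because \<open>lower N\<close> outgrows every geometric
      sequence.\<close>
    obtain C3 where C3: "C3 > 0" "\<And>l. (2 / (\<epsilon>0 * \<rho>)) ^ l \<le> C3 * lower N l"
      using power_le_const_mult[OF limN lower_props(2)[OF N], of "2 / (\<epsilon>0 * \<rho>)"] \<epsilon>0 \<rho>0 by auto
    define C4 where "C4 = L * C3 + 4 * L * \<epsilon>0 * L * (2 * K * \<sigma> * C)"
    have "norm (D l x) / (\<rho> ^ l * N l) \<le> C4" if "x \<in> ?S" for l x
    proof -
      have e1: "fact l * L * (2 / \<epsilon>0) ^ l \<le> L * C3 * (\<rho> ^ l * N l)"
      proof -
        have "fact l * L * (2 / \<epsilon>0) ^ l = fact l * L * \<rho> ^ l * (2 / (\<epsilon>0 * \<rho>)) ^ l" using \<rho>0 by (simp add: power_divide power_mult_distrib)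
        also have "\<dots> \<le> fact l * L * \<rho> ^ l * (C3 * lower N l)" using L \<rho>0 by (intro mult_left_mono C3(2)) auto
        also have "\<dots> = L * C3 * (\<rho> ^ l * N l)" by (simp add: lower_def)
        finally show ?thesis .
      qed
      have e2: "2 * (fact l * 16 ^ l * 2 * L * A (Suc l)) * \<epsilon>0 \<le> 4 * L * \<epsilon>0 * L * (2 * K * \<sigma> * C) * (\<rho> ^ l * N l)"
      proof -
        have "2 * (fact l * 16 ^ l * 2 * L * A (Suc l)) * \<epsilon>0 = (4 * L * \<epsilon>0 * L) * 16 ^ l * (2 * K * \<sigma>) ^ Suc l * (fact l * a (Suc l))"
          by (simp add: A_def)
        also have "\<dots> \<le> (4 * L * \<epsilon>0 * L) * 16 ^ l * (2 * K * \<sigma>) ^ Suc l * (C ^ Suc l * N l)"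
          using L \<epsilon>0 K \<sigma> by (intro mult_left_mono aN) auto
        also have "\<dots> = 4 * L * \<epsilon>0 * L * (2 * K * \<sigma> * C) * ((H * \<sigma>) ^ l * N l)"
        proof -
          have "(H * \<sigma>) ^ l = 16 ^ l * (2 * K * \<sigma>) ^ l * C ^ l" unfolding power_mult_distrib[symmetric] H_def by (simp add: mult_ac)
          then show ?thesis by (simp add: mult_ac)
        qed
        also have "\<dots> \<le> 4 * L * \<epsilon>0 * L * (2 * K * \<sigma> * C) * (\<rho> ^ l * N l)"
          using \<rho> H \<sigma> L \<epsilon>0 K C Npos[of l] by (intro mult_left_mono mult_right_mono power_mono) auto
        finally show ?thesis .
      qed
      have "norm (D l x) \<le> C4 * (\<rho> ^ l * N l)" using D(3)[OF that, of l] e1 e2 unfolding C4_def by (simp only: distrib_right)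
      moreover have "\<rho> ^ l * N l > 0" using \<rho>0 Npos[of l] by simp
      ultimately show ?thesis by (simp only: pos_divide_le_eq)
    qed
    then show "B_class N \<rho> ?S f" unfolding B_class_def using D by blast
  qed
qed

section \<open>From classes on intervals to germs\<close>

lemma B_class_mono:
  assumes f: "B_class M \<sigma> U f" and V: "V \<subseteq> U" and \<sigma>: "0 < \<sigma>" "\<sigma> \<le> \<sigma>'" and M: "\<And>k. M k > 0" "\<And>k. M k \<le> M' k"
  shows "B_class M' \<sigma>' V f"
proof -
  obtain D C where D: "\<forall>x\<in>U. D 0 x = f x" "\<forall>k. \<forall>x\<in>U. (D k has_vector_derivative D (Suc k) x) (at x)"
    "\<And>k x. x \<in> U \<Longrightarrow> norm (D k x) / (\<sigma> ^ k * M k) \<le> C" using f unfolding B_class_def by blast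
  have "norm (D k x) / (\<sigma>' ^ k * M' k) \<le> C" if "x \<in> V" for k x
  proof -
    have "\<sigma> ^ k * M k \<le> \<sigma>' ^ k * M' k" using \<sigma> M(1)[of k] M(2)[of k] by (intro mult_mono power_mono) auto
    moreover have "0 < \<sigma> ^ k * M k" using \<sigma> M(1)[of k] by simp
    ultimately have "norm (D k x) / (\<sigma>' ^ k * M' k) \<le> norm (D k x) / (\<sigma> ^ k * M k)" by (intro divide_left_mono) auto
    also have "\<dots> \<le> C" using D(3) V that by blast
    finally show ?thesis .
  qed
  then show ?thesis unfolding B_class_def using D(1,2) V by blast
qed

lemma rel_compact_open_interval:
  assumes "open U" "0 \<in> U" "open U'" "0 \<in> U'"
  obtains r :: real where "r > 0" "rel_compact_open {-2*r<..<2*r} U" "rel_compact_open {-2*r<..<2*r} U'"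
proof -
  have "open (U \<inter> U')" "0 \<in> U \<inter> U'" using assms by auto
  then obtain e where e: "e > 0" "cball 0 e \<subseteq> U \<inter> U'" using open_contains_cball by blast
  show ?thesis
  proof
    show "e / 2 > 0" using e by simp
    have "closure {-2*(e/2)<..<2*(e/2)} = cball 0 e" using e by (auto simp: dist_real_def)
    then show "rel_compact_open {-2*(e/2)<..<2*(e/2)} U" "rel_compact_open {-2*(e/2)<..<2*(e/2)} U'"
      using e unfolding rel_compact_open_def by auto
  qed
qed

lemma rel_compact_open_subset: "rel_compact_open V U \<Longrightarrow> V \<subseteq> U"
  using closure_subset by (auto simp: rel_compact_open_def)

theorem theorem4p2:
  fixes MM :: "(nat \<Rightarrow> real) set"
  assumes "weight_matrix MM"
  shows "(R_regular MM \<and> R_moderate_growth MM \<longrightarrow> property_D (germ_roumieu MM)) \<and>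
         (B_regular MM \<and> B_moderate_growth MM \<longrightarrow> property_D (germ_beurling MM))"
proof -
  have ws: "weight_sequence M" if "M \<in> MM" for M using assms that by (simp add: weight_matrix_def)
  have pos: "M k > 0" if "M \<in> MM" for M k using weight_sequence_props(2)[OF ws[OF that]] .
  \<comment> \<open>Doubling yields powers of two only, so the required exponent is majorized
    crudely by n \<le> 2^n.\<close>
  have exponent: "16 * j * Suc j \<le> 2 ^ (16 * j * Suc j)" for j :: nat by (simp add: less_imp_le)
  have roumieu: "germ_roumieu MM f"
    if R: "R_regular MM" "R_moderate_growth MM" and j: "j \<ge> 1"
      and g: "germ_roumieu MM (\<lambda>x. f x ^ j)" and h: "germ_roumieu MM (\<lambda>x. f x ^ Suc j)" for f :: "real \<Rightarrow> complex" and j :: nat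
  proof -
    obtain U where U: "open U" "0 \<in> U" "E_roumieu MM U (\<lambda>x. f x ^ j)" using g by (auto simp: germ_roumieu_def)
    obtain U' where U': "open U'" "0 \<in> U'" "E_roumieu MM U' (\<lambda>x. f x ^ Suc j)" using h unfolding germ_roumieu_def by blast
    obtain r where r: "r > 0" "rel_compact_open {-2*r<..<2*r} U" "rel_compact_open {-2*r<..<2*r} U'"
      using rel_compact_open_interval[OF U(1,2) U'(1,2)] by blast
    have "B_roumieu MM {-2*r<..<2*r} (\<lambda>x. f x ^ j)" using U(3) r(2) unfolding E_roumieu_def by blast
    then obtain M1 s1 where g1: "M1 \<in> MM" "s1 > 0" "B_class M1 s1 {-2*r<..<2*r} (\<lambda>x. f x ^ j)" unfolding B_roumieu_def by blast
    have "B_roumieu MM {-2*r<..<2*r} (\<lambda>x. f x ^ Suc j)" using U'(3) r(3) unfolding E_roumieu_def by blast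
    then obtain M2 s2 where h1: "M2 \<in> MM" "s2 > 0" "B_class M2 s2 {-2*r<..<2*r} (\<lambda>x. f x ^ Suc j)" unfolding B_roumieu_def by blast
    \<comment> \<open>The two powers may come with different sequences; the total order of the
      matrix supplies one that serves both.\<close>
    obtain M where M: "M \<in> MM" "\<And>k. M1 k \<le> M k" "\<And>k. M2 k \<le> M k"
    proof -
      have "(\<forall>k. M1 k \<le> M2 k) \<or> (\<forall>k. M2 k \<le> M1 k)" using assms g1(1) h1(1) by (simp add: weight_matrix_def)
      then show ?thesis using that g1(1) h1(1) by blast
    qed
    define s where "s = max s1 s2"
    have s: "s > 0" "s1 \<le> s" "s2 \<le> s" using g1(2) by (auto simp: s_def)
    have g2: "B_class M s {-2*r<..<2*r} (\<lambda>x. f x ^ j)" by (rule B_class_mono[OF g1(3) _ g1(2) s(2) pos[OF g1(1)] M(2)]) simp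
    have h2: "B_class M s {-2*r<..<2*r} (\<lambda>x. f x ^ Suc j)" by (rule B_class_mono[OF h1(3) _ h1(2) s(3) pos[OF h1(1)] M(3)]) simp
    obtain N where N: "N \<in> MM" "adapted (2 ^ (16 * j * Suc j)) M N" using R_adapted[OF assms R M(1)] by blast
    have limN: "filterlim (\<lambda>k. lower N k powr (1 / real k)) at_top sequentially" using R(1) N(1) by (simp add: R_regular_def)
    obtain H where H: "H > 0"
      and cls: "\<And>\<sigma> r f \<rho>. \<lbrakk>\<sigma> > 0; r > 0; B_class M \<sigma> {-2*r<..<2*r} (\<lambda>x. f x ^ j); B_class M \<sigma> {-2*r<..<2*r} (\<lambda>x. f x ^ Suc j); \<rho> \<ge> H * \<sigma>\<rbrakk>
       \<Longrightarrow> B_class N \<rho> {-r<..<r} f"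
      using B_class_root[OF j ws[OF M(1)] ws[OF N(1)] limN N(2) exponent] by blast
    have fN: "B_class N (H * s) {-r<..<r} f" by (rule cls[OF s(1) r(1) g2 h2 order_refl])
    have Hs: "H * s > 0" using H s by simp
    have "E_roumieu MM {-r<..<r} f"
      unfolding E_roumieu_def B_roumieu_def
    proof (intro allI impI bexI[OF _ N(1)] exI[of _ "H * s"] conjI Hs)
      fix V assume "rel_compact_open V {-r<..<r}"
      then show "B_class N (H * s) V f"
        by (intro B_class_mono[OF fN rel_compact_open_subset Hs order_refl pos[OF N(1)] order_refl])
    qed
    then show ?thesis unfolding germ_roumieu_def using r(1) by (intro exI[of _ "{-r<..<r}"]) auto
  qed
  have beurling: "germ_beurling MM f"
    if R: "B_regular MM" "B_moderate_growth MM" and j: "j \<ge> 1"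
      and g: "germ_beurling MM (\<lambda>x. f x ^ j)" and h: "germ_beurling MM (\<lambda>x. f x ^ Suc j)" for f :: "real \<Rightarrow> complex" and j :: nat
  proof -
    obtain U where U: "open U" "0 \<in> U" "E_beurling MM U (\<lambda>x. f x ^ j)" using g by (auto simp: germ_beurling_def)
    obtain U' where U': "open U'" "0 \<in> U'" "E_beurling MM U' (\<lambda>x. f x ^ Suc j)" using h unfolding germ_beurling_def by blast
    obtain r where r: "r > 0" "rel_compact_open {-2*r<..<2*r} U" "rel_compact_open {-2*r<..<2*r} U'"
      using rel_compact_open_interval[OF U(1,2) U'(1,2)] by blast
    \<comment> \<open>A germ needs one domain for all \<open>N\<close> and \<open>\<rho>\<close>;
      \<open>r\<close> depends only on the neighbourhoods of the two powers, whereas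
      \<open>M\<close> and \<open>H\<close> may vary with \<open>N\<close>.\<close>
    have fN: "B_class N \<rho> {-r<..<r} f" if N: "N \<in> MM" and \<rho>: "\<rho> > 0" for N \<rho>
    proof -
      obtain M where M: "M \<in> MM" "adapted (2 ^ (16 * j * Suc j)) M N" using B_adapted[OF assms R N] by blast
      have limN: "filterlim (\<lambda>k. lower N k powr (1 / real k)) at_top sequentially" using R(1) N by (simp add: B_regular_def)
      obtain H where H: "H > 0"
        and cls: "\<And>\<sigma> r f \<rho>. \<lbrakk>\<sigma> > 0; r > 0; B_class M \<sigma> {-2*r<..<2*r} (\<lambda>x. f x ^ j); B_class M \<sigma> {-2*r<..<2*r} (\<lambda>x. f x ^ Suc j); \<rho> \<ge> H * \<sigma>\<rbrakk>
         \<Longrightarrow> B_class N \<rho> {-r<..<r} f"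
        using B_class_root[OF j ws[OF M(1)] ws[OF N] limN M(2) exponent] by blast
      have s: "\<rho> / H > 0" "H * (\<rho> / H) \<le> \<rho>" using H \<rho> by auto
      have "B_class M (\<rho> / H) {-2*r<..<2*r} (\<lambda>x. f x ^ j)" "B_class M (\<rho> / H) {-2*r<..<2*r} (\<lambda>x. f x ^ Suc j)"
        using U(3) r(2) U'(3) r(3) M(1) s(1) unfolding E_beurling_def B_beurling_def by blast+
      from cls[OF s(1) r(1) this s(2)] show ?thesis .
    qed
    have "E_beurling MM {-r<..<r} f"
      unfolding E_beurling_def B_beurling_def
    proof (intro allI impI ballI)
      fix V N and \<rho> :: real assume "rel_compact_open V {-r<..<r}" "N \<in> MM" "\<rho> > 0"
      then show "B_class N \<rho> V f"
        by (intro B_class_mono[OF fN rel_compact_open_subset _ order_refl pos order_refl])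
    qed
    then show ?thesis unfolding germ_beurling_def using r(1) by (intro exI[of _ "{-r<..<r}"]) auto
  qed
  show ?thesis unfolding property_D_def using roumieu beurling by blast
qed

end
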